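(* Let $T>0$ and $\ell\in\mathbb{N}$ be fixed. Let $X$, $B$, $Y$ be Banach spaces such that the embedding $X\hookrightarrow B$ is compact and the embedding $B\hookrightarrow Y$ is continuous. Let $u_0\in X$, and let $\{\mathcal{T}_\tau\}_{\tau>0}$ be a family of partitions of $(0,T)$ with maximum time step $\tau\to 0^+$, for which there is a constant $C_\star>0$ such that, for all $\tau$ and all $n=2,\dots,N_\tau$, $\tau_n/\tau_{n-1}\le C_\star$. For each $\tau$, let $X_\tau$ be a subspace of $X$ and let $u_\tau\in\mathcal{P}_\tau^\ell(X_\tau)$. Let $\mathcal{R}_\tau u_\tau$ denote the time reconstruction of $u_\tau$ with initial datum $u_0$, and let $[\![u_\tau]\!]_{n-1}$, $n=1,\dots,N_\tau$, denote the time jumps of $u_\tau$, where $[\![u_\tau]\!]_0=u_\tau(\cdot,0^+)-u_0$ (all as defined in the context). Assume that: (h1) $\{u_\tau\}_{\tau>0}$ is uniformly bounded in $L^p(0,T;X)$ for some $p\in[1,\infty]$. (h2) $\{\partial_t\mathcal{R}_\tau u_\tau\}_{\tau>0}$ is uniformly bounded in $L^r(0,T;Y)$ for some $r\in[1,\infty]$. (h3) There exists a constant $C_J>0$ independent of $\tau$ such that $\sum_{n=1}^{N_\tau}\|[\![u_\tau]\!]_{n-1}\|_B^2\le C_J$ for all $\tau$. Then the following hold: (i) If $1\le p<\infty$, then $\{u_\tau\}_{\tau>0}$ is relatively compact in $L^p(0,T;B)$. (ii) If $p=\infty$ and $r>1$, then there exists a subsequence of $\{u_\tau\}_{\tau>0}$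 that converges strongly in $L^q(0,T;B)$ for all $1\le q<\infty$ to a function belonging to $C^0([0,T];B)$. (iii) Suppose that $X\hookrightarrow B$ and $B\hookrightarrow Y$ continuously, that $X\hookrightarrow Y$ compactly, and that for some $\theta\in(0,1)$ there exists $C_\theta>0$ such that $\|u\|_B\le C_\theta\|u\|_X^{\theta}\|u\|_Y^{1-\theta}$ for all $u\in X$. Then $\{u_\tau\}_{\tau>0}$ is relatively compact in $L^q(0,T;B)$ for all $$1\le q<\frac{rp}{(1-\theta)(1-r)p+\theta r},$$ provided that $(r-1)p/r\le\theta/(1-\theta)$.
   Context: Partitions. Each $\mathcal{T}_\tau$ is a partition of $(0,T)$ determined by nodes $0=t_0<t_1<\dots<t_{N_\tau}=T$. For $n=1,\dots,N_\tau$ set $I_n=(t_{n-1},t_n)$ and $\tau_n=t_n-t_{n-1}$. The index $\tau$ denotes the maximum time step, $\tau=\max_{1\le n\le N_\tau}\tau_n$. The family $\{\mathcal{T}_\tau\}$ is viewed as a sequence along which $\tau\to0^+$. The nodes and time steps depend on $\tau$. Piecewise polynomials. For a vector space $Z$, $\mathcal{P}^\ell(I_n)$ is the space of polynomials of degree at most $\ell$ on $I_n$, $\otimes$ is the algebraic tensor product, and $\mathcal{P}_\tau^\ell(Z)$ is the space of functions $v$ on $(0,T)$ with values in $Z$, integrable in time, with $v|_{I_n}\in\mathcal{P}^\ell(I_n)\otimes Z$ for each $n=1,\dots,N_\tau$. No continuity across the nodes is required. For Banach $Z$, $\mathcal{P}_\tau^{\ell,\mathrm{cont}}(Z)=\mathcal{P}_\tau^\ell(Z)\cap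 C^0([0,T];Z)$. Functions in $\mathcal{P}^\ell_\tau(X_\tau)$ are regarded as functions in $\mathcal{P}^\ell_\tau(X)$. Jumps. For $v\in\mathcal{P}_\tau^\ell(X)$ and $1\le n\le N_\tau-1$, $[\![v]\!]_n=v(\cdot,t_n^+)-v(\cdot,t_n^-)$, where $v(\cdot,t_n^\pm)=\lim_{\varepsilon\to0^+}v(\cdot,t_n\pm\varepsilon)$. With the fixed initial datum $u_0\in X$, $[\![v]\!]_0=v(\cdot,0^+)-u_0$. Time reconstruction. Let $L_{n,i}$ be the $i$th Legendre polynomial mapped to $I_n$, i.e. $L_{n,i}(t)=L_i\big((2t-t_{n-1}-t_n)/\tau_n\big)$ with $L_i$ the standard Legendre polynomial on $(-1,1)$ normalized by $L_i(1)=1$. For $z\in X$, the lifting $\mathcal{L}_\tau(z)\in\mathcal{P}_\tau^\ell(X)$ is defined by $$\mathcal{L}_\tau(z)(\cdot,t)=\frac{z}{\tau_n}\sum_{i=0}^{\ell}(-1)^i(2i+1)L_{n,i}(t),\qquad t\in I_n,\ n=1,\dots,N_\tau.$$ The reconstruction operator $\mathcal{R}_\tau:\mathcal{P}_\tau^\ell(X)\to\mathcal{P}_\tau^{\ell+1,\mathrm{cont}}(X)$ is defined for $t\in\overline{I_n}$, $n=1,\dots,N_\tau$, by $$\mathcal{R}_\tau v(\cdot,t)=v(\cdot,t)-[\![v]\!]_{n-1}+\int_{t_{n-1}}^t\mathcal{L}_\tau([\![v]\!]_{n-1})(\cdot,s)\,ds,$$ where $v(\cdot,t)$ at the endpoints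 of $I_n$ means the one-sided limit from inside $I_n$. It is a known fact that $\mathcal{R}_\tau v$ is continuous on $[0,T]$. Since $\mathcal{R}_\tau v$ is continuous and piecewise polynomial, its time derivative $\partial_t\mathcal{R}_\tau v$ is the piecewise derivative. It is regarded as a $Y$-valued function through $X\hookrightarrow B\hookrightarrow Y$. Conventions. Spaces $L^p(0,T;Z)$ are Bochner spaces. "Relatively compact" means that any sequence in the set has a subsequence converging strongly in the indicated space. In (iii), if $p=\infty$ or $r=\infty$, the two conditions are read in the reciprocal form $\frac1q>(1-\theta)\left(\frac1r-1\right)+\frac{\theta}{p}$ and $(1-\theta)\left(\frac1r-1\right)+\frac{\theta}{p}\ge0$ with $1/\infty=0$ (equivalent to the printed form for finite $p,r$). If the denominator in the bound for $q$ is zero, the bound means $q<\infty$. *)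

theory Defs
  imports
    "HOL-Probability.Essential_Supremum"
    "HOL-Computational_Algebra.Polynomial"
begin

section \<open>Embeddings of Banach spaces\<close>

text \<open>The spaces are separate types; an embedding is an explicit injective bounded linear map.\<close>

definition continuous_embedding :: "('a::real_normed_vector \<Rightarrow> 'b::real_normed_vector) \<Rightarrow> bool" where
  "continuous_embedding i \<longleftrightarrow> bounded_linear i \<and> inj i"

definition compact_embedding :: "('a::real_normed_vector \<Rightarrow> 'b::real_normed_vector) \<Rightarrow> bool" where
  "compact_embedding i \<longleftrightarrow>
     continuous_embedding i \<and> (\<forall>S. bounded S \<longrightarrow> compact (closure (i ` S)))"

section \<open>Bochner spaces on \<open>(0,T)\<close>\<close>

text \<open>
  The Bochner integral of the library needs a second countable range space, which is not assumed
  here. Strong (Bochner) measurability is therefore spelled out, and the integrals and essential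
  suprema below are those of the scalar function \<open>\<lambda>t. norm (f t)\<close>. Functions are not
  identified up to null sets.
\<close>

definition strongly_measurable :: "'t measure \<Rightarrow> ('t \<Rightarrow> 'a::real_normed_vector) \<Rightarrow> bool" where
  "strongly_measurable M f \<longleftrightarrow>
     (\<exists>s. (\<forall>i::nat. simple_function M (s i)) \<and> (AE t in M. (\<lambda>i. s i t) \<longlonglongrightarrow> f t))"

definition Lp_space :: "ereal \<Rightarrow> real \<Rightarrow> (real \<Rightarrow> 'a::real_normed_vector) set" where
  "Lp_space p T =
     {f. strongly_measurable (lebesgue_on {0<..<T}) f \<and>
         (if p = \<infinity> then esssup (lebesgue_on {0<..<T}) (\<lambda>t. ereal (norm (f t))) < \<infinity>
          else integrable (lebesgue_on {0<..<T}) (\<lambda>t. norm (f t) powr real_of_ereal p))}"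

text \<open>Meaningful for members of \<open>Lp_space p T\<close> only.\<close>

definition Lp_norm :: "ereal \<Rightarrow> real \<Rightarrow> (real \<Rightarrow> 'a::real_normed_vector) \<Rightarrow> real" where
  "Lp_norm p T f =
     (if p = \<infinity> then real_of_ereal (esssup (lebesgue_on {0<..<T}) (\<lambda>t. ereal (norm (f t))))
      else (\<integral>t. norm (f t) powr real_of_ereal p \<partial>lebesgue_on {0<..<T}) powr (1 / real_of_ereal p))"

definition uniformly_bounded_Lp ::
    "ereal \<Rightarrow> real \<Rightarrow> (nat \<Rightarrow> real \<Rightarrow> 'a::real_normed_vector) \<Rightarrow> bool" where
  "uniformly_bounded_Lp p T F \<longleftrightarrow> (\<exists>C. \<forall>k. F k \<in> Lp_space p T \<and> Lp_norm p T (F k) \<le> C)"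

definition converges_Lp ::
    "ereal \<Rightarrow> real \<Rightarrow> (nat \<Rightarrow> real \<Rightarrow> 'a::real_normed_vector) \<Rightarrow> (real \<Rightarrow> 'a) \<Rightarrow> bool" where
  "converges_Lp p T F g \<longleftrightarrow>
     (\<forall>k. F k \<in> Lp_space p T) \<and> g \<in> Lp_space p T \<and>
     (\<lambda>k. Lp_norm p T (\<lambda>t. F k t - g t)) \<longlonglongrightarrow> 0"

definition relatively_compact_Lp ::
    "ereal \<Rightarrow> real \<Rightarrow> (real \<Rightarrow> 'a::real_normed_vector) set \<Rightarrow> bool" where
  "relatively_compact_Lp p T S \<longleftrightarrow>
     S \<subseteq> Lp_space p T \<and>
     (\<forall>F. (\<forall>k. F k \<in> S) \<longrightarrow>
        (\<exists>\<phi> g. strict_mono (\<phi> :: nat \<Rightarrow> nat) \<and> converges_Lp p T (F \<circ> \<phi>) g))"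

section \<open>Partitions and piecewise polynomials\<close>

text \<open>
  A partition is given by the number \<open>N\<close> of intervals and the node function \<open>\<nu>\<close>, whose values at
  arguments greater than \<open>N\<close> are irrelevant. The intervals are \<open>I\<^sub>n = (\<nu> (n - 1), \<nu> n)\<close>
  for \<open>1 \<le> n \<le> N\<close>.
\<close>

definition time_partition :: "real \<Rightarrow> nat \<Rightarrow> (nat \<Rightarrow> real) \<Rightarrow> bool" where
  "time_partition T N \<nu> \<longleftrightarrow> N \<ge> 1 \<and> \<nu> 0 = 0 \<and> \<nu> N = T \<and> (\<forall>n<N. \<nu> n < \<nu> (Suc n))"

definition time_step :: "(nat \<Rightarrow> real) \<Rightarrow> nat \<Rightarrow> real" where
  "time_step \<nu> n = \<nu> n - \<nu> (n - 1)"

definition max_time_step :: "nat \<Rightarrow> (nat \<Rightarrow> real) \<Rightarrow> real" where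
  "max_time_step N \<nu> = Max (time_step \<nu> ` {1..N})"

definition time_interval :: "(nat \<Rightarrow> real) \<Rightarrow> nat \<Rightarrow> real set" where
  "time_interval \<nu> n = {\<nu> (n - 1)<..<\<nu> n}"

text \<open>
  On each interval the function is an element of the algebraic tensor product of the real
  polynomials of degree at most \<open>l\<close> with \<open>Z\<close>, that is, a finite sum of elementary tensors.
  Values at the nodes are not constrained.
\<close>

definition piecewise_poly ::
    "real \<Rightarrow> nat \<Rightarrow> (nat \<Rightarrow> real) \<Rightarrow> nat \<Rightarrow> 'a::real_normed_vector set \<Rightarrow> (real \<Rightarrow> 'a) set" where
  "piecewise_poly T N \<nu> l Z =
     {v. v \<in> Lp_space 1 T \<and>
         (\<forall>n\<in>{1..N}. \<exists>(m::nat) (P :: nat \<Rightarrow> real poly) z.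
            (\<forall>j<m. degree (P j) \<le> l \<and> z j \<in> Z) \<and>
            (\<forall>t\<in>time_interval \<nu> n. v t = (\<Sum>j<m. poly (P j) t *\<^sub>R z j)))}"

text \<open>At the initial node the left limit is replaced by the initial datum \<open>u0\<close>.\<close>

definition time_jump ::
    "(nat \<Rightarrow> real) \<Rightarrow> 'a::real_normed_vector \<Rightarrow> (real \<Rightarrow> 'a) \<Rightarrow> nat \<Rightarrow> 'a" where
  "time_jump \<nu> u0 v n =
     (if n = 0 then Lim (at_right (\<nu> 0)) v - u0
      else Lim (at_right (\<nu> n)) v - Lim (at_left (\<nu> n)) v)"

section \<open>Time reconstruction\<close>

text \<open>Rodrigues' formula.\<close>

definition legendre :: "nat \<Rightarrow> real poly" where
  "legendre i = smult (1 / (2 ^ i * fact i)) ((pderiv ^^ i) ([:-1, 0, 1:] ^ i))"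

definition legendre_on :: "(nat \<Rightarrow> real) \<Rightarrow> nat \<Rightarrow> nat \<Rightarrow> real \<Rightarrow> real" where
  "legendre_on \<nu> n i t = poly (legendre i) ((2 * t - \<nu> (n - 1) - \<nu> n) / time_step \<nu> n)"

text \<open>The polynomial that the lifting of \<open>z\<close> equals on the \<open>n\<close>-th interval.\<close>

definition lifting ::
    "(nat \<Rightarrow> real) \<Rightarrow> nat \<Rightarrow> nat \<Rightarrow> 'a::real_normed_vector \<Rightarrow> real \<Rightarrow> 'a" where
  "lifting \<nu> l n z t =
     ((\<Sum>i=0..l. (-1) ^ i * (2 * real i + 1) * legendre_on \<nu> n i t) / time_step \<nu> n) *\<^sub>R z"

text \<open>The value at a point of the closed interval, with limits from inside at the two endpoints.\<close>

definition inner_value ::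
    "(nat \<Rightarrow> real) \<Rightarrow> nat \<Rightarrow> (real \<Rightarrow> 'a::real_normed_vector) \<Rightarrow> real \<Rightarrow> 'a" where
  "inner_value \<nu> n v t =
     (if t \<in> time_interval \<nu> n then v t else Lim (at t within time_interval \<nu> n) v)"

text \<open>The integral is the vector-valued one of the library; its integrand is a polynomial.\<close>

definition reconstruction_on ::
    "(nat \<Rightarrow> real) \<Rightarrow> nat \<Rightarrow> 'a::banach \<Rightarrow> nat \<Rightarrow> (real \<Rightarrow> 'a) \<Rightarrow> real \<Rightarrow> 'a" where
  "reconstruction_on \<nu> l u0 n v t =
     inner_value \<nu> n v t - time_jump \<nu> u0 v (n - 1)
     + integral {\<nu> (n - 1)..t} (lifting \<nu> l n (time_jump \<nu> u0 v (n - 1)))"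

text \<open>
  For \<open>t\<close> in \<open>[0,T]\<close> the selected \<open>n\<close> is the least one with \<open>t\<close> in the closure of
  \<open>I\<^sub>n\<close>. At an interior node the two adjacent pieces agree, so the choice is immaterial.
\<close>

definition reconstruction ::
    "(nat \<Rightarrow> real) \<Rightarrow> nat \<Rightarrow> 'a::banach \<Rightarrow> (real \<Rightarrow> 'a) \<Rightarrow> real \<Rightarrow> 'a" where
  "reconstruction \<nu> l u0 v t = reconstruction_on \<nu> l u0 (LEAST n. 1 \<le> n \<and> t \<le> \<nu> n) v t"

text \<open>
  The derivative in the interior of each interval; the library value of \<open>vector_derivative\<close> at
  the nodes is arbitrary, which affects a null set only.
\<close>

definition reconstruction_deriv ::
    "(nat \<Rightarrow> real) \<Rightarrow> nat \<Rightarrow> 'a::banach \<Rightarrow> (real \<Rightarrow> 'a) \<Rightarrow> real \<Rightarrow> 'a" where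
  "reconstruction_deriv \<nu> l u0 v t = vector_derivative (reconstruction \<nu> l u0 v) (at t)"

section \<open>The range of exponents in the interpolation case\<close>

text \<open>
  With \<open>1/\<infinity> = 0\<close>, \<open>recip_exponent \<theta> p r\<close> is the reciprocal of
  \<open>r p / ((1 - \<theta>) (1 - r) p + \<theta> r)\<close>. It is used when \<open>p\<close> or \<open>r\<close> is infinite.
\<close>

definition recip_exponent :: "real \<Rightarrow> ereal \<Rightarrow> ereal \<Rightarrow> real" where
  "recip_exponent \<theta> p r =
     (1 - \<theta>) * (real_of_ereal (1 / r) - 1) + \<theta> * real_of_ereal (1 / p)"

definition exponents_compatible :: "real \<Rightarrow> ereal \<Rightarrow> ereal \<Rightarrow> bool" where
  "exponents_compatible \<theta> p r \<longleftrightarrow>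
     (if p = \<infinity> \<or> r = \<infinity> then recip_exponent \<theta> p r \<ge> 0
      else (real_of_ereal r - 1) * real_of_ereal p / real_of_ereal r \<le> \<theta> / (1 - \<theta>))"

text \<open>
  The quotient in the finite case is taken in \<open>ereal\<close>: the numerator is positive, so a zero
  denominator gives \<open>\<infinity>\<close> and the bound then imposes nothing on the real number \<open>q\<close>.
\<close>

definition below_critical_exponent :: "real \<Rightarrow> ereal \<Rightarrow> ereal \<Rightarrow> real \<Rightarrow> bool" where
  "below_critical_exponent \<theta> p r q \<longleftrightarrow>
     (if p = \<infinity> \<or> r = \<infinity> then 1 / q > recip_exponent \<theta> p r
      else ereal q <
        ereal (real_of_ereal r * real_of_ereal p) /
        ereal ((1 - \<theta>) * (1 - real_of_ereal r) * real_of_ereal p + \<theta> * real_of_ereal r))"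

end

theory Submission
  imports Defs "HOL-Library.Diagonal_Subsequence"
begin

text \<open>
  Let \<open>v\<close> be the reconstruction of an approximate solution \<open>u\<close>. On the \<open>n\<close>-th interval \<open>u - v\<close> equals
  \<open>(1 - \<rho>) J\<close>, where \<open>J\<close> is the jump at the left node and \<open>\<rho>\<close> is a polynomial profile with the end
  values 0 and 1, bounded independently of the partition. Since the squares of the jumps in \<open>B\<close> have
  bounded sums and the mesh is refined, \<open>u - v\<close> is bounded in \<open>L\<^sup>\<infinity>(0,T;B)\<close> and tends to 0 in \<open>L\<^sup>1(0,T;B)\<close>
  (\<open>error_estimates\<close>), hence in \<open>L\<^sup>q(0,T;B)\<close> for all finite \<open>q\<close>. It therefore suffices to study \<open>v\<close>, which
  is continuous, and whose increments in \<open>Y\<close> are bounded by integrals of its derivative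
  (\<open>reconstruction_increment\<close>, \<open>Lp_bound_short_interval\<close>).

  The functions \<open>v\<close> are bounded in \<open>L\<^sup>p(0,T;X)\<close> because \<open>u\<close> is: an inverse estimate for polynomials
  bounds the traces of \<open>u\<close> at the nodes, and the bound on the ratios of consecutive steps makes the trace
  from the preceding interval harmless (\<open>moment_reconstruction_le\<close>; for \<open>p = \<infinity>\<close> the bound is
  pointwise, \<open>reconstruction_bounded\<close>).

  Compactness is obtained in \<open>Aubin_Lions_Simon\<close> by replacing \<open>v\<close> on short cells by its value at a point
  where its norm in \<open>X\<close> does not exceed the mean. The error is uniformly small by Ehrling's inequality,
  and the step functions have values in compact subsets of \<open>B\<close>, so a diagonal sequence converges.
  Good points are used instead of averages throughout; no vector-valued integral is needed for this,
  and the limit is a limit of simple functions, hence strongly measurable without any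
  separability. This proves (i).

  In (ii) the functions \<open>v\<close> are bounded in \<open>X\<close> and, since \<open>r > 1\<close>, Hoelder continuous into \<open>Y\<close>. By
  Ehrling's inequality they are equicontinuous into \<open>B\<close>, so almost everywhere convergence improves to
  convergence at every point with a continuous limit.

  In (iii) the family is compact in \<open>L\<^sup>1(0,T;B)\<close>, and a bound in \<open>L\<^sup>c(0,T;B)\<close> for one \<open>c > q\<close> is enough
  (\<open>moment_converges_interpolate\<close>). For \<open>p = \<infinity>\<close> it is immediate. For finite \<open>p\<close> the interpolation
  inequality is applied to differences of values of \<open>v\<close> at good points of successive dyadic scales around a
  time \<open>t\<close>, down to the scale at which \<open>t\<close> itself is good. For \<open>c\<close> below the critical exponent, the resulting
  geometric series bounds the \<open>c\<close>-th power of the norm of \<open>v t\<close> in \<open>B\<close> by a multiple of 1 plus the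
  \<open>p\<close>-th power of its norm in \<open>X\<close> (\<open>multiscale_interpolation\<close>), which is integrable.
\<close>

section \<open>Strong measurability on a bounded interval\<close>

abbreviation time_measure :: "real \<Rightarrow> real measure" where
  "time_measure T \<equiv> lebesgue_on {0<..<T}"

lemma AE_time_measure_iff: "(AE t in time_measure T. P t) \<longleftrightarrow> (AE t in lebesgue. t \<in> {0<..<T} \<longrightarrow> P t)"
  by (rule AE_restrict_space_iff) simp

lemma AE_time_measure_not_in_finite:
  assumes "finite Z" shows "AE t in time_measure T. t \<notin> Z"
proof -
  have "negligible Z" using assms by (rule negligible_finite)
  then have "Z \<in> null_sets lebesgue" by (simp add: negligible_iff_null_sets)
  then have "AE t in lebesgue. t \<notin> Z" by (rule AE_not_in)
  then show ?thesis unfolding AE_time_measure_iff by eventually_elim simp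
qed

text \<open>
  Lebesgue measure is complete, so a change on a null set keeps measurability. This is what makes
  the norm of an almost everywhere limit of simple functions measurable.
\<close>

lemma borel_measurable_time_AE:
  fixes f g :: "real \<Rightarrow> real"
  assumes "f \<in> borel_measurable (time_measure T)" "AE t in time_measure T. f t = g t"
  shows "g \<in> borel_measurable (time_measure T)"
proof -
  have "(\<lambda>x. if x \<in> {0<..<T} then f x else 0) \<in> borel_measurable lebesgue"
    using assms(1) by (intro borel_measurable_if[THEN iffD2]) auto
  moreover have "AE x in lebesgue. (if x \<in> {0<..<T} then f x else 0) = (if x \<in> {0<..<T} then g x else 0)"
    using assms(2) unfolding AE_time_measure_iff by eventually_elim auto
  ultimately have "(\<lambda>x. if x \<in> {0<..<T} then g x else 0) \<in> borel_measurable lebesgue"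
    by (rule borel_measurable_AE)
  then show ?thesis by (rule borel_measurable_if_D)
qed

lemma strongly_measurable_norm:
  assumes "strongly_measurable (time_measure T) f"
  shows "(\<lambda>t. norm (f t)) \<in> borel_measurable (time_measure T)"
proof -
  obtain s where s: "\<And>i::nat. simple_function (time_measure T) (s i)"
    and lim: "AE t in time_measure T. (\<lambda>i. s i t) \<longlonglongrightarrow> f t"
    using assms unfolding strongly_measurable_def by blast
  have m: "(\<lambda>t. norm (s i t)) \<in> borel_measurable (time_measure T)" for i
    by (rule borel_measurable_simple_function, rule simple_function_compose1[OF s, where g = norm])
  have "(\<lambda>t. lim (\<lambda>i. norm (s i t))) \<in> borel_measurable (time_measure T)"
    using m by (rule borel_measurable_lim_metric)
  moreover have "AE t in time_measure T. lim (\<lambda>i. norm (s i t)) = norm (f t)"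
    using lim by eventually_elim (rule limI, rule tendsto_norm)
  ultimately show ?thesis by (rule borel_measurable_time_AE)
qed

lemma strongly_measurable_diff:
  assumes "strongly_measurable M f" "strongly_measurable M g"
  shows "strongly_measurable M (\<lambda>t. f t - g t)"
proof -
  obtain s where s: "\<And>i::nat. simple_function M (s i)" and ls: "AE t in M. (\<lambda>i. s i t) \<longlonglongrightarrow> f t"
    using assms(1) unfolding strongly_measurable_def by blast
  obtain r where r: "\<And>i::nat. simple_function M (r i)" and lr: "AE t in M. (\<lambda>i. r i t) \<longlonglongrightarrow> g t"
    using assms(2) unfolding strongly_measurable_def by blast
  have "simple_function M (\<lambda>t. s i t - r i t)" for i by (rule simple_function_diff[OF s r])
  moreover have "AE t in M. (\<lambda>i. s i t - r i t) \<longlonglongrightarrow> f t - g t"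
    using ls lr by eventually_elim (rule tendsto_diff)
  ultimately show ?thesis unfolding strongly_measurable_def by (intro exI[of _ "\<lambda>i t. s i t - r i t"]) auto
qed

lemma strongly_measurable_bounded_linear:
  assumes "bounded_linear h" "strongly_measurable M f"
  shows "strongly_measurable M (\<lambda>t. h (f t))"
proof -
  obtain s where s: "\<And>i::nat. simple_function M (s i)" and ls: "AE t in M. (\<lambda>i. s i t) \<longlonglongrightarrow> f t"
    using assms(2) unfolding strongly_measurable_def by blast
  have "simple_function M (\<lambda>t. h (s i t))" for i
    by (rule simple_function_compose1[OF s, where g = h])
  moreover have "AE t in M. (\<lambda>i. h (s i t)) \<longlonglongrightarrow> h (f t)"
    using ls by eventually_elim (rule bounded_linear.tendsto[OF assms(1)])
  ultimately show ?thesis unfolding strongly_measurable_def by (intro exI[of _ "\<lambda>i t. h (s i t)"]) auto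
qed

lemma strongly_measurable_simple: "simple_function M s \<Longrightarrow> strongly_measurable M s"
  unfolding strongly_measurable_def by (intro exI[of _ "\<lambda>_. s"]) auto

text \<open>
  The index of the cell containing \<open>t\<close> when \<open>(0,T)\<close> is cut into \<open>m\<close> equal cells. A function of
  this index alone is simple, whatever its range space.
\<close>

definition step_index :: "real \<Rightarrow> nat \<Rightarrow> real \<Rightarrow> nat" where
  "step_index T m t = nat \<lfloor>real m * t / T\<rfloor>"

lemma step_index_less:
  assumes "0 < t" "t < T" "m > 0"
  shows "step_index T m t < m"
proof -
  have "real m * t / T < real m" using assms by (simp add: divide_simps)
  moreover have "0 \<le> real m * t / T" using assms by simp
  ultimately show ?thesis unfolding step_index_def by linarith
qed

lemma step_index_bounds:
  assumes "0 < t" "t < T" "m > 0"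
  shows "real (step_index T m t) * T / real m \<le> t" "t < real (Suc (step_index T m t)) * T / real m"
proof -
  have nn: "0 \<le> real m * t / T" using assms by simp
  have e: "real (step_index T m t) = of_int \<lfloor>real m * t / T\<rfloor>"
    unfolding step_index_def using nn by simp
  have "real (step_index T m t) \<le> real m * t / T" unfolding e by simp
  then show "real (step_index T m t) * T / real m \<le> t" using assms by (simp add: field_simps)
  have "real m * t / T < real (Suc (step_index T m t))" using e by simp linarith
  then show "t < real (Suc (step_index T m t)) * T / real m" using assms by (simp add: field_simps)
qed

lemma simple_function_step:
  assumes "m > 0"
  shows "simple_function (time_measure T) (\<lambda>t. c (step_index T m t))"
proof (rule simple_function_compose1[where g = c])
  have "step_index T m ` space (time_measure T) \<subseteq> {..<m}"
    using assms step_index_less by auto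
  then have "finite (step_index T m ` space (time_measure T))" by (rule finite_subset) simp
  moreover have "step_index T m \<in> measurable (time_measure T) (count_space UNIV)"
  proof (rule measurable_restrict_space1)
    have "(\<lambda>t. real m * t / T) \<in> borel_measurable borel" by measurable
    then have "(\<lambda>t. real m * t / T) \<in> borel_measurable lebesgue"
      by (intro measurable_completion) simp
    then have "(\<lambda>t. \<lfloor>real m * t / T\<rfloor>) \<in> measurable lebesgue (count_space UNIV)"
      by (rule measurable_compose) (rule measurable_real_floor)
    then have "(\<lambda>t. nat \<lfloor>real m * t / T\<rfloor>) \<in> measurable lebesgue (count_space UNIV)"
      by (rule measurable_compose) simp
    then show "step_index T m \<in> measurable lebesgue (count_space UNIV)"
      unfolding step_index_def[abs_def] .
  qed
  ultimately show "simple_function (time_measure T) (step_index T m)"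
    unfolding simple_function_eq_measurable by simp
qed

text \<open>
  Uniform step functions converge pointwise to a continuous function. Continuity itself thus
  provides the approximating simple functions, whatever the range space.
\<close>

lemma strongly_measurable_continuous:
  fixes f :: "real \<Rightarrow> 'a::real_normed_vector"
  assumes c: "continuous_on {0..T} f" and T: "T > 0"
  shows "strongly_measurable (time_measure T) f"
proof -
  define s where "s i t = f (real (step_index T (Suc i) t) * T / real (Suc i))" for i t
  have "simple_function (time_measure T) (s i)" for i
    unfolding s_def using simple_function_step[of "Suc i" T "\<lambda>j. f (real j * T / real (Suc i))"] by simp
  moreover have "(\<lambda>i. s i t) \<longlonglongrightarrow> f t" if t: "0 < t" "t < T" for t
  proof -
    let ?x = "\<lambda>i. real (step_index T (Suc i) t) * T / real (Suc i)"
    have b: "?x i \<le> t \<and> t - T / real (Suc i) \<le> ?x i" for i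
      using step_index_bounds[OF t, of "Suc i"] by (simp add: add_divide_distrib distrib_right)
    have "(\<lambda>i. T / real (Suc i)) \<longlonglongrightarrow> 0"
      by (rule LIMSEQ_Suc[where f="\<lambda>i. T / real i"]) (rule lim_const_over_n)
    then have "(\<lambda>i. t - T / real (Suc i)) \<longlonglongrightarrow> t - 0" by (intro tendsto_intros)
    then have l: "?x \<longlonglongrightarrow> t"
      by (intro tendsto_sandwich[of "\<lambda>i. t - T / real (Suc i)" ?x sequentially "\<lambda>_. t"])
         (use b in \<open>auto intro!: always_eventually\<close>)
    show ?thesis unfolding s_def
    proof (rule continuous_on_tendsto_compose[OF c l])
      show "t \<in> {0..T}" using t by simp
      have "?x i \<in> {0..T}" for i using b[of i] t T by (auto intro: divide_nonneg_nonneg)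
      then show "\<forall>\<^sub>F i in sequentially. ?x i \<in> {0..T}" by (rule always_eventually[OF allI])
    qed
  qed
  then have "AE t in time_measure T. (\<lambda>i. s i t) \<longlonglongrightarrow> f t" by (intro AE_I2) auto
  ultimately show ?thesis unfolding strongly_measurable_def by blast
qed

section \<open>Moments of vector-valued functions\<close>

text \<open>
  The \<open>p\<close>-th power of the \<open>L\<^sup>p\<close> norm, kept in \<open>ennreal\<close> so that no integrability has to be known in
  advance. All estimates are made for this quantity; roots are taken only in the final conversion
  to \<open>Lp_norm\<close>.
\<close>

definition moment :: "real \<Rightarrow> real \<Rightarrow> (real \<Rightarrow> 'a::real_normed_vector) \<Rightarrow> ennreal" where
  "moment p T f = (\<integral>\<^sup>+t. ennreal (norm (f t) powr p) \<partial>time_measure T)"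

lemma moment_cong_AE: "AE t in time_measure T. f t = g t \<Longrightarrow> moment p T f = moment p T g"
  unfolding moment_def by (rule nn_integral_cong_AE) auto

lemma powr_add_le:
  fixes x y p :: real
  assumes "x \<ge> 0" "y \<ge> 0" "p \<ge> 0"
  shows "(x + y) powr p \<le> 2 powr p * (x powr p + y powr p)"
proof -
  have "(x + y) powr p \<le> (2 * max x y) powr p" using assms by (intro powr_mono2) auto
  also have "\<dots> = 2 powr p * max x y powr p" using assms by (simp add: powr_mult)
  also have "max x y powr p \<le> x powr p + y powr p" by (simp add: max_def)
  finally show ?thesis by simp
qed

text \<open>
  A triangle inequality with constant \<open>2\<^sup>p\<close>; this replaces Minkowski's inequality, since only
  smallness of moments matters.
\<close>

lemma moment_triangle:
  fixes f g h :: "real \<Rightarrow> 'a::real_normed_vector"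
  assumes "strongly_measurable (time_measure T) f" "strongly_measurable (time_measure T) g"
    "strongly_measurable (time_measure T) h" "p \<ge> 0"
  shows "moment p T (\<lambda>t. f t - h t) \<le>
    ennreal (2 powr p) * (moment p T (\<lambda>t. f t - g t) + moment p T (\<lambda>t. g t - h t))"
proof -
  have [measurable]: "(\<lambda>t. norm (f t - g t)) \<in> borel_measurable (time_measure T)"
    "(\<lambda>t. norm (g t - h t)) \<in> borel_measurable (time_measure T)"
    using assms by (auto intro!: strongly_measurable_norm strongly_measurable_diff)
  have "norm (f t - h t) powr p \<le> 2 powr p * (norm (f t - g t) powr p + norm (g t - h t) powr p)" for t
  proof -
    have "norm (f t - h t) \<le> norm (f t - g t) + norm (g t - h t)"
      using norm_triangle_ineq[of "f t - g t" "g t - h t"] by simp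
    then have "norm (f t - h t) powr p \<le> (norm (f t - g t) + norm (g t - h t)) powr p"
      using assms(4) by (intro powr_mono2) auto
    also have "\<dots> \<le> 2 powr p * (norm (f t - g t) powr p + norm (g t - h t) powr p)"
      using assms(4) by (intro powr_add_le) auto
    finally show ?thesis .
  qed
  then have "moment p T (\<lambda>t. f t - h t) \<le>
      (\<integral>\<^sup>+t. ennreal (2 powr p) * (ennreal (norm (f t - g t) powr p) + ennreal (norm (g t - h t) powr p)) \<partial>time_measure T)"
    unfolding moment_def
    by (intro nn_integral_mono) (simp add: ennreal_plus[symmetric] ennreal_mult'[symmetric] ennreal_leI del: ennreal_plus)
  also have "\<dots> = ennreal (2 powr p) * (moment p T (\<lambda>t. f t - g t) + moment p T (\<lambda>t. g t - h t))"
    unfolding moment_def by (simp add: nn_integral_cmult nn_integral_add)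
  finally show ?thesis .
qed

lemma moment_commute: "moment p T (\<lambda>t. f t - g t) = moment p T (\<lambda>t. g t - f t)"
  unfolding moment_def by (simp add: norm_minus_commute)

lemma Lp_space_iff_moment:
  "f \<in> Lp_space (ereal p) T \<longleftrightarrow> strongly_measurable (time_measure T) f \<and> moment p T f < \<infinity>"
proof (cases "strongly_measurable (time_measure T) f")
  case True
  have "(\<lambda>t. norm (f t) powr p) \<in> borel_measurable (time_measure T)"
    using strongly_measurable_norm[OF True] by measurable
  then show ?thesis using True unfolding Lp_space_def moment_def by (simp add: integrable_iff_bounded)
qed (simp add: Lp_space_def)

lemma Lp_norm_eq_moment:
  assumes "strongly_measurable (time_measure T) f"
  shows "Lp_norm (ereal p) T f = enn2real (moment p T f) powr (1 / p)"
proof -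
  have "(\<lambda>t. norm (f t) powr p) \<in> borel_measurable (time_measure T)"
    using strongly_measurable_norm[OF assms] by measurable
  then show ?thesis unfolding Lp_norm_def moment_def by (simp add: integral_eq_nn_integral)
qed

lemma moment_le_of_Lp_norm:
  assumes "f \<in> Lp_space (ereal p) T" "Lp_norm (ereal p) T f \<le> C" "p > 0"
  shows "moment p T f \<le> ennreal (C powr p)"
proof -
  have f: "strongly_measurable (time_measure T) f" "moment p T f < \<infinity>"
    using assms(1) unfolding Lp_space_iff_moment by auto
  let ?m = "enn2real (moment p T f)"
  have "?m = (?m powr (1 / p)) powr p" using assms(3) by (simp add: powr_powr)
  also have "\<dots> \<le> C powr p"
    using assms f by (intro powr_mono2) (auto simp: Lp_norm_eq_moment)
  finally show ?thesis using f(2) by (metis ennreal_enn2real ennreal_leI infinity_ennreal_def)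
qed

lemma converges_Lp_of_moment:
  assumes "p > 0" and "\<And>k. F k \<in> Lp_space (ereal p) T" "g \<in> Lp_space (ereal p) T"
    and lim: "(\<lambda>k. moment p T (\<lambda>t. F k t - g t)) \<longlonglongrightarrow> 0"
  shows "converges_Lp (ereal p) T F g"
proof -
  have "strongly_measurable (time_measure T) (\<lambda>t. F k t - g t)" for k
    using assms(2,3) by (auto simp: Lp_space_iff_moment intro!: strongly_measurable_diff)
  then have e: "Lp_norm (ereal p) T (\<lambda>t. F k t - g t) =
      enn2real (moment p T (\<lambda>t. F k t - g t)) powr (1 / p)" for k
    by (rule Lp_norm_eq_moment)
  have "(\<lambda>k. enn2real (moment p T (\<lambda>t. F k t - g t))) \<longlonglongrightarrow> 0"
    by (rule tendsto_enn2real) (use lim in simp_all)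
  then have "(\<lambda>k. enn2real (moment p T (\<lambda>t. F k t - g t)) powr (1 / p)) \<longlonglongrightarrow> 0 powr (1 / p)"
    using assms(1) by (intro tendsto_powr2) auto
  then show ?thesis using assms unfolding converges_Lp_def e by simp
qed

section \<open>Truncation, completeness and interpolation of moments\<close>

text \<open>
  Comparing \<open>x\<close> with a threshold \<open>\<kappa>\<close>: below it the power \<open>b\<close> is
  compared with the lower power \<open>a\<close>, above it with the higher power \<open>c\<close>.
  Integrated, and with \<open>\<kappa>\<close> chosen afterwards, this pointwise splitting takes over the role of
  Hoelder's inequality and of the interpolation inequality between Lebesgue spaces.
\<close>

lemma powr_le_split:
  fixes x \<kappa> a b c :: real
  assumes "x \<ge> 0" "\<kappa> > 0" "a \<le> b" "b \<le> c"
  shows "x powr b \<le> \<kappa> powr (b - a) * x powr a + \<kappa> powr (b - c) * x powr c"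
proof (cases "x \<le> \<kappa>")
  case True
  have "x powr b = x powr (b - a) * x powr a" using assms by (cases "x = 0") (auto simp: powr_add[symmetric])
  also have "\<dots> \<le> \<kappa> powr (b - a) * x powr a"
    using assms True by (intro mult_right_mono powr_mono2) auto
  also have "\<dots> \<le> \<kappa> powr (b - a) * x powr a + \<kappa> powr (b - c) * x powr c" by simp
  finally show ?thesis .
next
  case False
  then have x: "x > 0" using assms by linarith
  have "x powr b = x powr (b - c) * x powr c" using x by (auto simp: powr_add[symmetric])
  also have "\<dots> \<le> \<kappa> powr (b - c) * x powr c"
    using assms False by (intro mult_right_mono powr_mono2') auto
  also have "\<dots> \<le> \<kappa> powr (b - a) * x powr a + \<kappa> powr (b - c) * x powr c" by simp
  finally show ?thesis .
qed

lemma le_add_powr: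
  fixes x \<kappa> p :: real
  assumes "x \<ge> 0" "\<kappa> > 0" "p \<ge> 1"
  shows "x \<le> \<kappa> + \<kappa> powr (1 - p) * x powr p"
proof (cases "x = 0")
  case False
  then show ?thesis using powr_le_split[of x \<kappa> 0 1 p] assms by simp
qed (use assms in simp)

lemma moment_interpolate:
  assumes f: "strongly_measurable (time_measure T) f" and "\<kappa> > 0" "a \<le> b" "b \<le> c"
  shows "moment b T f \<le> ennreal (\<kappa> powr (b - a)) * moment a T f + ennreal (\<kappa> powr (b - c)) * moment c T f"
proof -
  have [measurable]: "(\<lambda>t. norm (f t)) \<in> borel_measurable (time_measure T)"
    using f by (rule strongly_measurable_norm)
  have "moment b T f \<le> (\<integral>\<^sup>+t. ennreal (\<kappa> powr (b - a)) * ennreal (norm (f t) powr a)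
      + ennreal (\<kappa> powr (b - c)) * ennreal (norm (f t) powr c) \<partial>time_measure T)"
    unfolding moment_def using assms
    by (intro nn_integral_mono)
      (auto simp: ennreal_plus[symmetric] ennreal_mult'[symmetric] simp del: ennreal_plus intro!: ennreal_leI powr_le_split)
  also have "\<dots> = ennreal (\<kappa> powr (b - a)) * moment a T f + ennreal (\<kappa> powr (b - c)) * moment c T f"
    unfolding moment_def by (simp add: nn_integral_cmult nn_integral_add)
  finally show ?thesis .
qed

lemma moment_0_le: "T \<ge> 0 \<Longrightarrow> moment 0 T f \<le> ennreal T"
proof -
  assume T: "T \<ge> 0"
  have "moment 0 T f \<le> (\<integral>\<^sup>+t. 1 \<partial>time_measure T)"
    unfolding moment_def by (intro nn_integral_mono) (auto simp: powr_def)
  also have "\<dots> = ennreal T" using T by (simp add: emeasure_restrict_space)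
  finally show ?thesis .
qed

lemma moment_bounded:
  assumes "AE t in time_measure T. norm (f t) \<le> C" "T \<ge> 0" "p \<ge> 0"
  shows "moment p T f \<le> ennreal (C powr p * T)"
proof -
  have "moment p T f \<le> (\<integral>\<^sup>+t. ennreal (C powr p) \<partial>time_measure T)"
    unfolding moment_def using assms(1)
    by (intro nn_integral_mono_AE, eventually_elim) (auto intro!: ennreal_leI powr_mono2 assms)
  also have "\<dots> = ennreal (C powr p * T)" using assms by (simp add: emeasure_restrict_space ennreal_mult')
  finally show ?thesis .
qed

text \<open>
  Fatou's lemma; it is applied to norms only, hence needs no integral in the range space.
\<close>

lemma moment_Fatou:
  assumes F: "\<And>j. strongly_measurable (time_measure T) (F j)"
    and lim: "AE t in time_measure T. (\<lambda>j::nat. F j t) \<longlonglongrightarrow> f t"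
    and le: "\<forall>\<^sub>F j in sequentially. moment p T (F j) \<le> C" and "p > 0"
  shows "moment p T f \<le> C"
proof -
  have [measurable]: "(\<lambda>t. norm (F j t)) \<in> borel_measurable (time_measure T)" for j
    using F by (rule strongly_measurable_norm)
  have "moment p T f = (\<integral>\<^sup>+t. liminf (\<lambda>j. ennreal (norm (F j t) powr p)) \<partial>time_measure T)"
    unfolding moment_def
  proof (rule nn_integral_cong_AE, use lim in eventually_elim)
    fix t assume "(\<lambda>j. F j t) \<longlonglongrightarrow> f t"
    then have "(\<lambda>j. norm (F j t) powr p) \<longlonglongrightarrow> norm (f t) powr p"
      using \<open>p > 0\<close> by (intro tendsto_powr2 tendsto_norm) auto
    then have "(\<lambda>j. ennreal (norm (F j t) powr p)) \<longlonglongrightarrow> ennreal (norm (f t) powr p)"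
      by (rule tendsto_ennrealI)
    then show "ennreal (norm (f t) powr p) = liminf (\<lambda>j. ennreal (norm (F j t) powr p))"
      by (intro lim_imp_Liminf[symmetric]) auto
  qed
  also have "\<dots> \<le> liminf (\<lambda>j. moment p T (F j))"
    unfolding moment_def by (rule nn_integral_liminf) measurable
  also have "\<dots> \<le> C" using le by (intro Liminf_le) auto
  finally show ?thesis .
qed

lemma ex_fast_subsequence:
  fixes K :: "nat \<Rightarrow> nat"
  obtains \<psi> where "strict_mono \<psi>" "\<And>i. \<psi> i \<ge> K i"
proof -
  define \<psi> where "\<psi> i = i + (\<Sum>j\<le>i. K j)" for i
  have "strict_mono \<psi>" unfolding strict_mono_Suc_iff \<psi>_def by simp
  moreover have "\<psi> i \<ge> K i" for i unfolding \<psi>_def by (simp add: member_le_sum trans_le_add2)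
  ultimately show ?thesis using that by blast
qed

lemma ennreal_tendsto_0I:
  assumes "\<And>e::real. e > 0 \<Longrightarrow> \<forall>\<^sub>F k in F. f k \<le> ennreal e"
  shows "(f \<longlongrightarrow> 0) F"
proof (rule order_tendstoI)
  fix e :: ennreal assume "0 < e"
  then obtain y where y: "0 < y" "y < e" using dense by blast
  then obtain e' where e': "y = ennreal e'" "e' > 0"
    by (cases y rule: ennreal_cases) (auto simp: ennreal_less_zero_iff)
  show "\<forall>\<^sub>F k in F. f k < e"
    using assms[OF e'(2)] by eventually_elim (use y(2) e'(1) in simp)
qed simp

text \<open>
  Completeness of \<open>L\<^sup>p\<close> for sequences of simple functions. A rapidly Cauchy subsequence converges
  almost everywhere because the norms of its increments are summable there, and its limit is
  strongly measurable since the approximating functions are simple. Working with simple functions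
  avoids proving that strong measurability is stable under limits.
\<close>

lemma simple_Cauchy_converges:
  fixes s :: "nat \<Rightarrow> real \<Rightarrow> 'b::banach"
  assumes s: "\<And>i. simple_function (time_measure T) (s i)" and p: "p \<ge> 1" and T: "T \<ge> 0"
    and Cauchy: "\<And>e. e > 0 \<Longrightarrow> \<exists>K. \<forall>m\<ge>K. \<forall>n\<ge>K. moment p T (\<lambda>t. s m t - s n t) \<le> ennreal e"
  obtains g where "strongly_measurable (time_measure T) g" "(\<lambda>i. moment p T (\<lambda>t. s i t - g t)) \<longlonglongrightarrow> 0"
proof -
  have ss: "strongly_measurable (time_measure T) (s i)" for i by (rule strongly_measurable_simple[OF s])
  have sd: "strongly_measurable (time_measure T) (\<lambda>t. s i t - s j t)" for i j
    by (rule strongly_measurable_diff[OF ss ss])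
  have [measurable]: "(\<lambda>t. norm (s i t - s j t)) \<in> borel_measurable (time_measure T)" for i j
    by (rule strongly_measurable_norm[OF sd])
  have "\<exists>K. \<forall>m\<ge>K. \<forall>n\<ge>K. moment p T (\<lambda>t. s m t - s n t) \<le> ennreal (((1/2)^i) powr p)" for i :: nat
    by (rule Cauchy) simp
  then obtain K where K: "\<And>i m n. m \<ge> K i \<Longrightarrow> n \<ge> K i \<Longrightarrow>
      moment p T (\<lambda>t. s m t - s n t) \<le> ennreal (((1/2)^i) powr p)" by metis
  obtain \<psi> where \<psi>: "strict_mono \<psi>" "\<And>i. \<psi> i \<ge> K i" using ex_fast_subsequence[of K] by blast
  define d where "d i t = norm (s (\<psi> (Suc i)) t - s (\<psi> i) t)" for i t
  have [measurable]: "d i \<in> borel_measurable (time_measure T)" for i unfolding d_def by measurable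
  have d_int: "(\<integral>\<^sup>+t. ennreal (d i t) \<partial>time_measure T) \<le> ennreal ((T + 1) * (1/2)^i)" for i
  proof -
    \<comment> \<open>the threshold \<open>(1/2)^i\<close> bounds the mean of \<open>d i\<close> by a multiple of \<open>(1/2)^i\<close>\<close>
    let ?k = "(1/2)^i :: real"
    have le: "\<psi> i \<le> \<psi> (Suc i)" using \<psi>(1) by (simp add: strict_mono_less_eq)
    have "(\<integral>\<^sup>+t. ennreal (d i t) \<partial>time_measure T) = moment 1 T (\<lambda>t. s (\<psi> (Suc i)) t - s (\<psi> i) t)"
      unfolding d_def moment_def by simp
    also have "\<dots> \<le> ennreal (?k powr (1 - 0)) * moment 0 T (\<lambda>t. s (\<psi> (Suc i)) t - s (\<psi> i) t)
        + ennreal (?k powr (1 - p)) * moment p T (\<lambda>t. s (\<psi> (Suc i)) t - s (\<psi> i) t)"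
      using p by (intro moment_interpolate sd) auto
    also have "\<dots> \<le> ennreal (?k powr (1 - 0)) * ennreal T + ennreal (?k powr (1 - p)) * ennreal (?k powr p)"
      using \<psi>(2)[of i] le by (intro add_mono mult_left_mono moment_0_le K T) auto
    also have "\<dots> = ennreal ((T + 1) * ?k)"
      using T by (simp add: ennreal_plus[symmetric] ennreal_mult'[symmetric] powr_add[symmetric] algebra_simps del: ennreal_plus)
    finally show ?thesis .
  qed
  have "(\<integral>\<^sup>+t. (\<Sum>i. ennreal (d i t)) \<partial>time_measure T) = (\<Sum>i. \<integral>\<^sup>+t. ennreal (d i t) \<partial>time_measure T)"
    by (rule nn_integral_suminf) measurable
  also have "\<dots> \<le> (\<Sum>i. ennreal ((T + 1) * (1/2)^i))"
    using d_int by (intro suminf_le) auto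
  also have "\<dots> < \<infinity>"
  proof -
    have "summable (\<lambda>i. (T + 1) * (1/2::real)^i)" by (intro summable_mult summable_geometric) simp
    then have "(\<Sum>i. ennreal ((T + 1) * (1/2)^i)) \<noteq> top"
      using T by (intro ennreal_suminf_neq_top) auto
    then show ?thesis by (simp add: less_top)
  qed
  finally have "AE t in time_measure T. (\<Sum>i. ennreal (d i t)) \<noteq> \<infinity>"
    by (intro nn_integral_PInf_AE) auto
  then have conv: "AE t in time_measure T. (\<lambda>i. s (\<psi> i) t) \<longlonglongrightarrow> lim (\<lambda>i. s (\<psi> i) t)"
  proof eventually_elim
    case (elim t)
    have "summable (\<lambda>i. norm (s (\<psi> (Suc i)) t - s (\<psi> i) t))"
      using elim unfolding d_def by (intro summable_suminf_not_top) auto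
    then have "summable (\<lambda>i. s (\<psi> (Suc i)) t - s (\<psi> i) t)" by (rule summable_norm_cancel)
    then have "convergent (\<lambda>n. \<Sum>i<n. s (\<psi> (Suc i)) t - s (\<psi> i) t)" by (simp add: summable_iff_convergent)
    then have "convergent (\<lambda>n. (s (\<psi> n) t - s (\<psi> 0) t) + s (\<psi> 0) t)"
      by (subst (asm) sum_lessThan_telescope) (intro convergent_add convergent_const)
    then show ?case by (simp add: convergent_LIMSEQ_iff)
  qed
  define g where "g t = lim (\<lambda>i. s (\<psi> i) t)" for t
  have lim: "AE t in time_measure T. (\<lambda>i. s (\<psi> i) t) \<longlonglongrightarrow> g t" using conv unfolding g_def .
  have "strongly_measurable (time_measure T) g" unfolding strongly_measurable_def
    by (rule exI[of _ "\<lambda>i. s (\<psi> i)"]) (simp add: lim s)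
  moreover have "(\<lambda>i. moment p T (\<lambda>t. s i t - g t)) \<longlonglongrightarrow> 0"
  proof (rule ennreal_tendsto_0I)
    show "\<forall>\<^sub>F i in sequentially. moment p T (\<lambda>t. s i t - g t) \<le> ennreal e'" if e': "e' > 0" for e' :: real
    proof -
      obtain K where K: "\<And>m n. m \<ge> K \<Longrightarrow> n \<ge> K \<Longrightarrow> moment p T (\<lambda>t. s m t - s n t) \<le> ennreal e'"
        using Cauchy[OF e'] by blast
      have "moment p T (\<lambda>t. s i t - g t) \<le> ennreal e'" if i: "i \<ge> K" for i
      proof (rule moment_Fatou[where F = "\<lambda>j t. s i t - s (\<psi> j) t"])
        show "AE t in time_measure T. (\<lambda>j. s i t - s (\<psi> j) t) \<longlonglongrightarrow> s i t - g t"
          using lim by eventually_elim (intro tendsto_intros)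
        show "\<forall>\<^sub>F j in sequentially. moment p T (\<lambda>t. s i t - s (\<psi> j) t) \<le> ennreal e'"
          using i seq_suble[OF \<psi>(1)] by (intro eventually_sequentiallyI[of K] K) (auto intro: order_trans)
      qed (use p sd in auto)
      then show ?thesis by (intro eventually_sequentiallyI[of K])
    qed
  qed
  ultimately show ?thesis using that by blast
qed

text \<open>
  Reduces to the scalar functions \<open>norm (F k t - g t)\<close>: a null sequence in \<open>L\<^sup>1\<close> has a subsequence
  that tends to 0 almost everywhere.
\<close>

lemma moment_1_AE_subseq:
  assumes "\<And>k. strongly_measurable (time_measure T) (F k)" "strongly_measurable (time_measure T) g"
    and lim: "(\<lambda>k. moment 1 T (\<lambda>t. F k t - g t)) \<longlonglongrightarrow> 0"
  obtains \<psi> :: "nat \<Rightarrow> nat" where "strict_mono \<psi>" "AE t in time_measure T. (\<lambda>k. F (\<psi> k) t) \<longlonglongrightarrow> g t"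
proof -
  define h where "h k t = norm (F k t - g t)" for k t
  have meas [measurable]: "h k \<in> borel_measurable (time_measure T)" for k
    unfolding h_def[abs_def] by (rule strongly_measurable_norm, rule strongly_measurable_diff[OF assms(1,2)])
  have m: "moment 1 T (\<lambda>t. F k t - g t) = (\<integral>\<^sup>+t. ennreal (h k t) \<partial>time_measure T)" for k
    unfolding moment_def h_def by simp
  have "\<forall>\<^sub>F k in sequentially. moment 1 T (\<lambda>t. F k t - g t) < 1"
    using lim by (rule order_tendstoD) simp
  then obtain K where K: "\<And>k. k \<ge> K \<Longrightarrow> (\<integral>\<^sup>+t. ennreal (h k t) \<partial>time_measure T) < 1"
    unfolding eventually_sequentially m by blast
  have int: "integrable (time_measure T) (h (k + K))" for k
    unfolding integrable_iff_bounded using K[of "k + K"] by (auto simp: h_def intro: order_less_trans)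
  have "(\<lambda>k. enn2real (moment 1 T (\<lambda>t. F k t - g t))) \<longlonglongrightarrow> 0"
    by (rule tendsto_enn2real) (use lim in simp_all)
  then have "(\<lambda>k. enn2real (moment 1 T (\<lambda>t. F (k + K) t - g t))) \<longlonglongrightarrow> 0"
    by (rule LIMSEQ_ignore_initial_segment)
  moreover have "(\<integral>t. norm (h (k + K) t) \<partial>time_measure T) = enn2real (moment 1 T (\<lambda>t. F (k + K) t - g t))" for k
    unfolding m using meas[of "k + K"] by (subst integral_eq_nn_integral) (simp_all add: h_def[abs_def])
  ultimately have "(\<lambda>k. \<integral>t. norm (h (k + K) t) \<partial>time_measure T) \<longlonglongrightarrow> 0" by simp
  from tendsto_L1_AE_subseq[OF int this]
  obtain r :: "nat \<Rightarrow> nat" where r: "strict_mono r" "AE t in time_measure T. (\<lambda>k. h (r k + K) t) \<longlonglongrightarrow> 0" by blast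
  have "strict_mono (\<lambda>k. r k + K)" using r(1) by (simp add: strict_mono_def)
  moreover have "AE t in time_measure T. (\<lambda>k. F (r k + K) t) \<longlonglongrightarrow> g t"
    using r(2) unfolding h_def by eventually_elim (simp add: LIM_zero_iff tendsto_norm_zero_iff)
  ultimately show ?thesis using that[of "\<lambda>k. r k + K"] by blast
qed

text \<open>
  Convergence in \<open>L\<^sup>1\<close> together with a bound in \<open>L\<^sup>c\<close> gives convergence in every intermediate
  \<open>L\<^sup>b\<close>. The limit inherits the bound by Fatou, and the differences are split at a high
  threshold, above which the \<open>c\<close>-th moment leaves little.
\<close>

lemma moment_converges_interpolate:
  assumes F: "\<And>k. strongly_measurable (time_measure T) (F k)" and g: "strongly_measurable (time_measure T) g"
    and lim: "(\<lambda>k. moment 1 T (\<lambda>t. F k t - g t)) \<longlonglongrightarrow> 0"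
    and bd: "\<And>k. moment c T (F k) \<le> ennreal C" and "1 \<le> b" "b < c" "T \<ge> 0"
  shows "moment b T g < \<infinity>" "(\<lambda>k. moment b T (\<lambda>t. F k t - g t)) \<longlonglongrightarrow> 0"
proof -
  obtain \<psi> :: "nat \<Rightarrow> nat" where \<psi>: "strict_mono \<psi>" "AE t in time_measure T. (\<lambda>k. F (\<psi> k) t) \<longlonglongrightarrow> g t"
    using moment_1_AE_subseq[OF F g lim] by blast
  have gc: "moment c T g \<le> ennreal C"
    using \<psi>(2) bd assms by (intro moment_Fatou[OF F \<psi>(2)] always_eventually) auto
  have "moment b T g \<le> ennreal (1 powr (b - 0)) * moment 0 T g + ennreal (1 powr (b - c)) * moment c T g"
    using assms by (intro moment_interpolate) auto
  also have "\<dots> \<le> ennreal (1 powr (b - 0)) * ennreal T + ennreal (1 powr (b - c)) * ennreal C"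
    using assms gc by (intro add_mono mult_left_mono moment_0_le) auto
  also have "\<dots> < \<infinity>" by (simp add: ennreal_mult_less_top)
  finally show "moment b T g < \<infinity>" .
  define C' where "C' = 2 powr c * (\<bar>C\<bar> + \<bar>C\<bar>)"
  have dc: "moment c T (\<lambda>t. F k t - g t) \<le> ennreal C'" for k
  proof -
    have "moment c T (\<lambda>t. F k t - g t) \<le> ennreal (2 powr c) * (moment c T (\<lambda>t. F k t - 0) + moment c T (\<lambda>t. 0 - g t))"
      using assms by (intro moment_triangle) (auto intro!: strongly_measurable_simple)
    also have "\<dots> = ennreal (2 powr c) * (moment c T (F k) + moment c T g)"
      by (simp add: moment_def)
    also have "\<dots> \<le> ennreal (2 powr c) * (ennreal \<bar>C\<bar> + ennreal \<bar>C\<bar>)"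
      by (intro mult_left_mono add_mono order_trans[OF bd] order_trans[OF gc] ennreal_leI) auto
    also have "\<dots> = ennreal C'" unfolding C'_def
      by (simp add: ennreal_plus[symmetric] ennreal_mult'[symmetric] del: ennreal_plus)
    finally show ?thesis .
  qed
  have C'0: "C' \<ge> 0" unfolding C'_def by simp
  show "(\<lambda>k. moment b T (\<lambda>t. F k t - g t)) \<longlonglongrightarrow> 0"
  proof (rule ennreal_tendsto_0I)
    fix e' :: real assume e': "e' > 0"
    \<comment> \<open>so large that the part above \<open>\<kappa>\<close> contributes at most half of the admissible error\<close>
    define \<kappa> where "\<kappa> = (2 * (C' + 1) / e') powr (1 / (c - b))"
    have \<kappa>: "\<kappa> > 0" unfolding \<kappa>_def using C'0 e' by simp
    have "\<kappa> powr (c - b) = 2 * (C' + 1) / e'"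
      unfolding \<kappa>_def using assms C'0 e' by (simp add: powr_powr)
    moreover have "\<kappa> powr (b - c) = 1 / \<kappa> powr (c - b)" by (simp add: powr_minus_divide[symmetric])
    ultimately have "\<kappa> powr (b - c) * C' = e' * C' / (2 * (C' + 1))" by simp
    also have "\<dots> \<le> e' / 2" using C'0 e' by (simp add: divide_simps)
    finally have k2: "\<kappa> powr (b - c) * C' \<le> e' / 2" .
    define d where "d = e' / 2 / \<kappa> powr (b - 1)"
    have d: "d > 0" "\<kappa> powr (b - 1) * d = e' / 2" unfolding d_def using e' \<kappa> by auto
    have "\<forall>\<^sub>F k in sequentially. moment 1 T (\<lambda>t. F k t - g t) < ennreal d"
      using lim d(1) by (intro order_tendstoD(2)) auto
    then show "\<forall>\<^sub>F k in sequentially. moment b T (\<lambda>t. F k t - g t) \<le> ennreal e'"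
    proof eventually_elim
      case (elim k)
      have "moment b T (\<lambda>t. F k t - g t) \<le> ennreal (\<kappa> powr (b - 1)) * moment 1 T (\<lambda>t. F k t - g t)
          + ennreal (\<kappa> powr (b - c)) * moment c T (\<lambda>t. F k t - g t)"
        using assms \<kappa> by (intro moment_interpolate strongly_measurable_diff) auto
      also have "\<dots> \<le> ennreal (\<kappa> powr (b - 1)) * ennreal d + ennreal (\<kappa> powr (b - c)) * ennreal C'"
        using elim dc by (intro add_mono mult_left_mono) auto
      also have "\<dots> = ennreal (\<kappa> powr (b - 1) * d + \<kappa> powr (b - c) * C')"
        using d C'0 by (simp add: ennreal_plus[symmetric] ennreal_mult'[symmetric] del: ennreal_plus)
      also have "\<dots> \<le> ennreal e'" using k2 d by (intro ennreal_leI) auto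
      finally show ?case .
    qed
  qed
qed

section \<open>Ehrling's inequality\<close>

text \<open>
  If this failed for some \<open>\<epsilon>\<close>, there would be vectors with \<open>norm (iXB z) = 1\<close>, bounded in the first
  space, whose images in the third space tend to 0. Compactness gives a limit of norm 1 in the
  middle space, and injectivity of the second embedding forces that limit to be 0.
\<close>

lemma Ehrling:
  fixes iXB :: "'x::real_normed_vector \<Rightarrow> 'b::real_normed_vector" and iBY :: "'b \<Rightarrow> 'y::real_normed_vector"
  assumes XB: "compact_embedding iXB" and BY: "continuous_embedding iBY" and "\<epsilon> > 0"
  obtains C where "C \<ge> 0" "\<And>w. norm (iXB w) \<le> \<epsilon> * norm w + C * norm (iBY (iXB w))"
proof -
  have lX: "bounded_linear iXB" and lB: "bounded_linear iBY" and inj: "inj iBY"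
    using XB BY unfolding compact_embedding_def continuous_embedding_def by auto
  interpret X: bounded_linear iXB by (rule lX)
  interpret B: bounded_linear iBY by (rule lB)
  have "\<exists>C\<ge>0. \<forall>w. norm (iXB w) \<le> \<epsilon> * norm w + C * norm (iBY (iXB w))"
  proof (rule ccontr)
    assume "\<not> ?thesis"
    then have "\<exists>w. \<epsilon> * norm w + real n * norm (iBY (iXB w)) < norm (iXB w)" for n
      by (metis not_le of_nat_0_le_iff)
    then obtain w where w: "\<And>n. \<epsilon> * norm (w n) + real n * norm (iBY (iXB (w n))) < norm (iXB (w n))" by metis
    \<comment> \<open>normalized in the middle space; the failing inequality then bounds \<open>z n\<close> in the first space\<close>
    define z where "z n = w n /\<^sub>R norm (iXB (w n))" for n
    have pos: "norm (iXB (w n)) > 0" for n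
      by (rule le_less_trans[OF _ w[of n]]) (use \<open>\<epsilon> > 0\<close> in simp)
    have z1: "norm (iXB (z n)) = 1" for n unfolding z_def X.scaleR using pos[of n] by simp
    have zw: "\<epsilon> * norm (z n) + real n * norm (iBY (iXB (z n))) < 1" for n
    proof -
      have "\<epsilon> * norm (z n) + real n * norm (iBY (iXB (z n))) =
          (\<epsilon> * norm (w n) + real n * norm (iBY (iXB (w n)))) / norm (iXB (w n))"
        unfolding z_def X.scaleR B.scaleR by (simp add: divide_inverse algebra_simps)
      also have "\<dots> < 1" using w[of n] pos[of n] by simp
      finally show ?thesis .
    qed
    have "norm (z n) \<le> 1 / \<epsilon>" for n
    proof -
      have "0 \<le> real n * norm (iBY (iXB (z n)))" by simp
      then have "\<epsilon> * norm (z n) \<le> 1" using zw[of n] by linarith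
      then show ?thesis using \<open>\<epsilon> > 0\<close> by (simp add: field_simps)
    qed
    then have "bounded (range z)" by (auto intro!: boundedI)
    then have "compact (closure (iXB ` range z))" using XB unfolding compact_embedding_def by blast
    moreover have "iXB (z n) \<in> closure (iXB ` range z)" for n by (intro closure_subset[THEN subsetD]) auto
    ultimately obtain b r where r: "strict_mono (r :: nat \<Rightarrow> nat)" and lim: "((\<lambda>n. iXB (z n)) \<circ> r) \<longlonglongrightarrow> b"
      by (meson compact_imp_seq_compact seq_compactE)
    have "(\<lambda>n. norm (iXB (z (r n)))) \<longlonglongrightarrow> norm b" using tendsto_norm[OF lim] by (simp add: o_def)
    then have nb: "norm b = 1" unfolding z1 by (simp add: LIMSEQ_const_iff)
    have "(\<lambda>n. iBY (iXB (z (Suc n)))) \<longlonglongrightarrow> 0"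
    proof (rule LIMSEQ_norm_0)
      fix n
      have "0 \<le> \<epsilon> * norm (z (Suc n))" using \<open>\<epsilon> > 0\<close> by simp
      then have "real (Suc n) * norm (iBY (iXB (z (Suc n)))) < 1" using zw[of "Suc n"] by linarith
      then show "norm (iBY (iXB (z (Suc n)))) < 1 / real (Suc n)" by (simp add: field_simps)
    qed
    then have "(\<lambda>n. iBY (iXB (z n))) \<longlonglongrightarrow> 0" by (rule LIMSEQ_imp_Suc)
    then have "(\<lambda>n. iBY (iXB (z (r n)))) \<longlonglongrightarrow> 0" using LIMSEQ_subseq_LIMSEQ[OF _ r] by (auto simp: o_def)
    moreover have "(\<lambda>n. iBY (iXB (z (r n)))) \<longlonglongrightarrow> iBY b" using B.tendsto[OF lim] by (simp add: o_def)
    ultimately have "iBY b = 0" by (blast intro: LIMSEQ_unique)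
    then have "b = 0" using inj B.zero by (metis injD)
    then show False using nb by simp
  qed
  then show ?thesis using that by blast
qed

section \<open>Partitions and good points\<close>

lemma time_partition_less:
  assumes "time_partition T N \<nu>" "i < j" "j \<le> N" shows "\<nu> i < \<nu> j"
  using assms(2,3)
proof (induction j)
  case (Suc j)
  have "\<nu> j < \<nu> (Suc j)" using assms(1) Suc.prems unfolding time_partition_def by auto
  then show ?case using Suc by (cases "i = j") (auto intro: less_trans)
qed simp

lemma time_partition_le:
  assumes "time_partition T N \<nu>" "i \<le> j" "j \<le> N" shows "\<nu> i \<le> \<nu> j"
  using time_partition_less[OF assms(1), of i j] assms by (cases "i = j") auto

lemma time_partition_bounds:
  assumes "time_partition T N \<nu>" "i \<le> N" shows "0 \<le> \<nu> i" "\<nu> i \<le> T"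
  using time_partition_le[OF assms(1), of 0 i] time_partition_le[OF assms(1), of i N] assms
  unfolding time_partition_def by auto

lemma borel_measurable_indicator_time [measurable]:
  "(indicator {a..<b} :: real \<Rightarrow> ennreal) \<in> borel_measurable (time_measure T)" for a b :: real
  by (intro measurable_restrict_space1 borel_measurable_indicator) simp

text \<open>
  Used for the time partitions of the approximate solutions as well as for uniform partitions.
\<close>

lemma nn_integral_partition:
  assumes part: "time_partition T N \<nu>" and [measurable]: "F \<in> borel_measurable (time_measure T)"
  shows "(\<integral>\<^sup>+t. F t \<partial>time_measure T) =
    (\<Sum>j<N. \<integral>\<^sup>+t. F t * indicator {\<nu> j..<\<nu> (Suc j)} t \<partial>time_measure T)"
proof -
  have "(\<Sum>j<m. indicator {\<nu> j..<\<nu> (Suc j)} t) = (indicator {\<nu> 0..<\<nu> m} t :: ennreal)" if "m \<le> N" for m t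
    using that
  proof (induction m)
    case (Suc m)
    have "\<nu> 0 \<le> \<nu> m" "\<nu> m \<le> \<nu> (Suc m)" using Suc.prems by (auto intro!: time_partition_le[OF part])
    then show ?case using Suc by (auto simp: indicator_def)
  qed simp
  moreover have "\<nu> 0 = 0" "\<nu> N = T" using part unfolding time_partition_def by auto
  ultimately have "(\<Sum>j<N. F t * indicator {\<nu> j..<\<nu> (Suc j)} t) = F t" if "t \<in> space (time_measure T)" for t
    using that unfolding sum_distrib_left[symmetric] by (simp add: indicator_def)
  then have "(\<integral>\<^sup>+t. F t \<partial>time_measure T) =
      (\<integral>\<^sup>+t. (\<Sum>j<N. F t * indicator {\<nu> j..<\<nu> (Suc j)} t) \<partial>time_measure T)"
    by (intro nn_integral_cong) simp
  also have "\<dots> = (\<Sum>j<N. \<integral>\<^sup>+t. F t * indicator {\<nu> j..<\<nu> (Suc j)} t \<partial>time_measure T)"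
    by (rule nn_integral_sum) measurable
  finally show ?thesis .
qed

lemma nn_integral_cell:
  assumes "0 \<le> a" "a \<le> b" "b \<le> T"
  shows "(\<integral>\<^sup>+t. indicator {a..<b} t \<partial>time_measure T) = ennreal (b - a)"
proof -
  have "(\<integral>\<^sup>+t. indicator {a..<b} t \<partial>time_measure T) = (\<integral>\<^sup>+t. indicator ({a..<b} \<inter> {0<..<T}) t \<partial>lebesgue)"
    by (subst nn_integral_restrict_space) (simp_all add: indicator_inter_arith[abs_def] del: nn_integral_indicator)
  also have "\<dots> = emeasure lebesgue ({a..<b} \<inter> {0<..<T})" by simp
  also have "{a..<b} \<inter> {0<..<T} = (if a = 0 then {a<..<b} else {a..<b})" using assms by auto
  also have "emeasure lebesgue \<dots> = ennreal (b - a)" using assms by simp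
  finally show ?thesis .
qed

text \<open>
  A function cannot exceed its mean everywhere. Such points replace averages of vector-valued
  functions: the value at a good point is as well controlled as a mean value would be, and no
  integral in a Banach space is needed.
\<close>

lemma ex_good_point:
  assumes [measurable]: "\<psi> \<in> borel_measurable (time_measure T)" and ab: "0 \<le> a" "a < b" "b \<le> T"
  obtains s where "a \<le> s" "s < b" "0 < s" "s < T"
    "ennreal (b - a) * \<psi> s \<le> (\<integral>\<^sup>+t. \<psi> t * indicator {a..<b} t \<partial>time_measure T)"
proof -
  let ?I = "\<integral>\<^sup>+t. \<psi> t * indicator {a..<b} t \<partial>time_measure T"
  have "\<exists>s\<in>{a..<b} \<inter> {0<..<T}. ennreal (b - a) * \<psi> s \<le> ?I"
  proof (rule ccontr)
    assume "\<not> ?thesis"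
    then have less: "?I < ennreal (b - a) * \<psi> s" if "s \<in> {a..<b} \<inter> {0<..<T}" for s using that by (meson not_le)
    have "(a + b) / 2 \<in> {a..<b} \<inter> {0<..<T}" using ab by auto
    from less[OF this] have "?I \<noteq> top" by (auto simp: top_unique)
    then obtain i where i: "?I = ennreal i" "i \<ge> 0" by (cases ?I rule: ennreal_cases) auto
    let ?q = "ennreal (i / (b - a))"
    have bq: "ennreal (b - a) * ?q = ?I" using i ab by (simp add: ennreal_mult'[symmetric])
    have q: "?q < \<psi> s" if "s \<in> {a..<b} \<inter> {0<..<T}" for s
    proof (rule ccontr)
      assume "\<not> ?q < \<psi> s"
      then have "ennreal (b - a) * \<psi> s \<le> ennreal (b - a) * ?q" by (intro mult_left_mono) auto
      then show False using less[OF that] unfolding bq by simp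
    qed
    have cI: "(\<integral>\<^sup>+t. ?q * indicator {a..<b} t \<partial>time_measure T) = ?I"
    proof -
      have "(\<integral>\<^sup>+t. ?q * indicator {a..<b} t \<partial>time_measure T) = ?q * ennreal (b - a)"
        using ab nn_integral_cell[of a b T] by (subst nn_integral_cmult) auto
      then show ?thesis using bq by (simp add: mult.commute)
    qed
    have "(\<integral>\<^sup>+t. ?q * indicator {a..<b} t \<partial>time_measure T) < ?I"
    proof (rule nn_integral_less)
      show "(\<integral>\<^sup>+t. ?q * indicator {a..<b} t \<partial>time_measure T) \<noteq> \<infinity>" unfolding cI i by simp
      show "AE t in time_measure T. ?q * indicator {a..<b} t \<le> \<psi> t * indicator {a..<b} t"
        using q by (intro AE_I2) (auto simp: indicator_def less_imp_le)
      show "\<not> (AE t in time_measure T. \<psi> t * indicator {a..<b} t \<le> ?q * indicator {a..<b} t)"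
      proof
        assume "AE t in time_measure T. \<psi> t * indicator {a..<b} t \<le> ?q * indicator {a..<b} t"
        moreover have "AE t in time_measure T. t \<in> space (time_measure T)" by (rule AE_space)
        ultimately have "AE t in time_measure T. (indicator {a..<b} t :: ennreal) = 0"
        proof eventually_elim
          case (elim t)
          then show ?case using q[of t] by (cases "t \<in> {a..<b}") auto
        qed
        then have "(\<integral>\<^sup>+t. indicator {a..<b} t \<partial>time_measure T) = 0"
          by (subst nn_integral_0_iff_AE) auto
        then show False using ab by (simp add: nn_integral_cell ennreal_eq_0_iff)
      qed
    qed measurable
    then show False unfolding cI by simp
  qed
  then show ?thesis using that by auto
qed

lemma moment_triangle_le:
  assumes "strongly_measurable (time_measure T) f" "strongly_measurable (time_measure T) g"
    "strongly_measurable (time_measure T) h" "p \<ge> 0" "a \<ge> 0" "b \<ge> 0"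
    "moment p T (\<lambda>t. f t - g t) \<le> ennreal a" "moment p T (\<lambda>t. g t - h t) \<le> ennreal b"
  shows "moment p T (\<lambda>t. f t - h t) \<le> ennreal (2 powr p * (a + b))"
proof -
  have "moment p T (\<lambda>t. f t - h t) \<le>
      ennreal (2 powr p) * (moment p T (\<lambda>t. f t - g t) + moment p T (\<lambda>t. g t - h t))"
    using assms by (intro moment_triangle) auto
  also have "\<dots> \<le> ennreal (2 powr p) * (ennreal a + ennreal b)"
    using assms by (intro mult_left_mono add_mono) auto
  also have "\<dots> = ennreal (2 powr p * (a + b))"
    using assms by (simp add: ennreal_plus[symmetric] ennreal_mult'[symmetric] del: ennreal_plus)
  finally show ?thesis .
qed

lemma step_index_eq:
  assumes "T > 0" "m > 0" "real j * T / real m \<le> t" "t < real (Suc j) * T / real m"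
  shows "step_index T m t = j"
proof -
  have "real j \<le> real m * t / T" "real m * t / T < real j + 1" using assms by (auto simp: field_simps)
  then have "\<lfloor>real m * t / T\<rfloor> = int j" by (simp add: floor_eq_iff)
  then show ?thesis unfolding step_index_def by simp
qed

section \<open>Compactness of continuous functions with controlled increments\<close>

text \<open>
  On each of \<open>m\<close> equal cells the function is replaced by its value at a point where \<open>norm (v t) powr p\<close>
  does not exceed its mean. Ehrling's inequality splits the error: the part in the first norm is
  small with \<open>\<epsilon>\<close>, because good points do not increase the \<open>p\<close>-th moment, and the part in the
  third norm is bounded by the variation of \<open>\<theta>\<close> over the cell. The variations add up to
  \<open>D\<close>, whence the factor \<open>T / m\<close>. The points are chosen before \<open>\<epsilon>\<close>, as the compactness argument
  fixes them once and for all.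
\<close>

lemma step_approximation:
  fixes v :: "real \<Rightarrow> 'x::banach" and iXB :: "'x \<Rightarrow> 'b::banach" and iBY :: "'b \<Rightarrow> 'y::banach"
  assumes XB: "bounded_linear iXB" and BY: "bounded_linear iBY" and T: "T > 0" and p: "p \<ge> 1" and m: "m > 0"
    and cont: "continuous_on {0..T} v"
    and A: "moment p T v \<le> ennreal A" "A \<ge> 0"
    and \<theta>: "\<And>s t. 0 \<le> s \<Longrightarrow> s \<le> t \<Longrightarrow> t \<le> T \<Longrightarrow> norm (iBY (iXB (v t)) - iBY (iXB (v s))) \<le> \<theta> t - \<theta> s"
    and D: "\<theta> T - \<theta> 0 \<le> D"
  obtains \<sigma> :: "nat \<Rightarrow> real"
    where "\<And>j. j < m \<Longrightarrow> T / real m * norm (v (\<sigma> j)) powr p \<le> A"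
      "\<And>\<epsilon> C. \<epsilon> \<ge> 0 \<Longrightarrow> C \<ge> 0 \<Longrightarrow> (\<And>w. norm (iXB w) \<le> \<epsilon> * norm w + C * norm (iBY (iXB w))) \<Longrightarrow>
        moment p T (\<lambda>t. iXB (v t) - iXB (v (\<sigma> (step_index T m t))))
          \<le> ennreal (2 * 4 powr p * \<epsilon> powr p * A + 2 powr p * C powr p * D powr p * (T / real m))"
proof -
  interpret X: bounded_linear iXB by (rule XB)
  interpret B: bounded_linear iBY by (rule BY)
  define \<nu> where "\<nu> j = real j * T / real m" for j
  define h where "h = T / real m"
  have h: "h > 0" using T m unfolding h_def by simp
  have part: "time_partition T m \<nu>" unfolding time_partition_def \<nu>_def using T m by (auto simp: divide_strict_right_mono)
  have \<nu>h: "\<nu> (Suc j) - \<nu> j = h" for j unfolding \<nu>_def h_def by (simp add: diff_divide_distrib[symmetric] algebra_simps)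
  have mono: "\<theta> s \<le> \<theta> t" if "0 \<le> s" "s \<le> t" "t \<le> T" for s t
    using \<theta>[OF that] norm_ge_zero[of "iBY (iXB (v t)) - iBY (iXB (v s))"] by linarith
  have [measurable]: "(\<lambda>t. norm (v t)) \<in> borel_measurable (time_measure T)"
    by (intro strongly_measurable_norm strongly_measurable_continuous cont T)
  define F where "F t = ennreal (norm (v t) powr p)" for t
  have [measurable]: "F \<in> borel_measurable (time_measure T)" unfolding F_def[abs_def] by measurable
  define a where "a j = (\<integral>\<^sup>+t. F t * indicator {\<nu> j..<\<nu> (Suc j)} t \<partial>time_measure T)" for j
  have sum_a: "(\<Sum>j<m. a j) = moment p T v"
    unfolding moment_def a_def using nn_integral_partition[OF part, of F] unfolding F_def by simp
  have "\<exists>s. j < m \<longrightarrow> \<nu> j \<le> s \<and> s < \<nu> (Suc j) \<and> 0 < s \<and> s < T \<and> ennreal h * F s \<le> a j" for j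
  proof (cases "j < m")
    case True
    have "0 \<le> \<nu> j" "\<nu> j < \<nu> (Suc j)" "\<nu> (Suc j) \<le> T"
      using True time_partition_bounds[OF part] time_partition_less[OF part] by auto
    then obtain s where "\<nu> j \<le> s" "s < \<nu> (Suc j)" "0 < s" "s < T"
      "ennreal (\<nu> (Suc j) - \<nu> j) * F s \<le> (\<integral>\<^sup>+t. F t * indicator {\<nu> j..<\<nu> (Suc j)} t \<partial>time_measure T)"
      using ex_good_point[of F T "\<nu> j" "\<nu> (Suc j)"] by auto
    then show ?thesis unfolding \<nu>h a_def by blast
  qed simp
  then obtain \<sigma> where \<sigma>: "\<And>j. j < m \<Longrightarrow> \<nu> j \<le> \<sigma> j \<and> \<sigma> j < \<nu> (Suc j) \<and> 0 < \<sigma> j \<and> \<sigma> j < T \<and> ennreal h * F (\<sigma> j) \<le> a j"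
    by metis
  show ?thesis
  proof (rule that[of \<sigma>])
    fix j assume j: "j < m"
    have "ennreal (h * norm (v (\<sigma> j)) powr p) = ennreal h * F (\<sigma> j)"
      unfolding F_def using h by (simp add: ennreal_mult')
    also have "\<dots> \<le> a j" using \<sigma>[OF j] by blast
    also have "\<dots> \<le> (\<Sum>j<m. a j)" using j by (intro member_le_sum) auto
    also have "\<dots> \<le> ennreal A" unfolding sum_a by (rule A)
    finally show "T / real m * norm (v (\<sigma> j)) powr p \<le> A" using A(2) unfolding h_def by simp
  next
    fix \<epsilon> C :: real
    assume \<epsilon>: "\<epsilon> \<ge> 0" and C: "C \<ge> 0" and E: "\<And>w. norm (iXB w) \<le> \<epsilon> * norm w + C * norm (iBY (iXB w))"
    define d where "d j = \<theta> (\<nu> (Suc j)) - \<theta> (\<nu> j)" for j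
    define G where "G t = ennreal (norm (iXB (v t) - iXB (v (\<sigma> (step_index T m t)))) powr p)" for t
    have "strongly_measurable (time_measure T) (\<lambda>t. iXB (v t) - iXB (v (\<sigma> (step_index T m t))))"
      using simple_function_step[OF m, of T "\<lambda>j. iXB (v (\<sigma> j))"]
      by (intro strongly_measurable_diff strongly_measurable_simple strongly_measurable_bounded_linear[OF XB]
          strongly_measurable_continuous cont T) auto
    from strongly_measurable_norm[OF this]
    have [measurable]: "G \<in> borel_measurable (time_measure T)" unfolding G_def[abs_def] by measurable
    define c1 where "c1 = 4 powr p * \<epsilon> powr p"
    define c2 where "c2 = 2 powr p * C powr p * D powr (p - 1)"
    have c0: "c1 \<ge> 0" "c2 \<ge> 0" unfolding c1_def c2_def by auto
    have d: "0 \<le> d j" "d j \<le> D" if "j < m" for j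
    proof -
      have "0 \<le> \<nu> j" "\<nu> j \<le> \<nu> (Suc j)" "\<nu> (Suc j) \<le> T"
        using that time_partition_bounds[OF part] time_partition_le[OF part] by auto
      then show "0 \<le> d j" "d j \<le> D"
        using mono[of "\<nu> j" "\<nu> (Suc j)"] mono[of 0 "\<nu> j"] mono[of "\<nu> (Suc j)" T] D
        unfolding d_def by linarith+
    qed
    have cell: "(\<integral>\<^sup>+t. G t * indicator {\<nu> j..<\<nu> (Suc j)} t \<partial>time_measure T) \<le>
        ennreal (2 * c1) * a j + ennreal (c2 * h * d j)" if j: "j < m" for j
    proof -
      have b: "0 \<le> \<nu> j" "\<nu> j \<le> \<nu> (Suc j)" "\<nu> (Suc j) \<le> T"
        using j time_partition_bounds[OF part] time_partition_le[OF part] by auto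
      have pt: "G t \<le> ennreal c1 * F t + ennreal (c1 * norm (v (\<sigma> j)) powr p + c2 * d j)"
        if t: "\<nu> j \<le> t" "t < \<nu> (Suc j)" for t
      proof -
        have ix: "step_index T m t = j" using t T m by (intro step_index_eq) (auto simp: \<nu>_def)
        have s: "\<nu> j \<le> \<sigma> j" "\<sigma> j < \<nu> (Suc j)" using \<sigma>[OF j] by auto
        have Y: "norm (iBY (iXB (v t)) - iBY (iXB (v (\<sigma> j)))) \<le> d j"
        proof (cases "\<sigma> j \<le> t")
          case True
          then show ?thesis using \<theta>[of "\<sigma> j" t] s t b mono[of "\<nu> j" "\<sigma> j"] mono[of t "\<nu> (Suc j)"]
            unfolding d_def by linarith
        next
          case False
          then show ?thesis using \<theta>[of t "\<sigma> j"] s t b mono[of "\<nu> j" t] mono[of "\<sigma> j" "\<nu> (Suc j)"]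
            unfolding d_def by (subst norm_minus_commute) linarith
        qed
        \<comment> \<open>only one power of \<open>d j\<close> is summed over the cells; the others are bounded by \<open>D\<close>\<close>
        have dp: "d j powr p \<le> D powr (p - 1) * d j"
        proof (cases "d j = 0")
          case False
          then have "d j powr p = d j powr (p - 1) * d j" using d[OF j] powr_add[of "d j" "p - 1" 1] by simp
          also have "\<dots> \<le> D powr (p - 1) * d j" using d[OF j] p by (intro mult_right_mono powr_mono2) auto
          finally show ?thesis .
        qed simp
        have "norm (iXB (v t) - iXB (v (\<sigma> j))) \<le> \<epsilon> * norm (v t - v (\<sigma> j)) + C * norm (iBY (iXB (v t - v (\<sigma> j))))"
          using E[of "v t - v (\<sigma> j)"] by (simp add: X.diff)
        also have "\<dots> \<le> \<epsilon> * (norm (v t) + norm (v (\<sigma> j))) + C * d j"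
          using Y \<epsilon> C by (intro add_mono mult_left_mono norm_triangle_ineq4) (auto simp: X.diff B.diff)
        finally have "norm (iXB (v t) - iXB (v (\<sigma> j))) powr p \<le> (\<epsilon> * (norm (v t) + norm (v (\<sigma> j))) + C * d j) powr p"
          using p by (intro powr_mono2) auto
        also have "\<dots> \<le> 2 powr p * ((\<epsilon> * (norm (v t) + norm (v (\<sigma> j)))) powr p + (C * d j) powr p)"
          using \<epsilon> C d[OF j] p by (intro powr_add_le) auto
        also have "\<dots> = 2 powr p * (\<epsilon> powr p * (norm (v t) + norm (v (\<sigma> j))) powr p + C powr p * d j powr p)"
          using \<epsilon> C d[OF j] by (simp add: powr_mult)
        also have "\<dots> \<le> 2 powr p * (\<epsilon> powr p * (2 powr p * (norm (v t) powr p + norm (v (\<sigma> j)) powr p)) + C powr p * (D powr (p - 1) * d j))"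
          using p dp by (intro mult_left_mono add_mono powr_add_le) auto
        also have "\<dots> = c1 * norm (v t) powr p + (c1 * norm (v (\<sigma> j)) powr p + c2 * d j)"
        proof -
          have "(4::real) powr p = 2 powr p * 2 powr p" using powr_mult[of 2 2 p] by simp
          then show ?thesis unfolding c1_def c2_def by (simp add: algebra_simps)
        qed
        finally have "G t \<le> ennreal (c1 * norm (v t) powr p + (c1 * norm (v (\<sigma> j)) powr p + c2 * d j))"
          unfolding G_def ix by (rule ennreal_leI)
        also have "\<dots> = ennreal c1 * F t + ennreal (c1 * norm (v (\<sigma> j)) powr p + c2 * d j)"
          unfolding F_def using c0 d[OF j] by (simp add: ennreal_plus ennreal_mult')
        finally show ?thesis .
      qed
      have "(\<integral>\<^sup>+t. G t * indicator {\<nu> j..<\<nu> (Suc j)} t \<partial>time_measure T) \<le>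
          (\<integral>\<^sup>+t. ennreal c1 * (F t * indicator {\<nu> j..<\<nu> (Suc j)} t) +
            ennreal (c1 * norm (v (\<sigma> j)) powr p + c2 * d j) * indicator {\<nu> j..<\<nu> (Suc j)} t \<partial>time_measure T)"
        using pt by (intro nn_integral_mono) (auto simp: indicator_def)
      also have "\<dots> = ennreal c1 * a j + ennreal (c1 * norm (v (\<sigma> j)) powr p + c2 * d j) * ennreal h"
        unfolding a_def using b by (simp add: nn_integral_add nn_integral_cmult nn_integral_cell \<nu>h)
      also have "\<dots> = ennreal c1 * a j + (ennreal c1 * (ennreal h * F (\<sigma> j)) + ennreal (c2 * h * d j))"
        unfolding F_def using c0 d[OF j] h
        by (simp add: ennreal_plus[symmetric] ennreal_mult'[symmetric] algebra_simps del: ennreal_plus)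
      \<comment> \<open>the good point contributes at most as much as the function itself\<close>
      also have "\<dots> \<le> ennreal c1 * a j + (ennreal c1 * a j + ennreal (c2 * h * d j))"
        using \<sigma>[OF j] by (intro add_left_mono add_right_mono mult_left_mono) auto
      also have "\<dots> = ennreal (2 * c1) * a j + ennreal (c2 * h * d j)"
        using c0 by (simp add: ennreal_mult' mult_2[symmetric] add.assoc[symmetric] mult.assoc)
      finally show ?thesis .
    qed
    have "moment p T (\<lambda>t. iXB (v t) - iXB (v (\<sigma> (step_index T m t)))) =
        (\<Sum>j<m. \<integral>\<^sup>+t. G t * indicator {\<nu> j..<\<nu> (Suc j)} t \<partial>time_measure T)"
      unfolding moment_def G_def[symmetric] by (rule nn_integral_partition[OF part]) measurable
    also have "\<dots> \<le> (\<Sum>j<m. ennreal (2 * c1) * a j + ennreal (c2 * h * d j))"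
      using cell by (intro sum_mono) auto
    also have "\<dots> = ennreal (2 * c1) * moment p T v + ennreal (c2 * h * (\<Sum>j<m. d j))"
      using c0 h d unfolding sum.distrib sum_a[symmetric] sum_distrib_left
      by (subst sum_ennreal) auto
    also have "(\<Sum>j<m. d j) = \<theta> T - \<theta> 0"
      unfolding d_def using part by (subst sum_lessThan_telescope) (simp add: time_partition_def)
    also have "ennreal (2 * c1) * moment p T v + ennreal (c2 * h * (\<theta> T - \<theta> 0)) \<le>
        ennreal (2 * c1) * ennreal A + ennreal (c2 * h * D)"
      using A c0 h D by (intro add_mono mult_left_mono ennreal_leI) auto
    also have "\<dots> = ennreal (2 * c1 * A + c2 * h * D)"
    proof -
      have "0 \<le> D" using D mono[of 0 T] T by linarith
      then show ?thesis using c0 A h by (simp add: ennreal_plus[symmetric] ennreal_mult'[symmetric] del: ennreal_plus)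
    qed
    also have "2 * c1 * A + c2 * h * D = 2 * 4 powr p * \<epsilon> powr p * A + 2 powr p * C powr p * D powr p * (T / real m)"
    proof (cases "D = 0")
      case False
      then have "D > 0" using D mono[of 0 T] T by linarith
      then have "D powr p = D powr (p - 1) * D" using powr_add[of D "p - 1" 1] by simp
      then show ?thesis unfolding c1_def c2_def h_def by (simp add: algebra_simps)
    qed (simp add: c1_def c2_def h_def algebra_simps)
    finally show "moment p T (\<lambda>t. iXB (v t) - iXB (v (\<sigma> (step_index T m t)))) \<le>
      ennreal (2 * 4 powr p * \<epsilon> powr p * A + 2 powr p * C powr p * D powr p * (T / real m))" .
  qed
qed

text \<open>
  Splits an admissible error over three steps when each triangle inequality costs a factor \<open>c\<close>.
\<close>

lemma ex_triangle_budget: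
  fixes c e :: real
  assumes "c > 0" "e > 0"
  shows "\<exists>e'>0. c * (e' + c * (e' + e')) = e"
proof (intro exI conjI)
  have pos: "c * (1 + 2 * c) > 0" using assms by simp
  show "e / (c * (1 + 2 * c)) > 0" using pos assms by simp
  have *: "c * (x + c * (x + x)) = x * (c * (1 + 2 * c))" for x by (simp add: algebra_simps)
  show "c * (e / (c * (1 + 2 * c)) + c * (e / (c * (1 + 2 * c)) + e / (c * (1 + 2 * c)))) = e"
    unfolding * using pos by (metis nonzero_eq_divide_eq less_irrefl)
qed

text \<open>
  The derivative enters only through its primitive \<open>\<theta> k\<close>, so that an integrable derivative suffices
  and no weak derivative has to be defined. The step functions built from good points approximate
  the given functions uniformly in the index, by the previous lemma. For a fixed number of cells their
  finitely many values lie in relatively compact images of bounded sets, so a diagonal subsequence makes all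
  these values converge at once. Along it the functions are Cauchy, and suitable step
  functions produce the limit.
\<close>

theorem Aubin_Lions_Simon:
  fixes v :: "nat \<Rightarrow> real \<Rightarrow> 'x::banach" and iXB :: "'x \<Rightarrow> 'b::banach" and iBY :: "'b \<Rightarrow> 'y::banach"
  assumes XB: "compact_embedding iXB" and BY: "continuous_embedding iBY" and T: "T > 0" and p: "p \<ge> 1"
    and cont: "\<And>k. continuous_on {0..T} (v k)"
    and A: "\<And>k. moment p T (v k) \<le> ennreal A"
    and \<theta>: "\<And>k s t. 0 \<le> s \<Longrightarrow> s \<le> t \<Longrightarrow> t \<le> T \<Longrightarrow> norm (iBY (iXB (v k t)) - iBY (iXB (v k s))) \<le> \<theta> k t - \<theta> k s"
    and D: "\<And>k. \<theta> k T - \<theta> k 0 \<le> D"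
  obtains \<phi> g where "strict_mono (\<phi> :: nat \<Rightarrow> nat)" "strongly_measurable (time_measure T) g"
    "(\<lambda>i. moment p T (\<lambda>t. iXB (v (\<phi> i) t) - g t)) \<longlonglongrightarrow> 0"
proof -
  have lX: "bounded_linear iXB" and lB: "bounded_linear iBY"
    using XB BY unfolding compact_embedding_def continuous_embedding_def by auto
  define A' where "A' = \<bar>A\<bar>"
  have A': "moment p T (v k) \<le> ennreal A'" "A' \<ge> 0" for k
    unfolding A'_def by (auto intro: order_trans[OF A] ennreal_leI)
  define good where "good k m \<sigma> \<longleftrightarrow> (\<forall>j<Suc m. T / real (Suc m) * norm (v k (\<sigma> j)) powr p \<le> A') \<and>
      (\<forall>\<epsilon> C. \<epsilon> \<ge> 0 \<longrightarrow> C \<ge> 0 \<longrightarrow> (\<forall>w. norm (iXB w) \<le> \<epsilon> * norm w + C * norm (iBY (iXB w))) \<longrightarrow>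
        moment p T (\<lambda>t. iXB (v k t) - iXB (v k (\<sigma> (step_index T (Suc m) t))))
          \<le> ennreal (2 * 4 powr p * \<epsilon> powr p * A' + 2 powr p * C powr p * D powr p * (T / real (Suc m))))"
    for k m and \<sigma> :: "nat \<Rightarrow> real"
  have "\<exists>\<sigma>. good k m \<sigma>" for k m
  proof -
    obtain \<sigma> where "\<And>j. j < Suc m \<Longrightarrow> T / real (Suc m) * norm (v k (\<sigma> j)) powr p \<le> A'"
      "\<And>\<epsilon> C. \<epsilon> \<ge> 0 \<Longrightarrow> C \<ge> 0 \<Longrightarrow> (\<And>w. norm (iXB w) \<le> \<epsilon> * norm w + C * norm (iBY (iXB w))) \<Longrightarrow>
        moment p T (\<lambda>t. iXB (v k t) - iXB (v k (\<sigma> (step_index T (Suc m) t))))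
          \<le> ennreal (2 * 4 powr p * \<epsilon> powr p * A' + 2 powr p * C powr p * D powr p * (T / real (Suc m)))"
      by (rule step_approximation[where v = "v k" and m = "Suc m" and A = A' and \<theta> = "\<theta> k" and D = D,
            OF lX lB T p zero_less_Suc cont A' \<theta> D]) blast+
    then have "good k m \<sigma>" unfolding good_def by blast
    then show ?thesis by blast
  qed
  then obtain \<sigma> where "\<And>k m. good k m (\<sigma> k m)" by metis
  then have \<sigma>: "\<And>k m j. j < Suc m \<Longrightarrow> T / real (Suc m) * norm (v k (\<sigma> k m j)) powr p \<le> A'"
    and approx: "\<And>k m \<epsilon> C. \<epsilon> \<ge> 0 \<Longrightarrow> C \<ge> 0 \<Longrightarrow> (\<forall>w. norm (iXB w) \<le> \<epsilon> * norm w + C * norm (iBY (iXB w))) \<Longrightarrow>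
        moment p T (\<lambda>t. iXB (v k t) - iXB (v k (\<sigma> k m (step_index T (Suc m) t))))
          \<le> ennreal (2 * 4 powr p * \<epsilon> powr p * A' + 2 powr p * C powr p * D powr p * (T / real (Suc m)))"
    unfolding good_def by blast+
  define c where "c k m j = iXB (v k (\<sigma> k m j))" for k m j
  define S where "S m k t = c k m (step_index T (Suc m) t)" for m k t
  have S: "simple_function (time_measure T) (S m k)" for m k
    unfolding S_def by (rule simple_function_step) simp
  have mF: "strongly_measurable (time_measure T) (\<lambda>t. iXB (v k t))" for k
    by (intro strongly_measurable_bounded_linear[OF lX] strongly_measurable_continuous cont T)
  have mS: "strongly_measurable (time_measure T) (S m k)" for m k by (rule strongly_measurable_simple[OF S])
  have small: "\<exists>m. \<forall>k. moment p T (\<lambda>t. iXB (v k t) - S m k t) \<le> ennreal e" if e: "e > 0" for e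
  proof -
    define \<epsilon> where "\<epsilon> = (e / (4 * 4 powr p * (A' + 1))) powr (1 / p)"
    have \<epsilon>0: "\<epsilon> > 0" unfolding \<epsilon>_def using e A' by simp
    have "\<epsilon> powr p = e / (4 * 4 powr p * (A' + 1))" unfolding \<epsilon>_def using p e A' by (simp add: powr_powr)
    then have "2 * 4 powr p * \<epsilon> powr p * A' = e / 2 * (A' / (A' + 1))"
      using A'(2) by (simp add: frac_eq_eq add_eq_0_iff)
    also have "\<dots> \<le> e / 2 * 1" using e A' by (intro mult_left_mono) auto
    finally have e1: "2 * 4 powr p * \<epsilon> powr p * A' \<le> e / 2" by simp
    obtain C where C: "C \<ge> 0" "\<And>w. norm (iXB w) \<le> \<epsilon> * norm w + C * norm (iBY (iXB w))"
      using Ehrling[OF XB BY \<epsilon>0] by blast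
    define L where "L = 2 powr p * C powr p * D powr p * T"
    have L: "L \<ge> 0" unfolding L_def using T by simp
    obtain m :: nat where m: "L / (e / 2) < real m" using reals_Archimedean2 by blast
    have "L / real (Suc m) \<le> e / 2" using m e L by (simp add: field_simps)
    then have e2: "2 powr p * C powr p * D powr p * (T / real (Suc m)) \<le> e / 2" unfolding L_def by simp
    have "moment p T (\<lambda>t. iXB (v k t) - S m k t) \<le> ennreal e" for k
    proof -
      have "moment p T (\<lambda>t. iXB (v k t) - S m k t) \<le>
          ennreal (2 * 4 powr p * \<epsilon> powr p * A' + 2 powr p * C powr p * D powr p * (T / real (Suc m)))"
        unfolding S_def c_def using \<epsilon>0 C by (intro approx) auto
      also have "\<dots> \<le> ennreal e" using e1 e2 by (intro ennreal_leI) linarith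
      finally show ?thesis .
    qed
    then show ?thesis by blast
  qed
  \<comment> \<open>one property for each pair of a number \<open>m\<close> of cells (less one) and a cell \<open>j\<close>\<close>
  interpret subseqs "\<lambda>n s. snd (prod_decode n) \<le> fst (prod_decode n) \<longrightarrow>
      convergent (\<lambda>i. c (s i) (fst (prod_decode n)) (snd (prod_decode n)))"
  proof
    fix n and s :: "nat \<Rightarrow> nat"
    let ?m = "fst (prod_decode n)" and ?j = "snd (prod_decode n)"
    show "\<exists>r'. strict_mono r' \<and> (?j \<le> ?m \<longrightarrow> convergent (\<lambda>i. c ((s \<circ> r') i) ?m ?j))"
    proof (cases "?j \<le> ?m")
      case True
      let ?R = "(A' * real (Suc ?m) / T) powr (1 / p)"
      have "norm (v k (\<sigma> k ?m ?j)) \<le> ?R" for k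
      proof -
        have "norm (v k (\<sigma> k ?m ?j)) powr p \<le> A' * real (Suc ?m) / T"
          using \<sigma>[of ?j ?m k] True T by (simp add: field_simps)
        then have "(norm (v k (\<sigma> k ?m ?j)) powr p) powr (1 / p) \<le> ?R" using p by (intro powr_mono2) auto
        then show ?thesis using p by (simp add: powr_powr)
      qed
      then have "bounded (range (\<lambda>k. v k (\<sigma> k ?m ?j)))" by (auto intro!: boundedI)
      then have "compact (closure (iXB ` range (\<lambda>k. v k (\<sigma> k ?m ?j))))"
        using XB unfolding compact_embedding_def by blast
      moreover have "c k ?m ?j \<in> closure (iXB ` range (\<lambda>k. v k (\<sigma> k ?m ?j)))" for k
        unfolding c_def by (intro closure_subset[THEN subsetD]) auto
      ultimately obtain b r where "strict_mono (r :: nat \<Rightarrow> nat)" "((\<lambda>i. c (s i) ?m ?j) \<circ> r) \<longlonglongrightarrow> b"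
        using compact_imp_seq_compact seq_compactE[of _ "\<lambda>i. c (s i) ?m ?j"] by metis
      then show ?thesis by (intro exI[of _ r]) (auto simp: o_def convergent_def)
    qed (auto intro: exI[of _ id] simp: strict_mono_def)
  qed
  define \<phi> where "\<phi> = diagseq"
  have \<phi>: "strict_mono \<phi>" unfolding \<phi>_def by (rule subseq_diagseq)
  have conv: "convergent (\<lambda>i. c (\<phi> i) m j)" if "j \<le> m" for m j
  proof -
    have "snd (prod_decode n) \<le> fst (prod_decode n) \<longrightarrow>
      convergent (\<lambda>i. c ((diagseq \<circ> (+) (Suc n)) i) (fst (prod_decode n)) (snd (prod_decode n)))" for n
    proof (rule diagseq_holds)
      fix r s :: "nat \<Rightarrow> nat" and n
      assume r: "strict_mono r" and c: "snd (prod_decode n) \<le> fst (prod_decode n) \<longrightarrow>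
        convergent (\<lambda>i. c (s i) (fst (prod_decode n)) (snd (prod_decode n)))"
      show "snd (prod_decode n) \<le> fst (prod_decode n) \<longrightarrow>
        convergent (\<lambda>i. c ((s \<circ> r) i) (fst (prod_decode n)) (snd (prod_decode n)))"
        using convergent_subseq_convergent[OF _ r] c by (auto simp: o_def)
    qed
    from this[of "prod_encode (m, j)"] have "convergent (\<lambda>i. c (\<phi> (i + Suc (prod_encode (m, j)))) m j)"
      using that unfolding \<phi>_def by (simp add: o_def add.commute)
    then show ?thesis by (subst (asm) convergent_ignore_initial_segment)
  qed
  have SC: "\<exists>K. \<forall>i\<ge>K. \<forall>i'\<ge>K. moment p T (\<lambda>t. S m (\<phi> i) t - S m (\<phi> i') t) \<le> ennreal e" if e: "e > 0" for m e
  proof -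
    define d where "d = (e / T) powr (1 / p)"
    have d: "d > 0" "d powr p * T = e" unfolding d_def using e T p by (auto simp: powr_powr)
    have "\<exists>K. \<forall>i\<ge>K. \<forall>i'\<ge>K. norm (c (\<phi> i) m j - c (\<phi> i') m j) < d" if "j \<le> m" for j
      using CauchyD[OF convergent_Cauchy[OF conv[OF that]] d(1)] by blast
    then obtain K where K: "\<And>j i i'. j \<le> m \<Longrightarrow> i \<ge> K j \<Longrightarrow> i' \<ge> K j \<Longrightarrow> norm (c (\<phi> i) m j - c (\<phi> i') m j) < d"
      by metis
    have "moment p T (\<lambda>t. S m (\<phi> i) t - S m (\<phi> i') t) \<le> ennreal e"
      if "i \<ge> (\<Sum>j\<le>m. K j)" "i' \<ge> (\<Sum>j\<le>m. K j)" for i i'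
    proof -
      have "norm (S m (\<phi> i) t - S m (\<phi> i') t) \<le> d" if t: "t \<in> space (time_measure T)" for t
      proof -
        let ?j = "step_index T (Suc m) t"
        have j: "?j \<le> m" using step_index_less[of t T "Suc m"] t by auto
        have "K ?j \<le> (\<Sum>j\<le>m. K j)" using j by (intro member_le_sum) auto
        then show ?thesis unfolding S_def using K[OF j, of i i'] \<open>i \<ge> _\<close> \<open>i' \<ge> _\<close> by (auto intro: less_imp_le)
      qed
      then have "moment p T (\<lambda>t. S m (\<phi> i) t - S m (\<phi> i') t) \<le> ennreal (d powr p * T)"
        using T p by (intro moment_bounded AE_I2) auto
      then show ?thesis unfolding d(2) .
    qed
    then show ?thesis by blast
  qed
  have p0: "p \<ge> 0" using p by simp
  have FC: "\<exists>K. \<forall>i\<ge>K. \<forall>i'\<ge>K. moment p T (\<lambda>t. iXB (v (\<phi> i) t) - iXB (v (\<phi> i') t)) \<le> ennreal e" if e: "e > 0" for e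
  proof -
    obtain e' where e': "e' > 0" "2 powr p * (e' + 2 powr p * (e' + e')) = e"
      using ex_triangle_budget[of "2 powr p" e] e by auto
    obtain m where m: "\<And>k. moment p T (\<lambda>t. iXB (v k t) - S m k t) \<le> ennreal e'" using small[OF e'(1)] by blast
    obtain K where K: "\<And>i i'. i \<ge> K \<Longrightarrow> i' \<ge> K \<Longrightarrow> moment p T (\<lambda>t. S m (\<phi> i) t - S m (\<phi> i') t) \<le> ennreal e'"
      using SC[OF e'(1)] by blast
    have "moment p T (\<lambda>t. iXB (v (\<phi> i) t) - iXB (v (\<phi> i') t)) \<le> ennreal (2 powr p * (e' + 2 powr p * (e' + e')))"
      if "i \<ge> K" "i' \<ge> K" for i i'
    proof (rule moment_triangle_le[OF mF mS mF p0 _ _ m])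
      show "moment p T (\<lambda>t. S m (\<phi> i) t - iXB (v (\<phi> i') t)) \<le> ennreal (2 powr p * (e' + e'))"
      proof (rule moment_triangle_le[OF mS mS mF p0 _ _ K[OF that]])
        show "moment p T (\<lambda>t. S m (\<phi> i') t - iXB (v (\<phi> i') t)) \<le> ennreal e'"
          using m[of "\<phi> i'"] by (subst moment_commute)
      qed (use e' in auto)
    qed (use e' in auto)
    then show ?thesis unfolding e'(2) by blast
  qed
  have "\<exists>m. \<forall>k. moment p T (\<lambda>t. iXB (v k t) - S m k t) \<le> ennreal (1 / real (Suc i))" for i
    by (rule small) simp
  then obtain M where M: "\<And>i k. moment p T (\<lambda>t. iXB (v k t) - S (M i) k t) \<le> ennreal (1 / real (Suc i))" by metis
  \<comment> \<open>simple functions approaching the subsequence; their limit is the limit of the subsequence\<close>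
  define s where "s i = S (M i) (\<phi> i)" for i
  have sC: "\<exists>K. \<forall>i\<ge>K. \<forall>i'\<ge>K. moment p T (\<lambda>t. s i t - s i' t) \<le> ennreal e" if e: "e > 0" for e
  proof -
    obtain e' where e': "e' > 0" "2 powr p * (e' + 2 powr p * (e' + e')) = e"
      using ex_triangle_budget[of "2 powr p" e] e by auto
    obtain K where K: "\<And>i i'. i \<ge> K \<Longrightarrow> i' \<ge> K \<Longrightarrow> moment p T (\<lambda>t. iXB (v (\<phi> i) t) - iXB (v (\<phi> i') t)) \<le> ennreal e'"
      using FC[OF e'(1)] by blast
    obtain K' :: nat where K': "1 / e' < real K'" using reals_Archimedean2 by blast
    have near: "moment p T (\<lambda>t. iXB (v (\<phi> i) t) - s i t) \<le> ennreal e'" if "i \<ge> K'" for i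
    proof -
      have "1 / real (Suc i) \<le> e'" using K' that e'(1) by (simp add: field_simps) (smt (verit) mult_left_mono of_nat_mono)
      then show ?thesis using M[of "\<phi> i" i] unfolding s_def by (auto intro: order_trans ennreal_leI)
    qed
    have "moment p T (\<lambda>t. s i t - s i' t) \<le> ennreal (2 powr p * (e' + 2 powr p * (e' + e')))"
      if "i \<ge> max K K'" "i' \<ge> max K K'" for i i'
    proof (rule moment_triangle_le[OF _ mF _ p0])
      show "moment p T (\<lambda>t. s i t - iXB (v (\<phi> i) t)) \<le> ennreal e'"
        using near[of i] that by (subst moment_commute) simp
      show "moment p T (\<lambda>t. iXB (v (\<phi> i) t) - s i' t) \<le> ennreal (2 powr p * (e' + e'))"
      proof (rule moment_triangle_le[OF mF mF _ p0])
        show "moment p T (\<lambda>t. iXB (v (\<phi> i) t) - iXB (v (\<phi> i') t)) \<le> ennreal e'" using that by (intro K) auto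
        show "moment p T (\<lambda>t. iXB (v (\<phi> i') t) - s i' t) \<le> ennreal e'" using that by (intro near) auto
      qed (use e' in \<open>auto simp: s_def mS\<close>)
    qed (use e' in \<open>auto simp: s_def mS\<close>)
    then show ?thesis unfolding e'(2) by blast
  qed
  obtain g where g: "strongly_measurable (time_measure T) g" "(\<lambda>i. moment p T (\<lambda>t. s i t - g t)) \<longlonglongrightarrow> 0"
  proof (rule simple_Cauchy_converges[of T s p])
    show "simple_function (time_measure T) (s i)" for i unfolding s_def by (rule S)
    show "T \<ge> 0" using T by simp
    show "\<exists>K. \<forall>m\<ge>K. \<forall>n\<ge>K. moment p T (\<lambda>t. s m t - s n t) \<le> ennreal e" if "e > 0" for e
      using sC[OF that] .
  qed (use p in blast)+
  have "(\<lambda>i. moment p T (\<lambda>t. iXB (v (\<phi> i) t) - g t)) \<longlonglongrightarrow> 0"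
  proof (rule tendsto_sandwich[OF _ _ tendsto_const])
    show "\<forall>\<^sub>F i in sequentially. 0 \<le> moment p T (\<lambda>t. iXB (v (\<phi> i) t) - g t)" by simp
    show "\<forall>\<^sub>F i in sequentially. moment p T (\<lambda>t. iXB (v (\<phi> i) t) - g t) \<le>
        ennreal (2 powr p) * (ennreal (1 / real (Suc i)) + moment p T (\<lambda>t. s i t - g t))"
    proof (rule always_eventually, rule allI)
      fix i
      have "moment p T (\<lambda>t. iXB (v (\<phi> i) t) - g t) \<le>
          ennreal (2 powr p) * (moment p T (\<lambda>t. iXB (v (\<phi> i) t) - s i t) + moment p T (\<lambda>t. s i t - g t))"
        using mF mS g p0 by (intro moment_triangle) (auto simp: s_def)
      also have "\<dots> \<le> ennreal (2 powr p) * (ennreal (1 / real (Suc i)) + moment p T (\<lambda>t. s i t - g t))"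
        unfolding s_def by (intro mult_left_mono add_mono M) auto
      finally show "moment p T (\<lambda>t. iXB (v (\<phi> i) t) - g t) \<le>
        ennreal (2 powr p) * (ennreal (1 / real (Suc i)) + moment p T (\<lambda>t. s i t - g t))" .
    qed
    have "(\<lambda>i. ennreal (1 / real (Suc i))) \<longlonglongrightarrow> ennreal 0"
      by (intro tendsto_ennrealI LIMSEQ_Suc[OF lim_1_over_n])
    then have "(\<lambda>i. ennreal (2 powr p) * (ennreal (1 / real (Suc i)) + moment p T (\<lambda>t. s i t - g t)))
        \<longlonglongrightarrow> ennreal (2 powr p) * (ennreal 0 + 0)"
      by (intro ennreal_tendsto_cmult tendsto_add g(2)) auto
    then show "(\<lambda>i. ennreal (2 powr p) * (ennreal (1 / real (Suc i)) + moment p T (\<lambda>t. s i t - g t))) \<longlonglongrightarrow> 0"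
      by simp
  qed
  then show ?thesis using that \<phi> g(1) by blast
qed

section \<open>Interpolation across dyadic scales\<close>

text \<open>
  The heart of the improved exponents. At scale \<open>h\<close> around \<open>t\<close> there is a point where the first norm
  is at most \<open>R h\<close>, of order \<open>h powr (-1/p)\<close>. Two such points at comparable distance differ
  in the third space by at most a multiple of \<open>h powr \<alpha>\<close>, and interpolation bounds their difference in
  the middle space by a multiple of \<open>h powr (- \<beta>)\<close>. Halving \<open>h\<close> repeatedly, these bounds form a
  geometric series dominated by its last term. The descent stops at the scale at which \<open>t\<close> itself
  is a good point, that is, where \<open>h powr (-1/p)\<close> is of the order of \<open>norm (v t)\<close>; this turns the
  bound \<open>h powr (- \<beta>)\<close> into \<open>norm (v t) powr (p * \<beta>)\<close>. Raised to the power \<open>1 / \<beta>\<close>, the right-hand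
  side is controlled by the \<open>p\<close>-th moment of \<open>v\<close>.
\<close>

lemma multiscale_interpolation:
  fixes iXB :: "'x::banach \<Rightarrow> 'b::banach" and iBY :: "'b \<Rightarrow> 'y::banach"
  assumes XB: "bounded_linear iXB" and BY: "bounded_linear iBY" and T: "T > 0" and p: "p \<ge> 1"
    and A: "A > 0" and D: "D \<ge> 0" and \<alpha>: "\<alpha> \<ge> 0" and \<theta>: "0 < \<theta>" "\<theta> < 1"
    and \<beta>: "\<beta> > 0" "\<theta> / p - (1 - \<theta>) * \<alpha> \<le> \<beta>"
    and interp: "\<And>w. norm (iXB w) \<le> C\<theta> * norm w powr \<theta> * norm (iBY (iXB w)) powr (1 - \<theta>)" and C\<theta>: "C\<theta> > 0"
  obtains C where "C \<ge> 0"
    "\<And>v t. continuous_on {0..T} v \<Longrightarrow> moment p T v \<le> ennreal A \<Longrightarrow>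
       (\<And>s t. 0 \<le> s \<Longrightarrow> s \<le> t \<Longrightarrow> t \<le> T \<Longrightarrow> norm (iBY (iXB (v t)) - iBY (iXB (v s))) \<le> D * (t - s) powr \<alpha>) \<Longrightarrow>
       0 < t \<Longrightarrow> t < T \<Longrightarrow> norm (iXB (v t)) \<le> C * (1 + norm (v t) powr (p * \<beta>))"
proof -
  interpret X: bounded_linear iXB by (rule XB)
  interpret Y: bounded_linear iBY by (rule BY)
  define \<gamma> where "\<gamma> = \<theta> / p - (1 - \<theta>) * \<alpha>"
  define R where "R h = A powr (1 / p) * h powr (- 1 / p)" for h
  define C2 where "C2 = C\<theta> * (2 * A powr (1 / p)) powr \<theta> * (D * 3 powr \<alpha>) powr (1 - \<theta>) * T powr (\<beta> - \<gamma>)"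
  obtain KX where KX: "\<And>w. norm (iXB w) \<le> norm w * KX" "KX \<ge> 0"
    using X.nonneg_bounded by blast
  \<comment> \<open>\<open>C3\<close> covers the coarsest scale and absorbs the geometric series: one halving of the scale maps
    a bound with \<open>C3\<close> to a bound with \<open>C3\<close>\<close>
  define C3 where "C3 = KX * R T * T powr \<beta> + C2 / (1 - 2 powr (- \<beta>))"
  have q: "2 powr (- \<beta>) < (1::real)" using \<beta> by (simp add: powr_less_one)
  have C2: "C2 \<ge> 0" unfolding C2_def using C\<theta> by simp
  have R0: "R h \<ge> 0" for h unfolding R_def by simp
  have C3: "C3 \<ge> 0" "C3 * 2 powr (- \<beta>) + C2 \<le> C3" "KX * R T \<le> C3 * T powr (- \<beta>)"
  proof -
    have a: "0 \<le> KX * R T * T powr \<beta>" using KX R0 by simp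
    have b: "0 \<le> C2 / (1 - 2 powr (- \<beta>))" using C2 q by simp
    show "C3 \<ge> 0" unfolding C3_def using a b by linarith
    have "C2 = (C2 / (1 - 2 powr (- \<beta>))) * (1 - 2 powr (- \<beta>))" using q \<beta> by simp
    also have "\<dots> \<le> C3 * (1 - 2 powr (- \<beta>))" unfolding C3_def using a q by (intro mult_right_mono) auto
    finally show "C3 * 2 powr (- \<beta>) + C2 \<le> C3" by (simp add: algebra_simps)
    have "KX * R T = KX * R T * T powr \<beta> * T powr (- \<beta>)" using T by (simp add: powr_minus)
    also have "\<dots> \<le> C3 * T powr (- \<beta>)" unfolding C3_def using b by (intro mult_right_mono) auto
    finally show "KX * R T \<le> C3 * T powr (- \<beta>)" .
  qed
  define C where "C = (C3 + C2) * (T powr (- \<beta>) + 2 powr \<beta> * A powr (- \<beta>))"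
  show ?thesis
  proof (rule that[of C])
    show "C \<ge> 0" unfolding C_def using C2 C3 by simp
    fix v :: "real \<Rightarrow> 'x" and t
    assume cont: "continuous_on {0..T} v" and mom: "moment p T v \<le> ennreal A"
      and H: "\<And>s t. 0 \<le> s \<Longrightarrow> s \<le> t \<Longrightarrow> t \<le> T \<Longrightarrow> norm (iBY (iXB (v t)) - iBY (iXB (v s))) \<le> D * (t - s) powr \<alpha>"
      and t: "0 < t" "t < T"
    have R_mono: "R h \<le> R h'" if "0 < h'" "h' \<le> h" for h h'
      unfolding R_def using that p by (intro mult_left_mono powr_mono2') auto
    have pair: "norm (iXB (v x - v y)) \<le> C2 * h powr (- \<beta>)"
      if h: "0 < h" "h \<le> T" and xy: "x \<in> {0..T}" "y \<in> {0..T}" "\<bar>x - y\<bar> \<le> 3 * h" and n: "norm (v x) \<le> R h" "norm (v y) \<le> R h" for x y h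
    proof -
      have n1: "norm (v x - v y) \<le> 2 * R h" using n norm_triangle_ineq4[of "v x" "v y"] by linarith
      have "norm (iBY (iXB (v x)) - iBY (iXB (v y))) \<le> D * \<bar>x - y\<bar> powr \<alpha>"
        using H[of x y] H[of y x] xy by (cases "x \<le> y") (auto simp: norm_minus_commute)
      also have "\<dots> \<le> D * (3 * h) powr \<alpha>" using xy \<alpha> D by (intro mult_left_mono powr_mono2) auto
      finally have n2: "norm (iBY (iXB (v x - v y))) \<le> D * (3 * h) powr \<alpha>" by (simp add: X.diff Y.diff)
      have "norm (iXB (v x - v y)) \<le> C\<theta> * norm (v x - v y) powr \<theta> * norm (iBY (iXB (v x - v y))) powr (1 - \<theta>)"
        by (rule interp)
      also have "\<dots> \<le> C\<theta> * (2 * R h) powr \<theta> * (D * (3 * h) powr \<alpha>) powr (1 - \<theta>)"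
        using n1 n2 C\<theta> \<theta> R0 by (intro mult_mono powr_mono2) auto
      also have "\<dots> = C\<theta> * (2 * A powr (1 / p)) powr \<theta> * (D * 3 powr \<alpha>) powr (1 - \<theta>) * (h powr (- 1 / p * \<theta>) * h powr (\<alpha> * (1 - \<theta>)))"
        unfolding R_def using D h by (simp add: powr_mult powr_powr)
      also have "h powr (- 1 / p * \<theta>) * h powr (\<alpha> * (1 - \<theta>)) = h powr (- \<gamma>)"
        unfolding \<gamma>_def using h by (simp add: powr_add[symmetric] algebra_simps)
      also have "h powr (- \<gamma>) = h powr (\<beta> - \<gamma>) * h powr (- \<beta>)" using h by (simp add: powr_add[symmetric])
      also have "C\<theta> * (2 * A powr (1 / p)) powr \<theta> * (D * 3 powr \<alpha>) powr (1 - \<theta>) * (h powr (\<beta> - \<gamma>) * h powr (- \<beta>))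
          \<le> C\<theta> * (2 * A powr (1 / p)) powr \<theta> * (D * 3 powr \<alpha>) powr (1 - \<theta>) * (T powr (\<beta> - \<gamma>) * h powr (- \<beta>))"
        using h \<beta> C\<theta> unfolding \<gamma>_def[symmetric] by (intro mult_left_mono mult_right_mono powr_mono2) auto
      finally show ?thesis unfolding C2_def by (simp add: mult.assoc)
    qed
    have [measurable]: "(\<lambda>t. norm (v t)) \<in> borel_measurable (time_measure T)"
      by (intro strongly_measurable_norm strongly_measurable_continuous cont T)
    have good: "\<exists>s. 0 < s \<and> s < T \<and> \<bar>s - t\<bar> \<le> h \<and> norm (v s) \<le> R h" if h: "0 < h" "h \<le> T" for h
    proof -
      \<comment> \<open>the left end of an interval of length \<open>h\<close> in \<open>[0,T]\<close> whose closure contains \<open>t\<close>\<close>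
      define c where "c = min t (T - h)"
      have c: "0 \<le> c" "c < c + h" "c + h \<le> T" unfolding c_def using h t by auto
      have "(\<lambda>t. ennreal (norm (v t) powr p)) \<in> borel_measurable (time_measure T)" by measurable
      from ex_good_point[OF this c] obtain s where s: "c \<le> s" "s < c + h" "0 < s" "s < T"
        and le: "ennreal (c + h - c) * ennreal (norm (v s) powr p) \<le>
          (\<integral>\<^sup>+t. ennreal (norm (v t) powr p) * indicator {c..<c + h} t \<partial>time_measure T)" by blast
      have "ennreal (h * norm (v s) powr p) = ennreal (c + h - c) * ennreal (norm (v s) powr p)"
        using h by (simp add: ennreal_mult')
      also note le
      also have "(\<integral>\<^sup>+t. ennreal (norm (v t) powr p) * indicator {c..<c + h} t \<partial>time_measure T) \<le> moment p T v"
        unfolding moment_def by (intro nn_integral_mono) (simp add: indicator_def)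
      also note mom
      finally have "h * norm (v s) powr p \<le> A" using A by simp
      then have "norm (v s) powr p \<le> A / h" using h by (simp add: field_simps)
      then have "(norm (v s) powr p) powr (1 / p) \<le> (A / h) powr (1 / p)" using p by (intro powr_mono2) auto
      also have "\<dots> = R h" unfolding R_def using A h by (simp add: powr_divide powr_minus_divide)
      finally have "norm (v s) \<le> R h" using p by (simp add: powr_powr)
      moreover have "\<bar>s - t\<bar> \<le> h" using s h t unfolding c_def by auto
      ultimately show ?thesis using s by blast
    qed
    define h where "h j = T / 2 ^ j" for j :: nat
    have h: "0 < h j" "h j \<le> T" "h (Suc j) = h j / 2" for j
      unfolding h_def using T by (auto simp: field_simps mult_le_cancel_left1)
    have scale: "h (Suc j) powr (- \<beta>) * 2 powr (- \<beta>) = h j powr (- \<beta>)" for j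
      using powr_mult[of "h (Suc j)" 2 "- \<beta>"] h(1,3)[of j] by (simp only: h(3) mult.commute) simp
    have ind: "\<exists>s. 0 < s \<and> s < T \<and> \<bar>s - t\<bar> \<le> h j \<and> norm (v s) \<le> R (h j) \<and> norm (iXB (v s)) \<le> C3 * h j powr (- \<beta>)" for j
    proof (induction j)
      case 0
      obtain s where s: "0 < s" "s < T" "\<bar>s - t\<bar> \<le> h 0" "norm (v s) \<le> R (h 0)" using good[of "h 0"] h[of 0] by blast
      have "norm (iXB (v s)) \<le> KX * R T"
        using KX(1)[of "v s"] mult_right_mono[OF s(4) KX(2)] by (simp add: h_def mult.commute)
      also note C3(3)
      finally have "norm (iXB (v s)) \<le> C3 * h 0 powr (- \<beta>)" by (simp add: h_def)
      then show ?case using s by blast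
    next
      case (Suc j)
      then obtain s where s: "0 < s" "s < T" "\<bar>s - t\<bar> \<le> h j" "norm (v s) \<le> R (h j)" "norm (iXB (v s)) \<le> C3 * h j powr (- \<beta>)" by blast
      obtain s' where s': "0 < s'" "s' < T" "\<bar>s' - t\<bar> \<le> h (Suc j)" "norm (v s') \<le> R (h (Suc j))" using good[of "h (Suc j)"] h[of "Suc j"] by blast
      have "norm (iXB (v s' - v s)) \<le> C2 * h (Suc j) powr (- \<beta>)"
      proof (rule pair)
        show "norm (v s) \<le> R (h (Suc j))" 
        proof (rule order_trans[OF s(4)], rule R_mono)
          show "0 < h (Suc j)" by (rule h(1))
          show "h (Suc j) \<le> h j" using h(1)[of j] h(3)[of j] by linarith
        qed
        show "\<bar>s' - s\<bar> \<le> 3 * h (Suc j)" using s(3) s'(3) h(3)[of j] by linarith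
      qed (use s s' h[of "Suc j"] in auto)
      moreover have "norm (iXB (v s')) \<le> norm (iXB (v s)) + norm (iXB (v s' - v s))"
        using norm_triangle_ineq[of "iXB (v s)" "iXB (v s' - v s)"] by (simp add: X.diff)
      ultimately have "norm (iXB (v s')) \<le> C3 * h j powr (- \<beta>) + C2 * h (Suc j) powr (- \<beta>)" using s(5) by linarith
      also have "\<dots> = (C3 * 2 powr (- \<beta>) + C2) * h (Suc j) powr (- \<beta>)"
        unfolding scale[of j, symmetric] by (simp add: algebra_simps)
      also have "\<dots> \<le> C3 * h (Suc j) powr (- \<beta>)" using C3 by (intro mult_right_mono) auto
      finally show ?case using s' by blast
    qed
    have "\<exists>j. norm (v t) \<le> R (h j)"
    proof -
      obtain j where j: "norm (v t) powr p * T / A < real j" using reals_Archimedean2 by blast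
      have "norm (v t) powr p * T / A < 2 ^ j" using j of_nat_less_two_power[of j] by (rule less_trans)
      then have "norm (v t) powr p \<le> A / h j" unfolding h_def using A T by (simp add: field_simps)
      then have "(norm (v t) powr p) powr (1 / p) \<le> (A / h j) powr (1 / p)" using p by (intro powr_mono2) auto
      also have "\<dots> = R (h j)" unfolding R_def using A h[of j] by (simp add: powr_divide powr_minus_divide)
      finally show ?thesis using p by (auto simp: powr_powr)
    qed
    \<comment> \<open>the first scale at which \<open>t\<close> is a good point; minimality bounds \<open>h j\<close> from below in terms of \<open>norm (v t)\<close>\<close>
    then obtain j where j: "norm (v t) \<le> R (h j)" and least: "\<And>i. i < j \<Longrightarrow> \<not> norm (v t) \<le> R (h i)"
      using exists_least_iff[of "\<lambda>j. norm (v t) \<le> R (h j)"] by blast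
    obtain s where s: "0 < s" "s < T" "\<bar>s - t\<bar> \<le> h j" "norm (v s) \<le> R (h j)" "norm (iXB (v s)) \<le> C3 * h j powr (- \<beta>)"
      using ind by blast
    have "norm (iXB (v t - v s)) \<le> C2 * h j powr (- \<beta>)"
      by (rule pair) (use s t j h[of j] in auto)
    moreover have "norm (iXB (v t)) \<le> norm (iXB (v s)) + norm (iXB (v t - v s))"
      using norm_triangle_ineq[of "iXB (v s)" "iXB (v t - v s)"] by (simp add: X.diff)
    ultimately have 1: "norm (iXB (v t)) \<le> (C3 + C2) * h j powr (- \<beta>)" using s(5) by (simp add: algebra_simps)
    have 2: "h j powr (- \<beta>) \<le> T powr (- \<beta>) + 2 powr \<beta> * A powr (- \<beta>) * norm (v t) powr (p * \<beta>)"
    proof (cases j)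
      case 0 then show ?thesis by (simp add: h_def)
    next
      case (Suc i)
      have "R (h i) \<le> norm (v t)" using least[of i] Suc by simp
      then have "R (h i) powr (p * \<beta>) \<le> norm (v t) powr (p * \<beta>)" using p \<beta> R0 by (intro powr_mono2) auto
      moreover have "R (h i) powr (p * \<beta>) = A powr \<beta> * h i powr (- \<beta>)"
        unfolding R_def using A h[of i] p by (simp add: powr_mult powr_powr)
      ultimately have "h i powr (- \<beta>) \<le> A powr (- \<beta>) * norm (v t) powr (p * \<beta>)"
        using A by (simp add: powr_minus field_simps)
      moreover have "h j powr (- \<beta>) = 2 powr \<beta> * h i powr (- \<beta>)"
        unfolding scale[of i, symmetric] Suc by (simp add: powr_minus)
      ultimately have "h j powr (- \<beta>) \<le> 2 powr \<beta> * (A powr (- \<beta>) * norm (v t) powr (p * \<beta>))" by simp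
      also have "\<dots> \<le> T powr (- \<beta>) + 2 powr \<beta> * A powr (- \<beta>) * norm (v t) powr (p * \<beta>)" by simp
      finally show ?thesis .
    qed
    have "h j powr (- \<beta>) \<le> (T powr (- \<beta>) + 2 powr \<beta> * A powr (- \<beta>)) * (1 + norm (v t) powr (p * \<beta>))"
    proof -
      have "0 \<le> T powr (- \<beta>) * norm (v t) powr (p * \<beta>)" "0 \<le> 2 powr \<beta> * A powr (- \<beta>)" by auto
      moreover have "(T powr (- \<beta>) + 2 powr \<beta> * A powr (- \<beta>)) * (1 + norm (v t) powr (p * \<beta>)) =
          T powr (- \<beta>) + 2 powr \<beta> * A powr (- \<beta>) * norm (v t) powr (p * \<beta>)
          + (T powr (- \<beta>) * norm (v t) powr (p * \<beta>) + 2 powr \<beta> * A powr (- \<beta>))"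
        by (simp add: algebra_simps)
      ultimately show ?thesis using 2 by linarith
    qed
    then have "(C3 + C2) * h j powr (- \<beta>) \<le> C * (1 + norm (v t) powr (p * \<beta>))"
      unfolding C_def mult.assoc using C2 C3 by (intro mult_left_mono) auto
    then show "norm (iXB (v t)) \<le> C * (1 + norm (v t) powr (p * \<beta>))" using 1 by linarith
  qed
qed

section \<open>The lifting and its primitive\<close>

text \<open>
  A derivative lowers the multiplicity of a factor by at most one.
\<close>

lemma power_dvd_pderiv:
  fixes c p :: "'a::{idom,semiring_char_0} poly"
  assumes "c ^ Suc m dvd p" shows "c ^ m dvd pderiv p"
proof -
  obtain q where "p = c ^ Suc m * q" using assms by (auto elim: dvdE)
  then have "pderiv p = c ^ m * (c * pderiv q + q * smult (of_nat (Suc m)) (pderiv c))"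
    by (simp only: pderiv_mult pderiv_power_Suc) (simp add: algebra_simps)
  then show ?thesis by simp
qed

lemma power_dvd_pderiv_funpow:
  fixes c p :: "'a::{idom,semiring_char_0} poly"
  assumes "c ^ (m + j) dvd p" shows "c ^ m dvd (pderiv ^^ j) p"
  using assms
proof (induction j arbitrary: m)
  case (Suc j)
  then have "c ^ Suc m dvd (pderiv ^^ j) p" by (intro Suc.IH) simp
  then show ?case using power_dvd_pderiv by auto
qed simp

text \<open>
  Rodrigues' formula with one derivative less. At \<open>i = 0\<close> the primitive of 1 that vanishes at \<open>-1\<close> is
  taken.
\<close>

definition legendre_primitive :: "nat \<Rightarrow> real poly" where
  "legendre_primitive i =
     (if i = 0 then [:1, 1:] else smult (1 / (2 ^ i * fact i)) ((pderiv ^^ (i - 1)) ([:-1, 0, 1:] ^ i)))"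

lemma pderiv_legendre_primitive: "pderiv (legendre_primitive i) = legendre i"
proof (cases i)
  case (Suc j)
  then show ?thesis unfolding legendre_primitive_def legendre_def by (simp add: pderiv_smult)
qed (simp add: legendre_primitive_def legendre_def pderiv_pCons)

text \<open>
  For \<open>i \<ge> 1\<close> the points \<open>-1\<close> and \<open>1\<close> are \<open>i\<close>-fold zeros of the polynomial in Rodrigues' formula, and
  \<open>i - 1\<close> derivatives leave a zero there. Hence only the constant Legendre polynomial has a nonzero
  mean.
\<close>

lemma poly_legendre_primitive:
  "poly (legendre_primitive i) (-1) = 0" "poly (legendre_primitive i) 1 = (if i = 0 then 2 else 0)"
proof -
  have root: "poly ((pderiv ^^ j) ([:-1, 0, 1:] ^ Suc j)) x = 0" if "x = 1 \<or> x = -1" for j and x :: real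
  proof -
    have "[:-x, 1:] dvd [:-1, 0, 1:]" using that by (auto simp: poly_eq_0_iff_dvd[symmetric])
    then have "[:-x, 1:] ^ (1 + j) dvd [:-1, 0, 1:] ^ Suc j" unfolding plus_1_eq_Suc by (rule dvd_power_same)
    then have "[:-x, 1:] ^ 1 dvd (pderiv ^^ j) ([:-1, 0, 1:] ^ Suc j)" by (rule power_dvd_pderiv_funpow)
    then show ?thesis by (simp add: poly_eq_0_iff_dvd)
  qed
  show "poly (legendre_primitive i) (-1) = 0" "poly (legendre_primitive i) 1 = (if i = 0 then 2 else 0)"
    by (cases i; simp add: legendre_primitive_def root del: power_Suc funpow.simps)+
qed

text \<open>
  The scalar primitive of the lifting on the reference interval. For every degree its values at the two
  ends are 0 and 1.
\<close>

definition lifting_profile :: "nat \<Rightarrow> real poly" where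
  "lifting_profile l = (\<Sum>i=0..l. smult ((-1) ^ i * (2 * real i + 1) / 2) (legendre_primitive i))"

lemma lifting_profile_ends: "poly (lifting_profile l) (-1) = 0" "poly (lifting_profile l) 1 = 1"
proof -
  show "poly (lifting_profile l) (-1) = 0"
    unfolding lifting_profile_def by (simp add: poly_sum poly_legendre_primitive)
  have "poly (lifting_profile l) 1 = (\<Sum>i=0..l. if i = 0 then 1 else 0)"
    unfolding lifting_profile_def poly_sum by (intro sum.cong) (auto simp: poly_legendre_primitive)
  then show "poly (lifting_profile l) 1 = 1" by (simp add: sum.delta)
qed

lemma pderiv_sum: "pderiv (\<Sum>i\<in>A. f i) = (\<Sum>i\<in>A. pderiv (f i))"
  by (induction A rule: infinite_finite_induct) (auto simp: pderiv_add)

lemma poly_pderiv_lifting_profile: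
  "poly (pderiv (lifting_profile l)) x = (\<Sum>i=0..l. (-1) ^ i * (2 * real i + 1) * poly (legendre i) x) / 2"
  unfolding lifting_profile_def
  by (simp add: pderiv_sum pderiv_smult pderiv_legendre_primitive poly_sum sum_divide_distrib)

definition profile_on :: "(nat \<Rightarrow> real) \<Rightarrow> nat \<Rightarrow> nat \<Rightarrow> real \<Rightarrow> real" where
  "profile_on \<nu> l n t = poly (lifting_profile l) ((2 * t - \<nu> (n - 1) - \<nu> n) / time_step \<nu> n)"

lemma profile_on_ends:
  assumes "\<nu> (n - 1) < \<nu> n"
  shows "profile_on \<nu> l n (\<nu> (n - 1)) = 0" "profile_on \<nu> l n (\<nu> n) = 1"
proof -
  have "(2 * \<nu> (n - 1) - \<nu> (n - 1) - \<nu> n) / time_step \<nu> n = -1" "(2 * \<nu> n - \<nu> (n - 1) - \<nu> n) / time_step \<nu> n = 1"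
    using assms unfolding time_step_def by (auto simp: field_simps)
  then show "profile_on \<nu> l n (\<nu> (n - 1)) = 0" "profile_on \<nu> l n (\<nu> n) = 1"
    unfolding profile_on_def by (simp_all add: lifting_profile_ends)
qed

lemma profile_on_derivative:
  fixes z :: "'a::banach"
  assumes "\<nu> (n - 1) < \<nu> n"
  shows "((\<lambda>t. profile_on \<nu> l n t *\<^sub>R z) has_vector_derivative lifting \<nu> l n z t) (at t within S)"
proof -
  have "((\<lambda>t. profile_on \<nu> l n t) has_real_derivative
      poly (pderiv (lifting_profile l)) ((2 * t - \<nu> (n - 1) - \<nu> n) / time_step \<nu> n) * (2 / time_step \<nu> n)) (at t within S)"
  proof -
    have "((\<lambda>t. 2 * t - \<nu> (n - 1) - \<nu> n) has_real_derivative 2) (at t within S)"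
      by (auto intro!: derivative_eq_intros)
    then have "((\<lambda>t. (2 * t - \<nu> (n - 1) - \<nu> n) / time_step \<nu> n) has_real_derivative 2 / time_step \<nu> n) (at t within S)"
      by (rule DERIV_cdivide)
    then show ?thesis unfolding profile_on_def by (rule DERIV_chain2[OF poly_DERIV])
  qed
  then have "((\<lambda>t. profile_on \<nu> l n t *\<^sub>R z) has_vector_derivative
      (poly (pderiv (lifting_profile l)) ((2 * t - \<nu> (n - 1) - \<nu> n) / time_step \<nu> n) * (2 / time_step \<nu> n)) *\<^sub>R z) (at t within S)"
    using has_vector_derivative_scaleR[OF _ has_vector_derivative_const[of z]] by fastforce
  then show ?thesis unfolding lifting_def poly_pderiv_lifting_profile legendre_on_def by (simp add: mult.commute)
qed

text \<open>
  The reconstruction removes the jump \<open>z\<close> at the left node and restores it along this profile.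
  Since the profile ends at 1, the reconstruction takes the value of the original function at the right
  node, which is why it is continuous.
\<close>

lemma integral_lifting:
  fixes z :: "'a::banach"
  assumes "\<nu> (n - 1) < \<nu> n" "\<nu> (n - 1) \<le> t"
  shows "integral {\<nu> (n - 1)..t} (lifting \<nu> l n z) = profile_on \<nu> l n t *\<^sub>R z"
proof -
  have "(lifting \<nu> l n z has_integral (profile_on \<nu> l n t *\<^sub>R z - profile_on \<nu> l n (\<nu> (n - 1)) *\<^sub>R z)) {\<nu> (n - 1)..t}"
    by (rule fundamental_theorem_of_calculus[OF assms(2) profile_on_derivative[OF assms(1)]])
  then show ?thesis using profile_on_ends[OF assms(1)] by (simp add: integral_unique)
qed

lemma ex_profile_bound:
  obtains K where "K \<ge> 0" "\<And>\<nu> n t. \<nu> (n - 1) < \<nu> n \<Longrightarrow> t \<in> {\<nu> (n - 1)..\<nu> n} \<Longrightarrow> \<bar>1 - profile_on \<nu> l n t\<bar> \<le> K"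
proof -
  have "compact ((\<lambda>x. 1 - poly (lifting_profile l) x) ` {-1..1})"
    by (intro compact_continuous_image continuous_intros) auto
  then have "bounded ((\<lambda>x. 1 - poly (lifting_profile l) x) ` {-1..1})" by (rule compact_imp_bounded)
  then obtain K where K': "\<forall>x\<in>{-1..1}. \<bar>1 - poly (lifting_profile l) x\<bar> \<le> K"
    unfolding bounded_iff by auto
  have K: "\<bar>1 - poly (lifting_profile l) x\<bar> \<le> K" if "x \<in> {-1..1}" for x using K' that by blast
  have "\<bar>1 - profile_on \<nu> l n t\<bar> \<le> K" if "\<nu> (n - 1) < \<nu> n" "t \<in> {\<nu> (n - 1)..\<nu> n}" for \<nu> n t
    unfolding profile_on_def by (rule K) (use that in \<open>auto simp: time_step_def field_simps\<close>)
  moreover have "K \<ge> 0" using K[of 0] by auto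
  ultimately show ?thesis using that by blast
qed

section \<open>Structure of the reconstruction\<close>

text \<open>
  Elements of the tensor product of the polynomials of degree at most \<open>l\<close> with the whole space.
\<close>

definition vector_poly :: "nat \<Rightarrow> (real \<Rightarrow> 'a::real_normed_vector) \<Rightarrow> bool" where
  "vector_poly l U \<longleftrightarrow> (\<exists>(m::nat) (P :: nat \<Rightarrow> real poly) z. (\<forall>j<m. degree (P j) \<le> l) \<and>
     U = (\<lambda>t. \<Sum>j<m. poly (P j) t *\<^sub>R z j))"

lemma vector_poly_continuous: "vector_poly l U \<Longrightarrow> continuous_on S U"
  unfolding vector_poly_def by (auto intro!: continuous_intros)

lemma vector_poly_differentiable: "vector_poly l U \<Longrightarrow> \<exists>D. (U has_vector_derivative D) (at t)"
proof -
  assume "vector_poly l U"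
  then obtain m :: nat and P z where U: "U = (\<lambda>t. \<Sum>j<m. poly (P j) t *\<^sub>R z j)" unfolding vector_poly_def by blast
  have "((\<lambda>t. poly (P j) t *\<^sub>R z j) has_vector_derivative (poly (pderiv (P j)) t *\<^sub>R z j)) (at t)" for j
    using has_vector_derivative_scaleR[OF poly_DERIV has_vector_derivative_const[of "z j"]] by fastforce
  then have "(U has_vector_derivative (\<Sum>j<m. poly (pderiv (P j)) t *\<^sub>R z j)) (at t)"
    unfolding U by (rule has_vector_derivative_sum)
  then show ?thesis by blast
qed

text \<open>
  One approximate solution on one partition, with polynomials \<open>U n\<close> that represent it and are defined
  on the whole line; one-sided limits at the nodes are then values of these polynomials.
\<close>

locale reconstruction_setup =
  fixes T :: real and N :: nat and \<nu> :: "nat \<Rightarrow> real" and l :: nat and u0 :: "'x::banach"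
    and u :: "real \<Rightarrow> 'x" and U :: "nat \<Rightarrow> real \<Rightarrow> 'x"
  assumes part: "time_partition T N \<nu>"
    and U_poly: "\<And>n. n \<in> {1..N} \<Longrightarrow> vector_poly l (U n)"
    and u_eq: "\<And>n t. n \<in> {1..N} \<Longrightarrow> t \<in> time_interval \<nu> n \<Longrightarrow> u t = U n t"
begin

text \<open>The jump at the left end of the \<open>n\<close>-th interval, expressed by the representing polynomials.\<close>

definition jump :: "nat \<Rightarrow> 'x" where
  "jump n = U n (\<nu> (n - 1)) - (if n = 1 then u0 else U (n - 1) (\<nu> (n - 1)))"

definition piece :: "nat \<Rightarrow> real \<Rightarrow> 'x" where
  "piece n t = U n t - (1 - profile_on \<nu> l n t) *\<^sub>R jump n"

abbreviation R :: "real \<Rightarrow> 'x" where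
  "R \<equiv> reconstruction \<nu> l u0 u"

lemma node_less: "n \<in> {1..N} \<Longrightarrow> \<nu> (n - 1) < \<nu> n"
  using time_partition_less[OF part, of "n - 1" n] by auto

lemma T_pos: "T > 0"
  using time_partition_less[OF part, of 0 N] part unfolding time_partition_def by auto

lemma U_tendsto:
  assumes n: "n \<in> {1..N}" and t: "t \<in> {\<nu> (n - 1)..\<nu> n}"
  shows "Lim (at t within time_interval \<nu> n) u = U n t"
proof (rule tendsto_Lim)
  have less: "\<nu> (n - 1) < \<nu> n" by (rule node_less[OF n])
  have "t islimpt {\<nu> (n - 1)<..<\<nu> n}"
    using islimpt_greaterThanLessThan1[OF less] islimpt_greaterThanLessThan2[OF less] t less
    by (cases "t = \<nu> (n - 1)"; cases "t = \<nu> n") (auto intro: interior_limit_point simp: interior_open)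
  then show "\<not> trivial_limit (at t within time_interval \<nu> n)"
    unfolding trivial_limit_within time_interval_def by simp
  have "(U n \<longlongrightarrow> U n t) (at t within time_interval \<nu> n)"
    using vector_poly_continuous[OF U_poly[OF n], of UNIV]
    by (metis UNIV_I continuous_on_def tendsto_within_subset top_greatest)
  then show "(u \<longlongrightarrow> U n t) (at t within time_interval \<nu> n)"
  proof (rule Lim_transform_eventually)
    show "\<forall>\<^sub>F x in at t within time_interval \<nu> n. U n x = u x"
      unfolding eventually_at_filter using u_eq[OF n] by (intro always_eventually) auto
  qed
qed

lemma at_right_node: "n \<in> {1..N} \<Longrightarrow> at_right (\<nu> (n - 1)) = at (\<nu> (n - 1)) within time_interval \<nu> n"
  unfolding time_interval_def by (rule at_within_nhd[where S = "{..<\<nu> n}"]) (use node_less in auto)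

lemma at_left_node: "n \<in> {1..N} \<Longrightarrow> at_left (\<nu> n) = at (\<nu> n) within time_interval \<nu> n"
  unfolding time_interval_def by (rule at_within_nhd[where S = "{\<nu> (n - 1)<..}"]) (use node_less in auto)

lemma time_jump_eq:
  assumes n: "n \<in> {1..N}" shows "time_jump \<nu> u0 u (n - 1) = jump n"
proof -
  have r: "Lim (at_right (\<nu> (n - 1))) u = U n (\<nu> (n - 1))"
    unfolding at_right_node[OF n] using n node_less[OF n] by (intro U_tendsto) auto
  show ?thesis
  proof (cases "n = 1")
    case False
    then have m: "n - 1 \<in> {1..N}" using n by auto
    have "Lim (at_left (\<nu> (n - 1))) u = U (n - 1) (\<nu> (n - 1))"
      unfolding at_left_node[OF m] using m node_less[OF m] by (intro U_tendsto) auto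
    then show ?thesis using r False n unfolding time_jump_def jump_def by auto
  qed (use r in \<open>simp add: time_jump_def jump_def\<close>)
qed

lemma reconstruction_on_eq:
  assumes n: "n \<in> {1..N}" and t: "t \<in> {\<nu> (n - 1)..\<nu> n}"
  shows "reconstruction_on \<nu> l u0 n u t = piece n t"
proof -
  have "inner_value \<nu> n u t = U n t"
    unfolding inner_value_def using u_eq[OF n] U_tendsto[OF n t] by auto
  then show ?thesis
    unfolding reconstruction_on_def piece_def time_jump_eq[OF n]
    using integral_lifting[OF node_less[OF n], of t l "jump n"] t by (simp add: algebra_simps)
qed

text \<open>
  At an interior node the profile is 1 for the left piece and 0 for the right piece, so both pieces
  take the left limit of the original function.
\<close>

lemma piece_left:
  assumes "n \<in> {1..N}" "n \<noteq> 1"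
  shows "piece n (\<nu> (n - 1)) = piece (n - 1) (\<nu> (n - 1))"
proof -
  have m: "n - 1 \<in> {1..N}" using assms by auto
  have "profile_on \<nu> l n (\<nu> (n - 1)) = 0" "profile_on \<nu> l (n - 1) (\<nu> (n - 1)) = 1"
    using profile_on_ends node_less assms(1) m by blast+
  moreover have "jump n = U n (\<nu> (n - 1)) - U (n - 1) (\<nu> (n - 1))" using assms(2) by (simp add: jump_def)
  ultimately show ?thesis unfolding piece_def by simp
qed

text \<open>
  The formula of the \<open>n\<close>-th interval holds on its whole closure. At the left node the reconstruction
  selects the preceding interval, whose formula has the same value there.
\<close>

lemma reconstruction_eq:
  assumes n: "n \<in> {1..N}" and t: "t \<in> {\<nu> (n - 1)..\<nu> n}"
  shows "R t = piece n t"
proof -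
  have gen: "R t = piece n t" if n: "n \<in> {1..N}" and t: "\<nu> (n - 1) < t \<or> n = 1" "\<nu> (n - 1) \<le> t" "t \<le> \<nu> n" for n t
  proof -
    have "(LEAST k. 1 \<le> k \<and> t \<le> \<nu> k) = n"
    proof (rule Least_equality)
      fix k assume k: "1 \<le> k \<and> t \<le> \<nu> k"
      show "n \<le> k"
      proof (rule ccontr)
        assume "\<not> n \<le> k"
        then have "k \<le> n - 1" "n \<noteq> 1" using k by auto
        then have "\<nu> k \<le> \<nu> (n - 1)" using n by (intro time_partition_le[OF part]) auto
        then show False using k t \<open>n \<noteq> 1\<close> by auto
      qed
    qed (use n t in auto)
    then show ?thesis unfolding reconstruction_def using reconstruction_on_eq[OF n, of t] t by simp
  qed
  show ?thesis
  proof (cases "\<nu> (n - 1) < t \<or> n = 1")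
    case False
    then have eq: "t = \<nu> (n - 1)" and m: "n - 1 \<in> {1..N}" "n \<noteq> 1" using n t by auto
    have "R t = piece (n - 1) t"
      unfolding eq using m node_less[OF m(1)] by (intro gen) auto
    then show ?thesis unfolding eq using piece_left[OF n m(2)] by simp
  qed (use gen n t in auto)
qed

lemma cell_cover:
  assumes "0 \<le> t" "t \<le> T" obtains n where "n \<in> {1..N}" "t \<in> {\<nu> (n - 1)..\<nu> n}"
proof -
  have "\<exists>n\<in>{1..m}. t \<in> {\<nu> (n - 1)..\<nu> n}" if "1 \<le> m" "m \<le> N" "0 \<le> t" "t \<le> \<nu> m" for m
    using that
  proof (induction m rule: dec_induct)
    case base
    then show ?case using part unfolding time_partition_def by auto
  next
    case (step m)
    show ?case
    proof (cases "t \<le> \<nu> m")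
      case True
      then obtain n where "n \<in> {1..m}" "t \<in> {\<nu> (n - 1)..\<nu> n}" using step by auto
      then show ?thesis by (intro bexI[of _ n]) auto
    next
      case False
      then show ?thesis using step.prems by (intro bexI[of _ "Suc m"]) auto
    qed
  qed
  from this[of N] show ?thesis using that assms part unfolding time_partition_def by auto
qed

lemma piece_continuous:
  assumes n: "n \<in> {1..N}" shows "continuous_on S (piece n)"
  unfolding piece_def profile_on_def using vector_poly_continuous[OF U_poly[OF n]] node_less[OF n]
  by (intro continuous_intros) (auto simp: time_step_def)

lemma reconstruction_continuous: "continuous_on {0..T} R"
proof -
  have "continuous_on (\<Union>n\<in>{1..N}. {\<nu> (n - 1)..\<nu> n}) R"
  proof (rule continuous_on_closed_Union)
    fix n assume n: "n \<in> {1..N}"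
    show "continuous_on {\<nu> (n - 1)..\<nu> n} R"
      using piece_continuous[OF n] by (rule continuous_on_eq) (use reconstruction_eq[OF n] in auto)
  qed auto
  moreover have "{0..T} \<subseteq> (\<Union>n\<in>{1..N}. {\<nu> (n - 1)..\<nu> n})"
  proof
    fix t assume "t \<in> {0..T}"
    then obtain n where "n \<in> {1..N}" "t \<in> {\<nu> (n - 1)..\<nu> n}" using cell_cover[of t] by auto
    then show "t \<in> (\<Union>n\<in>{1..N}. {\<nu> (n - 1)..\<nu> n})" by blast
  qed
  ultimately show ?thesis by (rule continuous_on_subset)
qed

lemma open_cell_cover:
  assumes "0 < t" "t < T" "t \<notin> \<nu> ` {0..N}" obtains n where "n \<in> {1..N}" "t \<in> time_interval \<nu> n"
proof -
  obtain n where n: "n \<in> {1..N}" "t \<in> {\<nu> (n - 1)..\<nu> n}" using cell_cover[of t] assms by auto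
  have "t \<noteq> \<nu> (n - 1)" "t \<noteq> \<nu> n" using assms(3) n by auto
  then show ?thesis using n that[of n] by (simp add: time_interval_def)
qed

lemma reconstruction_differentiable:
  assumes "0 \<le> t" "t \<le> T" "t \<notin> \<nu> ` {0..N}"
  shows "(R has_vector_derivative reconstruction_deriv \<nu> l u0 u t) (at t)"
proof -
  have "\<nu> 0 = 0" "\<nu> N = T" using part unfolding time_partition_def by auto
  then have "t \<noteq> 0" "t \<noteq> T" using assms(3) by force+
  then obtain n where n: "n \<in> {1..N}" "t \<in> time_interval \<nu> n" using open_cell_cover[of t] assms by auto
  obtain D where D: "(U n has_vector_derivative D) (at t)" using vector_poly_differentiable[OF U_poly[OF n(1)]] by blast
  have "((\<lambda>t. U n t - jump n + profile_on \<nu> l n t *\<^sub>R jump n) has_vector_derivative (D - 0 + lifting \<nu> l n (jump n) t)) (at t)"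
    by (intro has_vector_derivative_add has_vector_derivative_diff D has_vector_derivative_const
        profile_on_derivative[OF node_less[OF n(1)]])
  then have "(piece n has_vector_derivative (D + lifting \<nu> l n (jump n) t)) (at t)"
    unfolding piece_def by (simp add: algebra_simps)
  then have "(R has_vector_derivative (D + lifting \<nu> l n (jump n) t)) (at t)"
    by (rule has_vector_derivative_transform_within_open[of _ _ _ "time_interval \<nu> n"])
      (use n reconstruction_eq[OF n(1)] in \<open>auto simp: time_interval_def\<close>)
  then show ?thesis unfolding reconstruction_deriv_def by (simp add: vector_derivative_at)
qed

lemma reconstruction_error:
  assumes n: "n \<in> {1..N}" and t: "t \<in> time_interval \<nu> n"
  shows "u t - R t = (1 - profile_on \<nu> l n t) *\<^sub>R jump n"
  using reconstruction_eq[OF n, of t] u_eq[OF n t] t unfolding piece_def time_interval_def by simp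

lemma AE_not_node: "AE t in time_measure T. t \<notin> \<nu> ` {0..N}"
  by (rule AE_time_measure_not_in_finite) simp

end

lemma piecewise_poly_setup:
  fixes u :: "real \<Rightarrow> 'x::banach"
  assumes "time_partition T N \<nu>" "u \<in> piecewise_poly T N \<nu> l Z"
  obtains U where "reconstruction_setup T N \<nu> l u U"
proof -
  have "\<forall>n\<in>{1..N}. \<exists>V. vector_poly l V \<and> (\<forall>t\<in>time_interval \<nu> n. u t = V t)"
  proof
    fix n assume "n \<in> {1..N}"
    then obtain m :: nat and P z where "\<forall>j<m. degree (P j) \<le> l \<and> z j \<in> Z"
      "\<forall>t\<in>time_interval \<nu> n. u t = (\<Sum>j<m. poly (P j) t *\<^sub>R z j)"
      using assms(2) unfolding piecewise_poly_def by blast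
    then show "\<exists>V. vector_poly l V \<and> (\<forall>t\<in>time_interval \<nu> n. u t = V t)"
      unfolding vector_poly_def by (intro exI[of _ "\<lambda>t. \<Sum>j<m. poly (P j) t *\<^sub>R z j"]) blast
  qed
  then obtain U where "\<forall>n\<in>{1..N}. vector_poly l (U n) \<and> (\<forall>t\<in>time_interval \<nu> n. u t = U n t)" by metis
  then have "reconstruction_setup T N \<nu> l u U" using assms(1) by unfold_locales auto
  then show ?thesis by (rule that)
qed

section \<open>An inverse estimate for vector-valued polynomials\<close>

definition lagrange_basis :: "(nat \<Rightarrow> real) \<Rightarrow> nat \<Rightarrow> nat \<Rightarrow> real poly" where
  "lagrange_basis x l i = (\<Prod>j\<in>{..l} - {i}. smult (1 / (x i - x j)) [:- x j, 1:])"

lemma poly_lagrange_basis: "poly (lagrange_basis x l i) t = (\<Prod>j\<in>{..l} - {i}. (t - x j) / (x i - x j))"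
  unfolding lagrange_basis_def by (simp add: poly_prod diff_divide_distrib)

lemma degree_lagrange_basis:
  assumes "i \<le> l" shows "degree (lagrange_basis x l i) \<le> l"
proof -
  have "degree (lagrange_basis x l i) \<le> sum (degree \<circ> (\<lambda>j. smult (1 / (x i - x j)) [:- x j, 1:])) ({..l} - {i})"
    unfolding lagrange_basis_def by (rule degree_prod_sum_le) simp
  also have "\<dots> \<le> (\<Sum>j\<in>{..l} - {i}. 1)" by (intro sum_mono) auto
  also have "\<dots> = l" using assms by (simp add: card_Diff_singleton)
  finally show ?thesis .
qed

lemma lagrange_interpolation:
  assumes deg: "degree P \<le> l" and inj: "inj_on x {..l}"
  shows "poly P t = (\<Sum>i\<le>l. poly (lagrange_basis x l i) t * poly P (x i))"
proof -
  let ?Q = "\<Sum>i\<le>l. smult (poly P (x i)) (lagrange_basis x l i)"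
  have node: "poly (lagrange_basis x l i) (x k) = (if i = k then 1 else 0)" if "i \<le> l" "k \<le> l" for i k
  proof (cases "i = k")
    case True
    have "poly (lagrange_basis x l i) (x i) = (\<Prod>j\<in>{..l} - {i}. 1)"
      unfolding poly_lagrange_basis
    proof (rule prod.cong)
      fix j assume "j \<in> {..l} - {i}"
      then have "x i \<noteq> x j" using inj that by (auto dest: inj_onD)
      then show "(x i - x j) / (x i - x j) = 1" by simp
    qed simp
    then show ?thesis using True by simp
  next
    case False
    then have "k \<in> {..l} - {i}" using that by auto
    then show ?thesis using False unfolding poly_lagrange_basis by (auto intro!: prod_zero bexI[of _ k])
  qed
  have Qx: "poly ?Q (x k) = poly P (x k)" if "k \<le> l" for k
  proof -
    have "poly ?Q (x k) = (\<Sum>i\<le>l. if i = k then poly P (x k) else 0)"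
      unfolding poly_sum poly_smult by (intro sum.cong) (auto simp: node that)
    then show ?thesis using that by simp
  qed
  have degQ: "degree ?Q \<le> l"
    by (intro degree_sum_le) (auto simp del: degree_smult_eq intro!: order_trans[OF degree_smult_le degree_lagrange_basis])
  have "P = ?Q"
    by (rule poly_eqI_degree[of "x ` {..l}"]) (use Qx deg degQ inj in \<open>auto simp: card_image\<close>)
  then have "poly P t = poly ?Q t" by simp
  then show ?thesis by (simp add: poly_sum mult.commute)
qed

lemma vector_poly_interpolation:
  assumes "vector_poly l U" "inj_on x {..l}"
  shows "U t = (\<Sum>i\<le>l. poly (lagrange_basis x l i) t *\<^sub>R U (x i))"
proof -
  obtain m :: nat and P z where P: "\<And>j. j < m \<Longrightarrow> degree (P j) \<le> l" and U: "U = (\<lambda>t. \<Sum>j<m. poly (P j) t *\<^sub>R z j)"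
    using assms(1) unfolding vector_poly_def by blast
  have "U t = (\<Sum>j<m. (\<Sum>i\<le>l. poly (lagrange_basis x l i) t * poly (P j) (x i)) *\<^sub>R z j)"
    unfolding U using lagrange_interpolation[OF P assms(2)] by (intro sum.cong) auto
  also have "\<dots> = (\<Sum>j<m. \<Sum>i\<le>l. poly (lagrange_basis x l i) t *\<^sub>R (poly (P j) (x i) *\<^sub>R z j))"
    by (simp add: scaleR_sum_left)
  also have "\<dots> = (\<Sum>i\<le>l. poly (lagrange_basis x l i) t *\<^sub>R U (x i))"
    unfolding U scaleR_sum_right by (rule sum.swap)
  finally show ?thesis .
qed

text \<open>
  Explicit in \<open>l\<close> and \<open>p\<close>; what matters is that it depends on neither the interval nor the range space.
\<close>

definition inverse_const :: "nat \<Rightarrow> real \<Rightarrow> real" where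
  "inverse_const l p = (real (Suc l) * real (2 * l + 1) ^ l) powr p * real (2 * l + 1)"

text \<open>
  A polynomial is determined by its values at \<open>l + 1\<close> points. Cut the interval into \<open>2 l + 1\<close> equal
  cells and take a good point in every second one: these points are separated by a fixed fraction of the
  interval, so the Lagrange basis is bounded by a constant, while the values at the points are
  controlled by the mean of \<open>norm (U t) powr p\<close>. The argument applies verbatim to values
  in a Banach space.
\<close>

lemma inverse_estimate:
  fixes U :: "real \<Rightarrow> 'x::banach"
  assumes U: "vector_poly l U" and ab: "0 \<le> a" "a < b" "b \<le> T" and p: "p \<ge> 1"
    and r: "(\<integral>\<^sup>+t. ennreal (norm (U t) powr p) * indicator {a..<b} t \<partial>time_measure T) \<le> ennreal r" "r \<ge> 0"
    and t: "t \<in> {a..b}"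
  shows "(b - a) * norm (U t) powr p \<le> inverse_const l p * r"
proof -
  define M where "M = 2 * l + 1"
  define h where "h = (b - a) / real M"
  have M: "real M > 0" unfolding M_def by simp
  have h: "h > 0" unfolding h_def using ab M by simp
  have hM: "h * real M = b - a" unfolding h_def using M by simp
  have T0: "T > 0" using ab by simp
  have [measurable]: "(\<lambda>t. norm (U t)) \<in> borel_measurable (time_measure T)"
    by (intro strongly_measurable_norm strongly_measurable_continuous vector_poly_continuous[OF U] T0)
  have "\<exists>s. i \<le> l \<longrightarrow> a + real (2 * i) * h \<le> s \<and> s \<le> a + real (2 * i + 1) * h \<and> h * norm (U s) powr p \<le> r" for i
  proof (cases "i \<le> l")
    case True
    define c where "c = a + real (2 * i) * h"
    have "real (2 * i) * h + h \<le> real M * h" using True h mult_right_mono[of "real (2 * i + 1)" "real M" h]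
      unfolding M_def by (simp add: distrib_right)
    then have c: "a \<le> c" "c < c + h" "c + h \<le> b" "0 \<le> c" "c + h \<le> T" unfolding c_def using h hM ab by (auto simp: mult.commute)
    have "(\<lambda>t. ennreal (norm (U t) powr p)) \<in> borel_measurable (time_measure T)" by measurable
    from ex_good_point[OF this c(4) c(2) c(5)] obtain s where s: "c \<le> s" "s < c + h"
      and le: "ennreal (c + h - c) * ennreal (norm (U s) powr p) \<le>
        (\<integral>\<^sup>+t. ennreal (norm (U t) powr p) * indicator {c..<c + h} t \<partial>time_measure T)" by blast
    have "ennreal (h * norm (U s) powr p) = ennreal (c + h - c) * ennreal (norm (U s) powr p)" using h by (simp add: ennreal_mult')
    also note le
    also have "(\<integral>\<^sup>+t. ennreal (norm (U t) powr p) * indicator {c..<c + h} t \<partial>time_measure T) \<le>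
        (\<integral>\<^sup>+t. ennreal (norm (U t) powr p) * indicator {a..<b} t \<partial>time_measure T)"
      using c by (intro nn_integral_mono) (auto simp: indicator_def)
    also note r(1)
    finally have "h * norm (U s) powr p \<le> r" using r(2) by simp
    then show ?thesis using s unfolding c_def by (intro exI[of _ s]) (auto simp: algebra_simps)
  qed simp
  then obtain x where x: "\<And>i. i \<le> l \<Longrightarrow> a + real (2 * i) * h \<le> x i" "\<And>i. i \<le> l \<Longrightarrow> x i \<le> a + real (2 * i + 1) * h"
    "\<And>i. i \<le> l \<Longrightarrow> h * norm (U (x i)) powr p \<le> r" by metis
  have sep: "h \<le> x i - x j" if "j < i" "i \<le> l" for i j
  proof -
    have "real (2 * j + 1) + 1 \<le> real (2 * i)" using that by auto
    then have "(real (2 * j + 1) + 1) * h \<le> real (2 * i) * h" using h by (intro mult_right_mono) auto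
    then show ?thesis using x(1)[of i] x(2)[of j] that by (simp add: distrib_right)
  qed
  have sep': "h \<le> \<bar>x i - x j\<bar>" if "i \<noteq> j" "i \<le> l" "j \<le> l" for i j
    using sep[of i j] sep[of j i] that by (cases "i < j") auto
  have inj: "inj_on x {..l}"
  proof (rule inj_onI, rule ccontr)
    fix i j assume "i \<in> {..l}" "j \<in> {..l}" "x i = x j" "i \<noteq> j"
    then show False using sep'[of i j] h by simp
  qed
  have xab: "a \<le> x i" "x i \<le> b" if "i \<le> l" for i
  proof -
    have "0 \<le> real (2 * i) * h" using h by simp
    then show "a \<le> x i" using x(1)[OF that] by linarith
    have "real (2 * i + 1) * h \<le> real M * h" using that h unfolding M_def by (intro mult_right_mono) auto
    then show "x i \<le> b" using x(2)[OF that] hM by (simp add: mult.commute)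
  qed
  have basis: "\<bar>poly (lagrange_basis x l i) t\<bar> \<le> real M ^ l" if i: "i \<le> l" for i
  proof -
    have "\<bar>poly (lagrange_basis x l i) t\<bar> = (\<Prod>j\<in>{..l} - {i}. \<bar>(t - x j) / (x i - x j)\<bar>)"
      unfolding poly_lagrange_basis by (rule abs_prod)
    also have "\<dots> \<le> (\<Prod>j\<in>{..l} - {i}. real M)"
    proof (rule prod_mono, intro conjI)
      fix j assume j: "j \<in> {..l} - {i}"
      have "\<bar>t - x j\<bar> \<le> real M * h" using t xab[of j] j hM by (auto simp: mult.commute)
      also have "\<dots> \<le> real M * \<bar>x i - x j\<bar>" using sep'[of i j] i j M by (intro mult_left_mono) auto
      finally have le: "\<bar>t - x j\<bar> \<le> real M * \<bar>x i - x j\<bar>" .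
      have "0 < \<bar>x i - x j\<bar>" using sep'[of i j] i j h by auto
      then show "\<bar>(t - x j) / (x i - x j)\<bar> \<le> real M" unfolding abs_divide using le by (simp add: pos_divide_le_eq)
    qed simp
    also have "\<dots> = real M ^ l" using i by (simp add: card_Diff_singleton)
    finally show ?thesis .
  qed
  define Q where "Q = (r / h) powr (1 / p)"
  have Ux: "norm (U (x i)) \<le> Q" if "i \<le> l" for i
  proof -
    have "norm (U (x i)) powr p \<le> r / h" using x(3)[OF that] h by (simp add: pos_le_divide_eq mult.commute)
    then have "(norm (U (x i)) powr p) powr (1 / p) \<le> Q" unfolding Q_def using p by (intro powr_mono2) auto
    then show ?thesis using p by (simp add: powr_powr)
  qed
  have "norm (U t) \<le> (\<Sum>i\<le>l. norm (poly (lagrange_basis x l i) t *\<^sub>R U (x i)))"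
    by (subst vector_poly_interpolation[OF U inj, of t]) (rule norm_sum)
  also have "\<dots> \<le> (\<Sum>i\<le>l. real M ^ l * Q)"
    using basis Ux M by (intro sum_mono) (auto intro!: mult_mono)
  also have "\<dots> = (real (Suc l) * real M ^ l) * Q" by simp
  finally have "norm (U t) powr p \<le> ((real (Suc l) * real M ^ l) * Q) powr p" using p by (intro powr_mono2) auto
  also have "\<dots> = (real (Suc l) * real M ^ l) powr p * Q powr p" using M by (intro powr_mult)
  also have "Q powr p = r / h" unfolding Q_def using p r h by (simp add: powr_powr)
  finally have "(b - a) * norm (U t) powr p \<le> (h * real M) * ((real (Suc l) * real M ^ l) powr p * (r / h))"
    unfolding hM using ab by (intro mult_left_mono) auto
  also have "\<dots> = inverse_const l p * r" unfolding inverse_const_def M_def[symmetric] using h by simp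
  finally show ?thesis .
qed

section \<open>Uniform estimates for the reconstruction\<close>

lemma norm_diff_powr_le:
  fixes x y :: "'a::real_normed_vector"
  assumes "p \<ge> 0" shows "norm (x - y) powr p \<le> 2 powr p * (norm x powr p + norm y powr p)"
proof -
  have "norm (x - y) powr p \<le> (norm x + norm y) powr p" using assms by (intro powr_mono2 norm_triangle_ineq4) auto
  also have "\<dots> \<le> 2 powr p * (norm x powr p + norm y powr p)" using assms by (intro powr_add_le) auto
  finally show ?thesis .
qed

lemma time_step_le_max:
  assumes "n \<in> {1..N}" shows "time_step \<nu> n \<le> max_time_step N \<nu>"
  unfolding max_time_step_def using assms by (intro Max_ge) auto

context reconstruction_setup begin

lemma in_time_interval:
  assumes "j < N" "t \<in> {\<nu> j..<\<nu> (Suc j)}" "t \<notin> \<nu> ` {0..N}"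
  shows "t \<in> time_interval \<nu> (Suc j)"
proof -
  have "t \<noteq> \<nu> j" using assms by auto
  then show ?thesis using assms(2) unfolding time_interval_def by auto
qed

lemma error_le:
  assumes lX: "bounded_linear iXB" and K: "\<And>n t. \<nu> (n - 1) < \<nu> n \<Longrightarrow> t \<in> {\<nu> (n - 1)..\<nu> n} \<Longrightarrow> \<bar>1 - profile_on \<nu> l n t\<bar> \<le> K"
    and n: "n \<in> {1..N}" and t: "t \<in> time_interval \<nu> n"
  shows "norm (iXB (u t - R t)) \<le> K * norm (iXB (jump n))"
proof -
  have "norm (iXB (u t - R t)) = \<bar>1 - profile_on \<nu> l n t\<bar> * norm (iXB (jump n))"
    unfolding reconstruction_error[OF n t] by (simp add: linear_simps(5)[OF lX])
  also have "\<dots> \<le> K * norm (iXB (jump n))"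
    using t by (intro mult_right_mono K node_less[OF n]) (auto simp: time_interval_def)
  finally show ?thesis .
qed

text \<open>
  On each interval the error is a bounded multiple of one jump. Square summability of the jumps bounds
  it uniformly; weighting the jumps with the lengths of the intervals gains a factor \<open>sqrt \<tau>\<close>.
\<close>

lemma error_estimates:
  fixes iXB :: "'x \<Rightarrow> 'b::banach"
  assumes lX: "bounded_linear iXB" and K: "\<And>n t. \<nu> (n - 1) < \<nu> n \<Longrightarrow> t \<in> {\<nu> (n - 1)..\<nu> n} \<Longrightarrow> \<bar>1 - profile_on \<nu> l n t\<bar> \<le> K"
    and K0: "K \<ge> 0" and u: "strongly_measurable (time_measure T) u"
    and J: "(\<Sum>n=1..N. (norm (iXB (time_jump \<nu> u0 u (n - 1))))\<^sup>2) \<le> CJ"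
  shows "AE t in time_measure T. norm (iXB (u t - R t)) \<le> K * sqrt CJ"
    "moment 1 T (\<lambda>t. iXB (u t - R t)) \<le> ennreal (K * (CJ + T) * sqrt (max_time_step N \<nu>))"
proof -
  define q where "q n = norm (iXB (jump n))" for n
  have J': "(\<Sum>n=1..N. (q n)\<^sup>2) \<le> CJ"
    unfolding q_def using J by (subst (asm) sum.cong[OF refl]) (use time_jump_eq in auto)
  have le: "norm (iXB (u t - R t)) \<le> K * q n" if "n \<in> {1..N}" "t \<in> time_interval \<nu> n" for n t
    unfolding q_def using error_le[OF lX K that] by auto
  show "AE t in time_measure T. norm (iXB (u t - R t)) \<le> K * sqrt CJ"
  proof -
    have "AE t in time_measure T. t \<in> space (time_measure T)" by (rule AE_space)
    then show ?thesis using AE_not_node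
    proof eventually_elim
      case (elim t)
      then obtain n where n: "n \<in> {1..N}" "t \<in> time_interval \<nu> n" using open_cell_cover[of t] by auto
      have "(q n)\<^sup>2 \<le> (\<Sum>n=1..N. (q n)\<^sup>2)" using n by (intro member_le_sum) auto
      then have "q n \<le> sqrt CJ" using J' by (intro real_le_rsqrt) linarith
      then show ?case using le[OF n] K0 by (meson mult_left_mono order_trans)
    qed
  qed
  define \<tau> where "\<tau> = max_time_step N \<nu>"
  have N1: "1 \<in> {1..N}" using part unfolding time_partition_def by simp
  have \<tau>: "\<tau> > 0" using time_step_le_max[OF N1, of \<nu>] node_less[OF N1] unfolding \<tau>_def time_step_def by linarith
  define F where "F t = ennreal (norm (iXB (u t - R t)) powr 1)" for t
  have "strongly_measurable (time_measure T) (\<lambda>t. iXB (u t - R t))"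
    by (intro strongly_measurable_bounded_linear[OF lX] strongly_measurable_diff u
        strongly_measurable_continuous reconstruction_continuous T_pos)
  from strongly_measurable_norm[OF this]
  have [measurable]: "F \<in> borel_measurable (time_measure T)" unfolding F_def[abs_def] by measurable
  have cell: "(\<integral>\<^sup>+t. F t * indicator {\<nu> j..<\<nu> (Suc j)} t \<partial>time_measure T) \<le> ennreal (K * q (Suc j) * (\<nu> (Suc j) - \<nu> j))"
    if j: "j < N" for j
  proof -
    have b: "0 \<le> \<nu> j" "\<nu> j \<le> \<nu> (Suc j)" "\<nu> (Suc j) \<le> T"
      using j time_partition_bounds[OF part] time_partition_le[OF part] by auto
    have "(\<integral>\<^sup>+t. F t * indicator {\<nu> j..<\<nu> (Suc j)} t \<partial>time_measure T) \<le>
        (\<integral>\<^sup>+t. ennreal (K * q (Suc j)) * indicator {\<nu> j..<\<nu> (Suc j)} t \<partial>time_measure T)"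
    proof (rule nn_integral_mono_AE, use AE_not_node in eventually_elim)
      fix t assume "t \<notin> \<nu> ` {0..N}"
      then show "F t * indicator {\<nu> j..<\<nu> (Suc j)} t \<le> ennreal (K * q (Suc j)) * indicator {\<nu> j..<\<nu> (Suc j)} t"
        using le[of "Suc j" t] in_time_interval[OF j, of t] j unfolding F_def
        by (cases "t \<in> {\<nu> j..<\<nu> (Suc j)}") (auto intro!: ennreal_leI)
    qed
    also have "\<dots> = ennreal (K * q (Suc j) * (\<nu> (Suc j) - \<nu> j))"
      using b K0 nn_integral_cell[of "\<nu> j" "\<nu> (Suc j)" T] by (subst nn_integral_cmult) (simp_all add: ennreal_mult' q_def)
    finally show ?thesis .
  qed
  \<comment> \<open>a jump below \<open>sqrt \<tau>\<close> is paid by the length of the interval, a larger one by its own square\<close>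
  have real: "q (Suc j) * (\<nu> (Suc j) - \<nu> j) \<le> sqrt \<tau> * (\<nu> (Suc j) - \<nu> j) + sqrt \<tau> * (q (Suc j))\<^sup>2" if j: "j < N" for j
  proof -
    let ?d = "\<nu> (Suc j) - \<nu> j"
    have d: "0 \<le> ?d" "?d \<le> \<tau>" using j time_partition_le[OF part, of j "Suc j"] time_step_le_max[of "Suc j" N \<nu>]
      unfolding \<tau>_def time_step_def by auto
    show ?thesis
    proof (cases "q (Suc j) \<le> sqrt \<tau>")
      case True
      then have "q (Suc j) * ?d \<le> sqrt \<tau> * ?d" using d by (intro mult_right_mono)
      moreover have "0 \<le> sqrt \<tau> * (q (Suc j))\<^sup>2" using \<tau> by simp
      ultimately show ?thesis by linarith
    next
      case False
      have "q (Suc j) * ?d \<le> q (Suc j) * (sqrt \<tau> * sqrt \<tau>)" using d \<tau> by (intro mult_left_mono) (auto simp: q_def)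
      also have "\<dots> \<le> q (Suc j) * (sqrt \<tau> * q (Suc j))" using False \<tau> by (intro mult_left_mono) (auto simp: q_def)
      also have "\<dots> = sqrt \<tau> * (q (Suc j))\<^sup>2" by (simp add: power2_eq_square)
      finally show ?thesis using d \<tau> by (smt (verit) mult_nonneg_nonneg real_sqrt_ge_zero)
    qed
  qed
  have "moment 1 T (\<lambda>t. iXB (u t - R t)) = (\<Sum>j<N. \<integral>\<^sup>+t. F t * indicator {\<nu> j..<\<nu> (Suc j)} t \<partial>time_measure T)"
    unfolding moment_def F_def[symmetric] by (rule nn_integral_partition[OF part]) measurable
  also have "\<dots> \<le> (\<Sum>j<N. ennreal (K * q (Suc j) * (\<nu> (Suc j) - \<nu> j)))" using cell by (intro sum_mono) auto
  also have "\<dots> = ennreal (\<Sum>j<N. K * q (Suc j) * (\<nu> (Suc j) - \<nu> j))"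
    by (intro sum_ennreal) (use K0 time_partition_le[OF part] in \<open>auto simp: q_def\<close>)
  also have "(\<Sum>j<N. K * q (Suc j) * (\<nu> (Suc j) - \<nu> j)) \<le> K * (CJ + T) * sqrt \<tau>"
  proof -
    have "(\<Sum>j<N. q (Suc j) * (\<nu> (Suc j) - \<nu> j)) \<le> (\<Sum>j<N. sqrt \<tau> * (\<nu> (Suc j) - \<nu> j) + sqrt \<tau> * (q (Suc j))\<^sup>2)"
      using real by (intro sum_mono) auto
    also have "\<dots> = sqrt \<tau> * (\<Sum>j<N. \<nu> (Suc j) - \<nu> j) + sqrt \<tau> * (\<Sum>j<N. (q (Suc j))\<^sup>2)"
      by (simp add: sum.distrib sum_distrib_left)
    also have "(\<Sum>j<N. \<nu> (Suc j) - \<nu> j) = T" using part unfolding sum_lessThan_telescope time_partition_def by simp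
    also have "(\<Sum>j<N. (q (Suc j))\<^sup>2) = (\<Sum>n=1..N. (q n)\<^sup>2)" by (rule sum.reindex_bij_witness[of _ "\<lambda>n. n - 1" Suc]) auto
    also have "sqrt \<tau> * T + sqrt \<tau> * (\<Sum>n=1..N. (q n)\<^sup>2) \<le> sqrt \<tau> * T + sqrt \<tau> * CJ"
      using J' \<tau> by (intro add_left_mono mult_left_mono) auto
    finally have "K * (\<Sum>j<N. q (Suc j) * (\<nu> (Suc j) - \<nu> j)) \<le> K * (sqrt \<tau> * T + sqrt \<tau> * CJ)" using K0 by (rule mult_left_mono)
    then show ?thesis by (simp add: sum_distrib_left algebra_simps)
  qed
  finally show "moment 1 T (\<lambda>t. iXB (u t - R t)) \<le> ennreal (K * (CJ + T) * sqrt (max_time_step N \<nu>))"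
    unfolding \<tau>_def by (simp add: ennreal_leI)
qed

text \<open>
  The inverse estimate bounds the traces of \<open>u\<close> on both sides of a node. The trace from the left is
  controlled on the preceding interval, and the bound on the ratio of consecutive steps transports that
  control to the interval at hand. At the initial node the trace is the fixed datum \<open>u0\<close>, whose
  contribution is at most \<open>T * norm u0 powr p\<close>.
\<close>

lemma moment_reconstruction_le:
  assumes K: "\<And>n t. \<nu> (n - 1) < \<nu> n \<Longrightarrow> t \<in> {\<nu> (n - 1)..\<nu> n} \<Longrightarrow> \<bar>1 - profile_on \<nu> l n t\<bar> \<le> K" and K0: "K \<ge> 0"
    and u: "strongly_measurable (time_measure T) u" and p: "p \<ge> 1"
    and A: "moment p T u \<le> ennreal A" "A \<ge> 0"
    and ratio: "\<And>n. n \<in> {2..N} \<Longrightarrow> time_step \<nu> n / time_step \<nu> (n - 1) \<le> Cs" and Cs: "Cs > 0"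
  shows "moment p T R \<le> ennreal (2 powr p * (inverse_const l p * A
    + K powr p * (2 powr p * (inverse_const l p * A + (T * norm u0 powr p + Cs * (inverse_const l p * A))))))"
proof -
  define Ci where "Ci = inverse_const l p"
  have Ci: "Ci \<ge> 0" unfolding Ci_def inverse_const_def by simp
  define F where "F t = ennreal (norm (u t) powr p)" for t
  have [measurable]: "(\<lambda>t. norm (u t)) \<in> borel_measurable (time_measure T)" by (rule strongly_measurable_norm[OF u])
  have [measurable]: "F \<in> borel_measurable (time_measure T)" unfolding F_def[abs_def] by measurable
  define a where "a j = (\<integral>\<^sup>+t. F t * indicator {\<nu> j..<\<nu> (Suc j)} t \<partial>time_measure T)" for j
  define r where "r j = enn2real (a j)" for j
  have sum_a: "(\<Sum>j<N. a j) \<le> ennreal A"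
    unfolding a_def using A(1) nn_integral_partition[OF part, of F] by (simp add: moment_def F_def)
  have ar: "a j = ennreal (r j)" if "j < N" for j
  proof -
    have "a j \<le> (\<Sum>j<N. a j)" using that by (intro member_le_sum) auto
    then have "a j < top" using sum_a by (meson ennreal_less_top le_less_trans)
    then show ?thesis unfolding r_def by simp
  qed
  have r0: "r j \<ge> 0" for j unfolding r_def by simp
  have sum_r: "(\<Sum>j<N. r j) \<le> A"
  proof -
    have "ennreal (\<Sum>j<N. r j) = (\<Sum>j<N. ennreal (r j))" using r0 by (intro sum_ennreal[symmetric])
    also have "\<dots> = (\<Sum>j<N. a j)" using ar by (intro sum.cong) auto
    finally have "ennreal (\<Sum>j<N. r j) \<le> ennreal A" using sum_a by simp
    then show ?thesis using A(2) by simp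
  qed
  have bnds: "0 \<le> \<nu> j" "\<nu> j < \<nu> (Suc j)" "\<nu> (Suc j) \<le> T" if "j < N" for j
    using that time_partition_bounds[OF part] time_partition_less[OF part] by auto
  have inv: "(\<nu> (Suc j) - \<nu> j) * norm (U (Suc j) t) powr p \<le> Ci * r j"
    if j: "j < N" and t: "t \<in> {\<nu> j..\<nu> (Suc j)}" for j t
    unfolding Ci_def
  proof (rule inverse_estimate[OF U_poly _ _ _ p])
    have "(\<integral>\<^sup>+t. ennreal (norm (U (Suc j) t) powr p) * indicator {\<nu> j..<\<nu> (Suc j)} t \<partial>time_measure T) = a j"
      unfolding a_def F_def
    proof (rule nn_integral_cong_AE, use AE_not_node in eventually_elim)
      fix t assume "t \<notin> \<nu> ` {0..N}"
      then show "ennreal (norm (U (Suc j) t) powr p) * indicator {\<nu> j..<\<nu> (Suc j)} t =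
          ennreal (norm (u t) powr p) * indicator {\<nu> j..<\<nu> (Suc j)} t"
        using u_eq[of "Suc j" t] in_time_interval[OF j, of t] j by (cases "t \<in> {\<nu> j..<\<nu> (Suc j)}") auto
    qed
    then show "(\<integral>\<^sup>+t. ennreal (norm (U (Suc j) t) powr p) * indicator {\<nu> j..<\<nu> (Suc j)} t \<partial>time_measure T) \<le> ennreal (r j)"
      using ar[OF j] by simp
  qed (use j t bnds[OF j] r0 in auto)
  \<comment> \<open>bound for the trace from the left, weighted with the length of the interval\<close>
  define s where "s j = (if j = 0 then T * norm u0 powr p else Cs * (Ci * r (j - 1)))" for j
  have s0: "s j \<ge> 0" for j unfolding s_def using T_pos Cs Ci r0 by auto
  have jmp: "(\<nu> (Suc j) - \<nu> j) * norm (jump (Suc j)) powr p \<le> 2 powr p * (Ci * r j + s j)" if j: "j < N" for j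
  proof -
    let ?d = "\<nu> (Suc j) - \<nu> j"
    let ?y = "if j = 0 then u0 else U j (\<nu> j)"
    have "norm (jump (Suc j)) powr p \<le> 2 powr p * (norm (U (Suc j) (\<nu> j)) powr p + norm ?y powr p)"
      unfolding jump_def using norm_diff_powr_le[of p "U (Suc j) (\<nu> j)" ?y] p by auto
    then have "?d * norm (jump (Suc j)) powr p \<le> ?d * (2 powr p * (norm (U (Suc j) (\<nu> j)) powr p + norm ?y powr p))"
      using bnds[OF j] by (intro mult_left_mono) auto
    also have "\<dots> = 2 powr p * (?d * norm (U (Suc j) (\<nu> j)) powr p + ?d * norm ?y powr p)" by (simp add: algebra_simps)
    also have "\<dots> \<le> 2 powr p * (Ci * r j + s j)"
    proof (intro mult_left_mono add_mono inv j)
      show "?d * norm ?y powr p \<le> s j"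
      proof (cases j)
        case 0
        then show ?thesis using bnds[OF j] unfolding s_def by (auto intro!: mult_right_mono)
      next
        case (Suc i)
        have i: "i < N" using Suc j by simp
        have "time_step \<nu> (Suc (Suc i)) / time_step \<nu> (Suc i) \<le> Cs" using ratio[of "Suc (Suc i)"] Suc j by simp
        then have "?d \<le> Cs * (\<nu> (Suc i) - \<nu> i)" using bnds[OF i] Suc unfolding time_step_def by (simp add: pos_divide_le_eq)
        then have "?d * norm ?y powr p \<le> Cs * (\<nu> (Suc i) - \<nu> i) * norm ?y powr p" by (rule mult_right_mono) simp
        also have "\<dots> = Cs * ((\<nu> (Suc i) - \<nu> i) * norm (U (Suc i) (\<nu> (Suc i))) powr p)" using Suc by simp
        also have "\<dots> \<le> Cs * (Ci * r i)" using Cs bnds[OF i] by (intro mult_left_mono inv i) auto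
        finally show ?thesis unfolding s_def using Suc by simp
      qed
    qed (use bnds[OF j] in auto)
    finally show ?thesis .
  qed
  define G where "G t = ennreal (norm (R t) powr p)" for t
  have [measurable]: "(\<lambda>t. norm (R t)) \<in> borel_measurable (time_measure T)"
    by (intro strongly_measurable_norm strongly_measurable_continuous reconstruction_continuous T_pos)
  have [measurable]: "G \<in> borel_measurable (time_measure T)" unfolding G_def[abs_def] by measurable
  define e where "e j = 2 powr p * (Ci * r j + K powr p * (2 powr p * (Ci * r j + s j)))" for j
  have e0: "e j \<ge> 0" for j unfolding e_def using Ci r0 s0 by simp
  have cell: "(\<integral>\<^sup>+t. G t * indicator {\<nu> j..<\<nu> (Suc j)} t \<partial>time_measure T) \<le> ennreal (e j)" if j: "j < N" for j
  proof -
    let ?d = "\<nu> (Suc j) - \<nu> j"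
    have d: "?d > 0" using bnds[OF j] by simp
    have pt: "?d * norm (R t) powr p \<le> e j" if t: "t \<in> {\<nu> j..\<nu> (Suc j)}" for t
    proof -
      have n: "Suc j \<in> {1..N}" using j by auto
      let ?w = "(1 - profile_on \<nu> l (Suc j) t) *\<^sub>R jump (Suc j)"
      have "norm (R t) powr p = norm (U (Suc j) t - ?w) powr p"
        using reconstruction_eq[OF n, of t] t unfolding piece_def by simp
      also have "\<dots> \<le> 2 powr p * (norm (U (Suc j) t) powr p + norm ?w powr p)" using p by (intro norm_diff_powr_le) auto
      also have "norm ?w powr p \<le> K powr p * norm (jump (Suc j)) powr p"
      proof -
        have "norm ?w \<le> K * norm (jump (Suc j))"
          using K[of "Suc j" t] t bnds[OF j] by (auto intro!: mult_right_mono)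
        then have "norm ?w powr p \<le> (K * norm (jump (Suc j))) powr p" using p by (intro powr_mono2) auto
        then show ?thesis using K0 by (simp add: powr_mult)
      qed
      finally have "norm (R t) powr p \<le> 2 powr p * (norm (U (Suc j) t) powr p + K powr p * norm (jump (Suc j)) powr p)" by simp
      then have "?d * norm (R t) powr p \<le> ?d * (2 powr p * (norm (U (Suc j) t) powr p + K powr p * norm (jump (Suc j)) powr p))"
        using d by (intro mult_left_mono) auto
      also have "\<dots> = 2 powr p * (?d * norm (U (Suc j) t) powr p + K powr p * (?d * norm (jump (Suc j)) powr p))" by (simp add: algebra_simps)
      also have "\<dots> \<le> e j" unfolding e_def by (intro mult_left_mono add_mono inv jmp j t) auto
      finally show ?thesis .
    qed
    have "(\<integral>\<^sup>+t. G t * indicator {\<nu> j..<\<nu> (Suc j)} t \<partial>time_measure T) \<le>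
        (\<integral>\<^sup>+t. ennreal (e j / ?d) * indicator {\<nu> j..<\<nu> (Suc j)} t \<partial>time_measure T)"
    proof (rule nn_integral_mono)
      fix t
      show "G t * indicator {\<nu> j..<\<nu> (Suc j)} t \<le> ennreal (e j / ?d) * indicator {\<nu> j..<\<nu> (Suc j)} t"
      proof (cases "t \<in> {\<nu> j..<\<nu> (Suc j)}")
        case True
        then have "norm (R t) powr p \<le> e j / ?d" using pt[of t] d by (simp add: pos_le_divide_eq mult.commute)
        then show ?thesis unfolding G_def using True by (simp add: ennreal_leI)
      qed simp
    qed
    also have "\<dots> = ennreal (e j / ?d) * ennreal ?d"
      using bnds[OF j] nn_integral_cell[of "\<nu> j" "\<nu> (Suc j)" T] by (subst nn_integral_cmult) auto
    also have "\<dots> = ennreal (e j)" using d e0[of j] by (simp add: ennreal_mult'[symmetric])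
    finally show ?thesis .
  qed
  have "moment p T R = (\<Sum>j<N. \<integral>\<^sup>+t. G t * indicator {\<nu> j..<\<nu> (Suc j)} t \<partial>time_measure T)"
    unfolding moment_def G_def[symmetric] by (rule nn_integral_partition[OF part]) measurable
  also have "\<dots> \<le> (\<Sum>j<N. ennreal (e j))" using cell by (intro sum_mono) auto
  also have "\<dots> = ennreal (\<Sum>j<N. e j)" using e0 by (intro sum_ennreal) auto
  also have "\<dots> \<le> ennreal (2 powr p * (Ci * A + K powr p * (2 powr p * (Ci * A + (T * norm u0 powr p + Cs * (Ci * A))))))"
  proof (rule ennreal_leI)
    have ss: "(\<Sum>j<N. s j) \<le> T * norm u0 powr p + Cs * (Ci * A)"
    proof -
      obtain M where M: "N = Suc M" using part unfolding time_partition_def by (cases N) auto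
      have "(\<Sum>j<N. s j) = T * norm u0 powr p + (\<Sum>j<M. Cs * (Ci * r j))"
        unfolding M sum.lessThan_Suc_shift s_def by simp
      also have "(\<Sum>j<M. Cs * (Ci * r j)) = Cs * (Ci * (\<Sum>j<M. r j))" by (simp add: sum_distrib_left)
      also have "(\<Sum>j<M. r j) \<le> A" using sum_r r0[of M] unfolding M by simp
      finally show ?thesis using Cs Ci by (simp add: mult_left_mono)
    qed
    have "(\<Sum>j<N. e j) = 2 powr p * (Ci * (\<Sum>j<N. r j) + K powr p * (2 powr p * (Ci * (\<Sum>j<N. r j) + (\<Sum>j<N. s j))))"
      unfolding e_def by (simp add: sum_distrib_left[symmetric] sum.distrib)
    also have "\<dots> \<le> 2 powr p * (Ci * A + K powr p * (2 powr p * (Ci * A + (T * norm u0 powr p + Cs * (Ci * A)))))"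
      using sum_r ss Ci by (intro mult_left_mono add_mono) auto
    finally show "(\<Sum>j<N. e j) \<le> 2 powr p * (Ci * A + K powr p * (2 powr p * (Ci * A + (T * norm u0 powr p + Cs * (Ci * A)))))" .
  qed
  finally show ?thesis unfolding Ci_def .
qed

text \<open>
  By continuity an almost everywhere bound holds for the representing polynomials on closed
  intervals, hence for all traces and jumps.
\<close>

lemma reconstruction_bounded:
  assumes K: "\<And>n t. \<nu> (n - 1) < \<nu> n \<Longrightarrow> t \<in> {\<nu> (n - 1)..\<nu> n} \<Longrightarrow> \<bar>1 - profile_on \<nu> l n t\<bar> \<le> K" and K0: "K \<ge> 0"
    and M: "AE t in time_measure T. norm (u t) \<le> M" "M \<ge> 0" and t: "0 \<le> t" "t \<le> T"
  shows "norm (R t) \<le> M + K * (2 * M + norm u0)"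
proof -
  have UM: "norm (U n t) \<le> M" if n: "n \<in> {1..N}" and t: "t \<in> {\<nu> (n - 1)..\<nu> n}" for n t
  proof -
    have closed: "closed {t. norm (U n t) \<le> M}"
      by (intro closed_Collect_le continuous_intros vector_poly_continuous[OF U_poly[OF n]])
    have sub: "{\<nu> (n - 1)<..<\<nu> n} \<subseteq> {0<..<T}" 
    proof -
      have "0 \<le> \<nu> (n - 1)" "\<nu> n \<le> T" using n by (auto intro!: time_partition_bounds[OF part])
      then show ?thesis by auto
    qed
    have "AE t in lebesgue. t \<in> {0<..<T} \<longrightarrow> norm (u t) \<le> M" using M(1) unfolding AE_time_measure_iff .
    then have ae: "AE x\<in>{\<nu> (n - 1)<..<\<nu> n} in lebesgue. x \<in> {t. norm (U n t) \<le> M}"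
    proof eventually_elim
      case (elim x)
      show ?case
      proof
        assume x: "x \<in> {\<nu> (n - 1)<..<\<nu> n}"
        then have "u x = U n x" using u_eq[OF n] unfolding time_interval_def by simp
        then show "x \<in> {t. norm (U n t) \<le> M}" using elim x sub by auto
      qed
    qed
    have "{\<nu> (n - 1)<..<\<nu> n} \<subseteq> {t. norm (U n t) \<le> M}"
      using mem_closed_if_AE_lebesgue_open[OF open_greaterThanLessThan closed ae] by blast
    then have "closure {\<nu> (n - 1)<..<\<nu> n} \<subseteq> {t. norm (U n t) \<le> M}" using closed by (rule closure_minimal)
    then show ?thesis using t node_less[OF n] by auto
  qed
  obtain n where n: "n \<in> {1..N}" "t \<in> {\<nu> (n - 1)..\<nu> n}" using cell_cover[OF t] by blast
  have less: "\<nu> (n - 1) < \<nu> n" by (rule node_less[OF n(1)])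
  have "norm (jump n) \<le> 2 * M + norm u0"
  proof (cases "n = 1")
    case True
    then show ?thesis unfolding jump_def using UM[OF n(1), of "\<nu> (n - 1)"] less norm_triangle_ineq4[of "U n (\<nu> (n - 1))" u0] M(2) by auto
  next
    case False
    then have m: "n - 1 \<in> {1..N}" using n by auto
    have "norm (U n (\<nu> (n - 1))) \<le> M" using less by (intro UM n(1)) auto
    moreover have "norm (U (n - 1) (\<nu> (n - 1))) \<le> M" using node_less[OF m] by (intro UM m) auto
    moreover have "norm (jump n) \<le> norm (U n (\<nu> (n - 1))) + norm (U (n - 1) (\<nu> (n - 1)))"
      unfolding jump_def using False norm_triangle_ineq4 by auto
    ultimately show ?thesis using norm_ge_zero[of u0] by linarith
  qed
  then have "\<bar>1 - profile_on \<nu> l n t\<bar> * norm (jump n) \<le> K * (2 * M + norm u0)"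
    using K[OF less n(2)] K0 by (intro mult_mono) auto
  moreover have "norm (R t) \<le> norm (U n t) + norm ((1 - profile_on \<nu> l n t) *\<^sub>R jump n)"
    unfolding reconstruction_eq[OF n] piece_def by (rule norm_triangle_ineq4)
  ultimately show ?thesis using UM[OF n] by simp
qed

text \<open>
  The fundamental theorem of calculus across the nodes: the reconstruction is continuous and
  differentiable off a finite set.
\<close>

lemma reconstruction_increment:
  fixes iXY :: "'x \<Rightarrow> 'y::banach"
  assumes lin: "bounded_linear iXY"
    and meas: "(\<lambda>x. norm (iXY (reconstruction_deriv \<nu> l u0 u x))) \<in> borel_measurable (time_measure T)"
    and fin: "(\<integral>\<^sup>+x. ennreal (norm (iXY (reconstruction_deriv \<nu> l u0 u x))) \<partial>time_measure T) < \<infinity>"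
    and st: "0 \<le> s" "s \<le> t" "t \<le> T"
  shows "ennreal (norm (iXY (R t) - iXY (R s))) \<le>
    (\<integral>\<^sup>+x. ennreal (norm (iXY (reconstruction_deriv \<nu> l u0 u x))) * indicator {s..<t} x \<partial>time_measure T)"
proof -
  interpret bounded_linear iXY by (rule lin)
  define d where "d x = iXY (reconstruction_deriv \<nu> l u0 u x)" for x
  have int: "(d has_integral (iXY (R t) - iXY (R s))) {s..t}"
  proof (rule fundamental_theorem_of_calculus_strong[of "\<nu> ` {0..N}" s t "\<lambda>x. iXY (R x)" d])
    show "((\<lambda>x. iXY (R x)) has_vector_derivative d x) (at x)" if "x \<in> {s..t} - \<nu> ` {0..N}" for x
      unfolding d_def using that st by (intro has_vector_derivative reconstruction_differentiable) auto
    show "continuous_on {s..t} (\<lambda>x. iXY (R x))"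
      using st by (intro continuous_on continuous_on_subset[OF reconstruction_continuous]) auto
  qed (use st in auto)
  have I: "integrable (time_measure T) (\<lambda>x. norm (d x))"
    unfolding integrable_iff_bounded d_def using meas fin by simp
  have sub: "{s<..<t} \<subseteq> {0<..<T}" using st by auto
  have I2: "integrable (lebesgue_on {s<..<t}) (\<lambda>x. norm (d x))"
  proof -
    have "set_integrable lebesgue {0<..<T} (\<lambda>x. norm (d x))"
      using I by (simp add: set_integrable_def integrable_restrict_space)
    then have "set_integrable lebesgue {s<..<t} (\<lambda>x. norm (d x))" by (rule set_integrable_subset) (use sub in auto)
    then show ?thesis by (simp add: set_integrable_def integrable_restrict_space)
  qed
  have on: "(\<lambda>x. norm (d x)) integrable_on {s..t}"
    using integrable_on_lebesgue_on[OF I2] by (simp add: integrable_on_open_interval_real)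
  have "norm (iXY (R t) - iXY (R s)) = norm (integral {s..t} d)" using int by (simp add: integral_unique)
  also have "\<dots> \<le> integral {s..t} (\<lambda>x. norm (d x))"
    using int on by (intro integral_norm_bound_integral) auto
  also have "\<dots> = integral {s<..<t} (\<lambda>x. norm (d x))" by (rule integral_open_interval_real)
  also have "\<dots> = (\<integral>x. norm (d x) \<partial>lebesgue_on {s<..<t})" by (rule lebesgue_integral_eq_integral[symmetric, OF I2]) simp
  finally have "ennreal (norm (iXY (R t) - iXY (R s))) \<le> ennreal (\<integral>x. norm (d x) \<partial>lebesgue_on {s<..<t})" by (rule ennreal_leI)
  also have "\<dots> = (\<integral>\<^sup>+x. ennreal (norm (d x)) \<partial>lebesgue_on {s<..<t})"
    using I2 by (intro nn_integral_eq_integral[symmetric]) auto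
  also have "\<dots> = (\<integral>\<^sup>+x. ennreal (norm (d x)) * indicator {s<..<t} x \<partial>lebesgue)" by (rule nn_integral_restrict_space) simp
  also have "\<dots> \<le> (\<integral>\<^sup>+x. (ennreal (norm (d x)) * indicator {s..<t} x) * indicator {0<..<T} x \<partial>lebesgue)"
    using sub by (intro nn_integral_mono) (auto simp: indicator_def)
  also have "\<dots> = (\<integral>\<^sup>+x. ennreal (norm (d x)) * indicator {s..<t} x \<partial>time_measure T)" by (rule nn_integral_restrict_space[symmetric]) simp
  finally show ?thesis unfolding d_def .
qed

end

lemma AE_bound_of_Lp_norm_infinity:
  assumes "f \<in> Lp_space \<infinity> T" "Lp_norm \<infinity> T f \<le> C"
  shows "AE x in time_measure T. norm (f x) \<le> \<bar>C\<bar>"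
proof -
  have ess: "esssup (time_measure T) (\<lambda>t. ereal (norm (f t))) \<le> ereal \<bar>C\<bar>"
    using assms unfolding Lp_space_def Lp_norm_def by (cases "esssup (time_measure T) (\<lambda>t. ereal (norm (f t)))") auto
  show ?thesis
    using esssup_AE[of "\<lambda>t. ereal (norm (f t))" "time_measure T"]
    by eventually_elim (use ess in \<open>auto dest: order_trans\<close>)
qed

text \<open>
  The bound that Hoelder's inequality gives, up to the constant: for finite \<open>r\<close>, splitting at
  the threshold \<open>(t - s) powr (- 1 / r)\<close> balances the two parts.
\<close>

lemma Lp_bound_short_interval:
  fixes f :: "real \<Rightarrow> 'y::real_normed_vector" and r :: ereal
  assumes f: "f \<in> Lp_space r T" "Lp_norm r T f \<le> C" and r: "1 \<le> r" and st: "0 \<le> s" "s \<le> t" "t \<le> T"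
  shows "(\<integral>\<^sup>+x. ennreal (norm (f x)) * indicator {s..<t} x \<partial>time_measure T) \<le>
    ennreal ((1 + \<bar>C\<bar> + \<bar>C\<bar> powr real_of_ereal r) * (t - s) powr (1 - real_of_ereal (1 / r)))"
proof (cases "s = t")
  case False
  define h where "h = t - s"
  have h: "h > 0" using False st unfolding h_def by simp
  have sm: "strongly_measurable (time_measure T) f" using f(1) unfolding Lp_space_def by simp
  have [measurable]: "(\<lambda>x. norm (f x)) \<in> borel_measurable (time_measure T)" by (rule strongly_measurable_norm[OF sm])
  have cell: "(\<integral>\<^sup>+x. indicator {s..<t} x \<partial>time_measure T) = ennreal h" unfolding h_def by (rule nn_integral_cell[OF st])
  consider r' where "r = ereal r'" "r' \<ge> 1" | "r = \<infinity>" using r by (cases r) auto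
  then show ?thesis
  proof cases
    case 1
    have m: "moment r' T f \<le> ennreal (C powr r')" using f 1 by (intro moment_le_of_Lp_norm) auto
    \<comment> \<open>both \<open>\<kappa> * h\<close> and \<open>\<kappa> powr (1 - r')\<close> are then equal to \<open>h powr (1 - 1 / r')\<close>\<close>
    define \<kappa> where "\<kappa> = h powr (- 1 / r')"
    have \<kappa>: "\<kappa> > 0" unfolding \<kappa>_def using h by simp
    have "ennreal (norm (f x)) * indicator {s..<t} x \<le> ennreal \<kappa> * indicator {s..<t} x
        + ennreal (\<kappa> powr (1 - r')) * ennreal (norm (f x) powr r')" for x
      using le_add_powr[OF norm_ge_zero \<kappa> 1(2), of "f x"] \<kappa>
      by (cases "x \<in> {s..<t}") (auto simp: ennreal_plus[symmetric] ennreal_mult'[symmetric] ennreal_leI simp del: ennreal_plus)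
    then have "(\<integral>\<^sup>+x. ennreal (norm (f x)) * indicator {s..<t} x \<partial>time_measure T) \<le>
        (\<integral>\<^sup>+x. ennreal \<kappa> * indicator {s..<t} x + ennreal (\<kappa> powr (1 - r')) * ennreal (norm (f x) powr r') \<partial>time_measure T)"
      by (intro nn_integral_mono) auto
    also have "\<dots> = ennreal \<kappa> * ennreal h + ennreal (\<kappa> powr (1 - r')) * moment r' T f"
      unfolding moment_def using cell by (simp add: nn_integral_add nn_integral_cmult)
    also have "\<dots> \<le> ennreal \<kappa> * ennreal h + ennreal (\<kappa> powr (1 - r')) * ennreal (C powr r')"
      using m by (intro add_left_mono mult_left_mono) auto
    also have "\<dots> = ennreal (\<kappa> * h + \<kappa> powr (1 - r') * C powr r')"
      using \<kappa> h by (simp add: ennreal_plus[symmetric] ennreal_mult'[symmetric] del: ennreal_plus)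
    also have "\<kappa> * h = h powr (1 - 1 / r')" unfolding \<kappa>_def using h powr_add[of h "- 1 / r'" 1] by simp
    also have "\<kappa> powr (1 - r') = h powr (1 - 1 / r')"
    proof -
      have "- 1 / r' * (1 - r') = 1 - 1 / r'" using 1(2) by (simp add: field_simps)
      then show ?thesis unfolding \<kappa>_def by (simp add: powr_powr)
    qed
    also have "ennreal (h powr (1 - 1 / r') + h powr (1 - 1 / r') * C powr r') \<le>
        ennreal ((1 + \<bar>C\<bar> + \<bar>C\<bar> powr r') * h powr (1 - 1 / r'))"
    proof (rule ennreal_leI)
      have "0 \<le> Lp_norm r T f" unfolding Lp_norm_def 1(1) by simp
      then have "C powr r' = \<bar>C\<bar> powr r'" using f(2) by simp
      then show "h powr (1 - 1 / r') + h powr (1 - 1 / r') * C powr r' \<le> (1 + \<bar>C\<bar> + \<bar>C\<bar> powr r') * h powr (1 - 1 / r')"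
        by (simp add: algebra_simps)
    qed
    finally show ?thesis using 1 unfolding h_def by (simp add: one_ereal_def)
  next
    case 2
    have "AE x in time_measure T. norm (f x) \<le> \<bar>C\<bar>" using f 2 by (intro AE_bound_of_Lp_norm_infinity) auto
    then have "(\<integral>\<^sup>+x. ennreal (norm (f x)) * indicator {s..<t} x \<partial>time_measure T) \<le>
        (\<integral>\<^sup>+x. ennreal \<bar>C\<bar> * indicator {s..<t} x \<partial>time_measure T)"
      by (intro nn_integral_mono_AE, eventually_elim) (auto intro!: mult_right_mono ennreal_leI)
    also have "\<dots> = ennreal (\<bar>C\<bar> * h)" using cell by (simp add: nn_integral_cmult ennreal_mult')
    also have "\<dots> \<le> ennreal ((1 + \<bar>C\<bar> + \<bar>C\<bar> powr real_of_ereal r) * h)" using h by (intro ennreal_leI mult_right_mono) auto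
    finally show ?thesis using 2 h unfolding h_def by simp
  qed
qed simp

section \<open>Compactness of approximate solutions close to their reconstructions\<close>

lemma moment_le_bounded:
  assumes "AE t in time_measure T. norm (f t) \<le> E" "p \<ge> 1"
    "(\<lambda>t. norm (f t)) \<in> borel_measurable (time_measure T)"
  shows "moment p T f \<le> ennreal (E powr (p - 1)) * moment 1 T f"
proof -
  note [measurable] = assms(3)
  have "moment p T f \<le> (\<integral>\<^sup>+t. ennreal (E powr (p - 1)) * ennreal (norm (f t) powr 1) \<partial>time_measure T)"
    unfolding moment_def
  proof (rule nn_integral_mono_AE, use assms(1) in eventually_elim)
    fix t assume le: "norm (f t) \<le> E"
    have "norm (f t) powr p = norm (f t) powr (p - 1) * norm (f t) powr 1"
      using powr_add[of "norm (f t)" "p - 1" 1] by simp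
    also have "\<dots> \<le> E powr (p - 1) * norm (f t) powr 1"
      using le assms(2) by (intro mult_right_mono powr_mono2) auto
    finally show "ennreal (norm (f t) powr p) \<le> ennreal (E powr (p - 1)) * ennreal (norm (f t) powr 1)"
      by (simp add: ennreal_mult'[symmetric] ennreal_leI)
  qed
  also have "\<dots> = ennreal (E powr (p - 1)) * moment 1 T f" unfolding moment_def by (simp add: nn_integral_cmult)
  finally show ?thesis .
qed

lemma tendsto_0_ennreal_le:
  assumes "\<And>i. f i \<le> g i" "(g \<longlongrightarrow> (0::ennreal)) F" shows "(f \<longlongrightarrow> 0) F"
  using tendsto_sandwich[of "\<lambda>_. 0" f F g 0] assms by auto

lemma moment_limit_finite:
  assumes F: "\<And>i. strongly_measurable (time_measure T) (F i)" "\<And>i. moment p T (F i) < \<infinity>"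
    and g: "strongly_measurable (time_measure T) g"
    and lim: "(\<lambda>i. moment p T (\<lambda>t. F i t - g t)) \<longlonglongrightarrow> 0" and p: "p > 0"
  shows "moment p T g < \<infinity>"
proof -
  have "\<forall>\<^sub>F i in sequentially. moment p T (\<lambda>t. F i t - g t) < 1" using lim by (rule order_tendstoD) simp
  then obtain i where i: "moment p T (\<lambda>t. F i t - g t) < 1" by (meson eventually_sequentially order_refl)
  have "moment p T (\<lambda>t. g t - 0) \<le> ennreal (2 powr p) * (moment p T (\<lambda>t. g t - F i t) + moment p T (\<lambda>t. F i t - 0))"
    using F g p by (intro moment_triangle) (auto intro!: strongly_measurable_simple)
  also have "moment p T (\<lambda>t. g t - F i t) = moment p T (\<lambda>t. F i t - g t)" by (rule moment_commute)
  also have "ennreal (2 powr p) * (moment p T (\<lambda>t. F i t - g t) + moment p T (\<lambda>t. F i t - 0)) < \<infinity>"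
    using i F(2)[of i] by (auto simp: ennreal_mult_less_top intro: order_less_trans)
  finally show ?thesis by simp
qed

text \<open>
  A sequence taken from the range of a family may repeat members in any order. Up to a subsequence it
  is constant, or its indices diverge, so that the mesh sizes along it tend to 0.
\<close>

lemma const_or_divergent_subsequence:
  fixes \<sigma> :: "nat \<Rightarrow> nat"
  obtains \<psi> c where "strict_mono (\<psi> :: nat \<Rightarrow> nat)" "\<And>i. \<sigma> (\<psi> i) = c"
  | "filterlim \<sigma> at_top sequentially"
proof (cases "\<exists>c. infinite {k. \<sigma> k = c}")
  case True
  then obtain c where c: "infinite {k. \<sigma> k = c}" by blast
  then have "strict_mono (enumerate {k. \<sigma> k = c})" by (rule strict_mono_enumerate)
  moreover have "\<sigma> (enumerate {k. \<sigma> k = c} i) = c" for i using enumerate_in_set[OF c, of i] by simp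
  ultimately show ?thesis using that(1) by blast
next
  case False
  have "filterlim \<sigma> at_top sequentially" unfolding filterlim_at_top
  proof
    fix Z
    have "{k. \<sigma> k < Z} = (\<Union>c<Z. {k. \<sigma> k = c})" by auto
    also have "finite \<dots>" using False by simp
    finally have fin: "finite {k. \<sigma> k < Z}" .
    then obtain K where K: "\<forall>k\<in>{k. \<sigma> k < Z}. k < K" unfolding finite_nat_set_iff_bounded by blast
    have "Z \<le> \<sigma> k" if "k \<ge> K" for k
    proof (rule ccontr)
      assume "\<not> Z \<le> \<sigma> k"
      then have "k < K" using K by simp
      then show False using that by simp
    qed
    then show "\<forall>\<^sub>F k in sequentially. Z \<le> \<sigma> k" by (rule eventually_sequentiallyI)
  qed
  then show ?thesis by (rule that(2))
qed

text \<open>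
  Reduces relative compactness of a family, whose sequences may be indexed arbitrarily, to index
  sequences that tend to infinity.
\<close>

lemma relatively_compact_range:
  fixes F :: "nat \<Rightarrow> real \<Rightarrow> 'b::banach"
  assumes F: "\<And>k. F k \<in> Lp_space (ereal q) T" and q: "q > 0"
    and sub: "\<And>\<sigma>. filterlim \<sigma> at_top sequentially \<Longrightarrow>
      \<exists>\<phi> g. strict_mono (\<phi> :: nat \<Rightarrow> nat) \<and> strongly_measurable (time_measure T) g \<and>
        (\<lambda>i. moment q T (\<lambda>t. F (\<sigma> (\<phi> i)) t - g t)) \<longlonglongrightarrow> 0"
  shows "relatively_compact_Lp (ereal q) T (range F)"
  unfolding relatively_compact_Lp_def
proof (intro conjI allI impI)
  show "range F \<subseteq> Lp_space (ereal q) T" using F by auto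
  fix G :: "nat \<Rightarrow> real \<Rightarrow> 'b" assume "\<forall>k. G k \<in> range F"
  then have "\<forall>k. \<exists>j. G k = F j" by blast
  then obtain \<sigma> where G: "\<And>k. G k = F (\<sigma> k)" by metis
  show "\<exists>\<phi> g. strict_mono (\<phi> :: nat \<Rightarrow> nat) \<and> converges_Lp (ereal q) T (G \<circ> \<phi>) g"
  proof (rule const_or_divergent_subsequence[of \<sigma>])
    fix \<psi> c assume \<psi>: "strict_mono (\<psi> :: nat \<Rightarrow> nat)" "\<And>i. \<sigma> (\<psi> i) = c"
    have "converges_Lp (ereal q) T (G \<circ> \<psi>) (F c)"
      using F q by (intro converges_Lp_of_moment) (auto simp: G \<psi>(2) moment_def)
    then show ?thesis using \<psi>(1) by blast
  next
    assume "filterlim \<sigma> at_top sequentially"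
    then obtain \<phi> g where \<phi>: "strict_mono (\<phi> :: nat \<Rightarrow> nat)" and g: "strongly_measurable (time_measure T) g"
      and lim: "(\<lambda>i. moment q T (\<lambda>t. F (\<sigma> (\<phi> i)) t - g t)) \<longlonglongrightarrow> 0" using sub by blast
    have "moment q T g < \<infinity>"
      using F q by (intro moment_limit_finite[OF _ _ g lim]) (auto simp: Lp_space_iff_moment)
    then have "converges_Lp (ereal q) T (G \<circ> \<phi>) g"
      using F q g lim by (intro converges_Lp_of_moment) (auto simp: G Lp_space_iff_moment)
    then show ?thesis using \<phi> by blast
  qed
qed

text \<open>
  The points of convergence are dense, and equicontinuity carries convergence from them to every point
  of the closed interval. This takes the place of the Arzela--Ascoli theorem.
\<close>

lemma AE_convergent_equicontinuous:
  fixes f :: "nat \<Rightarrow> real \<Rightarrow> 'b::banach"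
  assumes T: "T > 0"
    and equi: "\<And>e. e > 0 \<Longrightarrow> \<exists>d>0. \<forall>i. \<forall>s\<in>{0..T}. \<forall>t\<in>{0..T}. \<bar>t - s\<bar> < d \<longrightarrow> norm (f i t - f i s) \<le> e"
    and conv: "AE t in time_measure T. (\<lambda>i. f i t) \<longlonglongrightarrow> g t"
  obtains G where "continuous_on {0..T} G" "AE t in time_measure T. g t = G t"
proof -
  have dense_conv: "\<exists>s\<in>{0..T}. \<bar>t - s\<bar> < d \<and> (\<lambda>i. f i s) \<longlonglongrightarrow> g s" if t: "t \<in> {0..T}" and d: "d > 0" for t d
  proof (rule ccontr)
    assume no: "\<not> ?thesis"
    let ?a = "max 0 (t - d)" and ?b = "min T (t + d)"
    have ab: "?a < ?b" using t d T by auto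
    have "AE x in lebesgue. x \<in> {0<..<T} \<longrightarrow> (\<lambda>i. f i x) \<longlonglongrightarrow> g x" using conv unfolding AE_time_measure_iff .
    then have ae: "AE x\<in>{?a<..<?b} in lebesgue. x \<in> {}"
    proof eventually_elim
      case (elim x)
      show ?case
      proof
        assume x: "x \<in> {?a<..<?b}"
        then have "x \<in> {0..T}" "\<bar>t - x\<bar> < d" "x \<in> {0<..<T}" by auto
        then show "x \<in> {}" using no elim by blast
      qed
    qed
    obtain m where "?a < m" "m < ?b" using dense[OF ab] by blast
    then have "m \<in> {?a<..<?b}" unfolding greaterThanLessThan_iff by (rule conjI)
    with open_greaterThanLessThan closed_empty ae have "m \<in> {}" by (rule mem_closed_if_AE_lebesgue_open)
    then show False by (rule emptyE)
  qed
  have "convergent (\<lambda>i. f i t)" if t: "t \<in> {0..T}" for t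
  proof (rule Cauchy_convergent, rule CauchyI)
    fix e :: real assume e: "e > 0"
    obtain d where d: "d > 0" "\<And>i s t. s \<in> {0..T} \<Longrightarrow> t \<in> {0..T} \<Longrightarrow> \<bar>t - s\<bar> < d \<Longrightarrow> norm (f i t - f i s) \<le> e / 4"
      using equi[of "e / 4"] e by auto
    obtain s where s: "s \<in> {0..T}" "\<bar>t - s\<bar> < d" "(\<lambda>i. f i s) \<longlonglongrightarrow> g s" using dense_conv[OF t d(1)] by blast
    obtain M where M: "\<And>m n. m \<ge> M \<Longrightarrow> n \<ge> M \<Longrightarrow> norm (f m s - f n s) < e / 4"
      using CauchyD[OF LIMSEQ_imp_Cauchy[OF s(3)], of "e / 4"] e by auto
    have "norm (f m t - f n t) < e" if "m \<ge> M" "n \<ge> M" for m n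
    proof -
      have "norm (f m t - f n t) \<le> norm ((f m t - f m s) + (f m s - f n s)) + norm (f n t - f n s)"
        using norm_triangle_ineq4[of "(f m t - f m s) + (f m s - f n s)" "f n t - f n s"] by simp
      also have "norm ((f m t - f m s) + (f m s - f n s)) \<le> norm (f m t - f m s) + norm (f m s - f n s)"
        by (rule norm_triangle_ineq)
      finally have "norm (f m t - f n t) \<le> norm (f m t - f m s) + norm (f m s - f n s) + norm (f n t - f n s)" by simp
      then show ?thesis using d(2)[OF s(1) t s(2), of m] d(2)[OF s(1) t s(2), of n] M[OF that] e by linarith
    qed
    then show "\<exists>M. \<forall>m\<ge>M. \<forall>n\<ge>M. norm (f m t - f n t) < e" by blast
  qed
  then have lim: "(\<lambda>i. f i t) \<longlonglongrightarrow> lim (\<lambda>i. f i t)" if "t \<in> {0..T}" for t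
    using that by (simp add: convergent_LIMSEQ_iff)
  have "continuous_on {0..T} (\<lambda>t. lim (\<lambda>i. f i t))"
    unfolding continuous_on_iff
  proof (intro ballI allI impI)
    fix t e :: real assume t: "t \<in> {0..T}" and e: "e > 0"
    obtain d where d: "d > 0" "\<And>i s t. s \<in> {0..T} \<Longrightarrow> t \<in> {0..T} \<Longrightarrow> \<bar>t - s\<bar> < d \<Longrightarrow> norm (f i t - f i s) \<le> e / 2"
      using equi[of "e / 2"] e by auto
    have "dist (lim (\<lambda>i. f i s)) (lim (\<lambda>i. f i t)) < e" if s: "s \<in> {0..T}" "dist s t < d" for s
    proof -
      have "norm (lim (\<lambda>i. f i s) - lim (\<lambda>i. f i t)) \<le> e / 2"
      proof (rule LIMSEQ_le_const2[OF tendsto_norm[OF tendsto_diff[OF lim[OF s(1)] lim[OF t]]]])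
        show "\<exists>N. \<forall>n\<ge>N. norm (f n s - f n t) \<le> e / 2" using d(2)[OF t s(1)] s(2) by (auto simp: dist_real_def)
      qed
      then show ?thesis using e by (simp add: dist_norm)
    qed
    then show "\<exists>d>0. \<forall>s\<in>{0..T}. dist s t < d \<longrightarrow> dist (lim (\<lambda>i. f i s)) (lim (\<lambda>i. f i t)) < e" using d(1) by blast
  qed
  moreover have "AE t in time_measure T. g t = lim (\<lambda>i. f i t)"
    using conv by eventually_elim (metis limI)
  ultimately show ?thesis by (rule that)
qed

text \<open>
  What the proof retains of a family of approximate solutions \<open>u k\<close> and their reconstructions \<open>v k\<close>: the
  increments of \<open>v k\<close> in the third space are controlled by nondecreasing functions \<open>\<theta> k\<close> with uniformly bounded increments, and \<open>u k - v k\<close> is bounded in the middle space and tends to 0 there in the mean.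
\<close>

locale reconstructed_family =
  fixes T :: real and iXB :: "'x::banach \<Rightarrow> 'b::banach" and iBY :: "'b \<Rightarrow> 'y::banach"
    and u v :: "nat \<Rightarrow> real \<Rightarrow> 'x" and \<theta> :: "nat \<Rightarrow> real \<Rightarrow> real" and \<delta> :: "nat \<Rightarrow> real" and D \<alpha> E :: real
  assumes T: "T > 0" and XB: "compact_embedding iXB" and BY: "continuous_embedding iBY"
    and u_meas: "\<And>k. strongly_measurable (time_measure T) (u k)"
    and v_cont: "\<And>k. continuous_on {0..T} (v k)"
    and increment: "\<And>k s t. 0 \<le> s \<Longrightarrow> s \<le> t \<Longrightarrow> t \<le> T \<Longrightarrow> norm (iBY (iXB (v k t)) - iBY (iXB (v k s))) \<le> \<theta> k t - \<theta> k s"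
    and modulus: "\<And>k s t. 0 \<le> s \<Longrightarrow> s \<le> t \<Longrightarrow> t \<le> T \<Longrightarrow> \<theta> k t - \<theta> k s \<le> D * (t - s) powr \<alpha>"
    and D: "D \<ge> 0" and \<alpha>: "\<alpha> \<ge> 0"
    and err_bounded: "\<And>k. AE t in time_measure T. norm (iXB (u k t - v k t)) \<le> E"
    and err_moment: "\<And>k. moment 1 T (\<lambda>t. iXB (u k t - v k t)) \<le> ennreal (\<delta> k)"
    and \<delta>: "\<delta> \<longlonglongrightarrow> 0"
begin

lemma lX: "bounded_linear iXB" and lB: "bounded_linear iBY"
  using XB BY unfolding compact_embedding_def continuous_embedding_def by auto

lemma v_meas: "strongly_measurable (time_measure T) (v k)"
  by (rule strongly_measurable_continuous[OF v_cont T])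

lemma iXB_diff: "iXB (x - y) = iXB x - iXB y"
  using lX by (simp add: linear_simps(2))

lemmas iu_meas = strongly_measurable_bounded_linear[OF lX u_meas]
lemmas iv_meas = strongly_measurable_bounded_linear[OF lX v_meas]

text \<open>
  Aubin--Lions--Simon gives compactness of the reconstructions, and the difference to the approximate
  solutions tends to 0 in \<open>L\<^sup>p\<close> for every finite \<open>p\<close>, being bounded and small in \<open>L\<^sup>1\<close>.
\<close>

lemma compactness:
  assumes p: "p \<ge> 1" and A: "\<And>k. moment p T (v k) \<le> ennreal A" and \<sigma>: "filterlim \<sigma> at_top sequentially"
  obtains \<phi> g where "strict_mono (\<phi> :: nat \<Rightarrow> nat)" "strongly_measurable (time_measure T) g"
    "(\<lambda>i. moment p T (\<lambda>t. iXB (v (\<sigma> (\<phi> i)) t) - g t)) \<longlonglongrightarrow> 0"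
    "(\<lambda>i. moment p T (\<lambda>t. iXB (u (\<sigma> (\<phi> i)) t) - g t)) \<longlonglongrightarrow> 0"
proof -
  have D': "\<theta> k T - \<theta> k 0 \<le> D * T powr \<alpha>" for k using modulus[of 0 T k] T by simp
  obtain \<phi> g where \<phi>: "strict_mono (\<phi> :: nat \<Rightarrow> nat)" and g: "strongly_measurable (time_measure T) g"
    and lim: "(\<lambda>i. moment p T (\<lambda>t. iXB (v (\<sigma> (\<phi> i)) t) - g t)) \<longlonglongrightarrow> 0"
    using Aubin_Lions_Simon[where v = "\<lambda>k. v (\<sigma> k)" and \<theta> = "\<lambda>k. \<theta> (\<sigma> k)" and D = "D * T powr \<alpha>" and A = A,
        OF XB BY T p v_cont A increment D'] by blast
  have "filterlim (\<lambda>i. \<sigma> (\<phi> i)) at_top sequentially"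
    by (rule filterlim_compose[OF \<sigma> filterlim_subseq[OF \<phi>]])
  then have "(\<lambda>i. \<delta> (\<sigma> (\<phi> i))) \<longlonglongrightarrow> 0" by (rule filterlim_compose[OF \<delta>])
  then have d0: "(\<lambda>i. ennreal (E powr (p - 1)) * ennreal (\<delta> (\<sigma> (\<phi> i)))) \<longlonglongrightarrow> ennreal (E powr (p - 1)) * ennreal 0"
    by (intro ennreal_tendsto_cmult tendsto_ennrealI) auto
  have err: "moment p T (\<lambda>t. iXB (u k t) - iXB (v k t)) \<le> ennreal (E powr (p - 1)) * ennreal (\<delta> k)" for k
  proof -
    have "moment p T (\<lambda>t. iXB (u k t - v k t)) \<le> ennreal (E powr (p - 1)) * moment 1 T (\<lambda>t. iXB (u k t - v k t))"
      by (intro moment_le_bounded err_bounded p strongly_measurable_norm strongly_measurable_bounded_linear[OF lX]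
          strongly_measurable_diff u_meas v_meas)
    also have "\<dots> \<le> ennreal (E powr (p - 1)) * ennreal (\<delta> k)" by (intro mult_left_mono err_moment) simp
    finally show ?thesis unfolding iXB_diff .
  qed
  have "(\<lambda>i. moment p T (\<lambda>t. iXB (u (\<sigma> (\<phi> i)) t) - g t)) \<longlonglongrightarrow> 0"
  proof (rule tendsto_0_ennreal_le)
    fix i
    have "moment p T (\<lambda>t. iXB (u (\<sigma> (\<phi> i)) t) - g t) \<le> ennreal (2 powr p) *
        (moment p T (\<lambda>t. iXB (u (\<sigma> (\<phi> i)) t) - iXB (v (\<sigma> (\<phi> i)) t)) + moment p T (\<lambda>t. iXB (v (\<sigma> (\<phi> i)) t) - g t))"
      using p by (intro moment_triangle iu_meas iv_meas g) auto
    also have "\<dots> \<le> ennreal (2 powr p) *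
        (ennreal (E powr (p - 1)) * ennreal (\<delta> (\<sigma> (\<phi> i))) + moment p T (\<lambda>t. iXB (v (\<sigma> (\<phi> i)) t) - g t))"
      by (intro mult_left_mono add_mono err) auto
    finally show "moment p T (\<lambda>t. iXB (u (\<sigma> (\<phi> i)) t) - g t) \<le> ennreal (2 powr p) *
        (ennreal (E powr (p - 1)) * ennreal (\<delta> (\<sigma> (\<phi> i))) + moment p T (\<lambda>t. iXB (v (\<sigma> (\<phi> i)) t) - g t))" .
  next
    have "(\<lambda>i. ennreal (2 powr p) * (ennreal (E powr (p - 1)) * ennreal (\<delta> (\<sigma> (\<phi> i))) + moment p T (\<lambda>t. iXB (v (\<sigma> (\<phi> i)) t) - g t)))
        \<longlonglongrightarrow> ennreal (2 powr p) * (ennreal (E powr (p - 1)) * ennreal 0 + 0)"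
      by (intro ennreal_tendsto_cmult tendsto_add d0 lim) auto
    then show "(\<lambda>i. ennreal (2 powr p) * (ennreal (E powr (p - 1)) * ennreal (\<delta> (\<sigma> (\<phi> i))) + moment p T (\<lambda>t. iXB (v (\<sigma> (\<phi> i)) t) - g t))) \<longlonglongrightarrow> 0"
      by simp
  qed
  then show ?thesis using that \<phi> g lim by blast
qed

lemma relatively_compact_same_exponent:
  assumes p: "p \<ge> 1" and A: "\<And>k. moment p T (v k) \<le> ennreal A" and u: "\<And>k. moment p T (u k) < \<infinity>"
  shows "relatively_compact_Lp (ereal p) T (range (\<lambda>k t. iXB (u k t)))"
proof (rule relatively_compact_range)
  obtain KX where KX: "\<And>w. norm (iXB w) \<le> norm w * KX" "KX \<ge> 0" using bounded_linear.nonneg_bounded[OF lX] by blast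
  show "(\<lambda>t. iXB (u k t)) \<in> Lp_space (ereal p) T" for k
  proof -
    have [measurable]: "(\<lambda>t. norm (u k t)) \<in> borel_measurable (time_measure T)" by (rule strongly_measurable_norm[OF u_meas])
    have "moment p T (\<lambda>t. iXB (u k t)) \<le> (\<integral>\<^sup>+t. ennreal (KX powr p) * ennreal (norm (u k t) powr p) \<partial>time_measure T)"
      unfolding moment_def
    proof (rule nn_integral_mono)
      fix t
      have "norm (iXB (u k t)) powr p \<le> (KX * norm (u k t)) powr p"
        using KX(1)[of "u k t"] p by (intro powr_mono2) (auto simp: mult.commute)
      then show "ennreal (norm (iXB (u k t)) powr p) \<le> ennreal (KX powr p) * ennreal (norm (u k t) powr p)"
        using KX(2) by (simp add: ennreal_mult'[symmetric] powr_mult ennreal_leI)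
    qed
    also have "\<dots> = ennreal (KX powr p) * moment p T (u k)" unfolding moment_def by (simp add: nn_integral_cmult)
    also have "\<dots> < \<infinity>" using u[of k] by (simp add: ennreal_mult_less_top)
    finally show ?thesis unfolding Lp_space_iff_moment using iu_meas by auto
  qed
  show "\<exists>\<phi> g. strict_mono (\<phi> :: nat \<Rightarrow> nat) \<and> strongly_measurable (time_measure T) g \<and>
      (\<lambda>i. moment p T (\<lambda>t. iXB (u (\<sigma> (\<phi> i)) t) - g t)) \<longlonglongrightarrow> 0" if "filterlim \<sigma> at_top sequentially" for \<sigma>
    by (rule compactness[OF p A that]) blast
qed (use p in auto)

text \<open>
  Above the integrability in the first space, compactness comes from compactness in \<open>L\<^sup>1\<close> and a bound in
  a slightly better Lebesgue space.
\<close>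

lemma relatively_compact_lower_exponent:
  assumes A: "\<And>k. moment 1 T (v k) \<le> ennreal A" and C: "\<And>k. moment c T (\<lambda>t. iXB (u k t)) \<le> ennreal C"
    and q: "1 \<le> q" "q < c"
  shows "relatively_compact_Lp (ereal q) T (range (\<lambda>k t. iXB (u k t)))"
proof (rule relatively_compact_range)
  show "(\<lambda>t. iXB (u k t)) \<in> Lp_space (ereal q) T" for k
  proof -
    have "moment q T (\<lambda>t. iXB (u k t)) \<le> ennreal (1 powr (q - 0)) * moment 0 T (\<lambda>t. iXB (u k t))
        + ennreal (1 powr (q - c)) * moment c T (\<lambda>t. iXB (u k t))"
      using q by (intro moment_interpolate iu_meas) auto
    also have "\<dots> \<le> ennreal (1 powr (q - 0)) * ennreal T + ennreal (1 powr (q - c)) * ennreal C"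
      using T by (intro add_mono mult_left_mono moment_0_le C) auto
    also have "\<dots> < \<infinity>" by (simp add: ennreal_mult_less_top)
    finally show ?thesis unfolding Lp_space_iff_moment using iu_meas by auto
  qed
  show "\<exists>\<phi> g. strict_mono (\<phi> :: nat \<Rightarrow> nat) \<and> strongly_measurable (time_measure T) g \<and>
      (\<lambda>i. moment q T (\<lambda>t. iXB (u (\<sigma> (\<phi> i)) t) - g t)) \<longlonglongrightarrow> 0" if \<sigma>: "filterlim \<sigma> at_top sequentially" for \<sigma>
  proof -
    obtain \<phi> g where \<phi>: "strict_mono (\<phi> :: nat \<Rightarrow> nat)" and g: "strongly_measurable (time_measure T) g"
      and lim: "(\<lambda>i. moment 1 T (\<lambda>t. iXB (u (\<sigma> (\<phi> i)) t) - g t)) \<longlonglongrightarrow> 0"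
      using compactness[OF order_refl A \<sigma>] by blast
    have "(\<lambda>i. moment q T (\<lambda>t. iXB (u (\<sigma> (\<phi> i)) t) - g t)) \<longlonglongrightarrow> 0"
      using T q by (intro moment_converges_interpolate(2)[OF iu_meas g lim C]) auto
    then show ?thesis using \<phi> g by blast
  qed
qed (use q in auto)

lemma u_bounded:
  assumes v: "\<And>k t. 0 \<le> t \<Longrightarrow> t \<le> T \<Longrightarrow> norm (v k t) \<le> M"
  obtains C where "C \<ge> 0" "\<And>k. AE t in time_measure T. norm (iXB (u k t)) \<le> C"
proof -
  obtain KX where KX: "\<And>w. norm (iXB w) \<le> norm w * KX" "KX \<ge> 0" using bounded_linear.nonneg_bounded[OF lX] by blast
  have "AE t in time_measure T. norm (iXB (u k t)) \<le> \<bar>M * KX + E\<bar>" for k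
    using err_bounded[of k] AE_space
  proof eventually_elim
    case (elim t)
    have "norm (iXB (v k t)) \<le> M * KX" using KX(1)[of "v k t"] v[of t k] elim(2) KX(2) by (auto intro: order_trans mult_right_mono)
    then show ?case using elim(1) norm_triangle_ineq[of "iXB (v k t)" "iXB (u k t - v k t)"] by (simp add: iXB_diff)
  qed
  then show ?thesis using that[of "\<bar>M * KX + E\<bar>"] by auto
qed

text \<open>
  The functions are bounded in the first space and equicontinuous into the third; Ehrling's inequality
  transfers equicontinuity to the middle space.
\<close>

lemma equicontinuous:
  assumes v: "\<And>k t. 0 \<le> t \<Longrightarrow> t \<le> T \<Longrightarrow> norm (v k t) \<le> M" and M: "M \<ge> 0" and \<alpha>: "\<alpha> > 0" and e: "e > 0"
  shows "\<exists>d>0. \<forall>k. \<forall>s\<in>{0..T}. \<forall>t\<in>{0..T}. \<bar>t - s\<bar> < d \<longrightarrow> norm (iXB (v k t) - iXB (v k s)) \<le> e"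
proof -
  define \<epsilon> where "\<epsilon> = e / (4 * (M + 1))"
  have \<epsilon>: "\<epsilon> > 0" unfolding \<epsilon>_def using e M by simp
  have \<epsilon>M: "\<epsilon> * (2 * M) \<le> e / 2" unfolding \<epsilon>_def using e M by (simp add: field_simps)
  obtain C where C: "C \<ge> 0" "\<And>w. norm (iXB w) \<le> \<epsilon> * norm w + C * norm (iBY (iXB w))" using Ehrling[OF XB BY \<epsilon>] by blast
  define d where "d = (e / (2 * (C * D + 1))) powr (1 / \<alpha>)"
  have CD: "C * D \<ge> 0" using C D by simp
  have d: "d > 0" unfolding d_def using e CD by simp
  have da: "C * (D * d powr \<alpha>) \<le> e / 2"
  proof -
    have "d powr \<alpha> = e / (2 * (C * D + 1))" unfolding d_def using \<alpha> e CD by (simp add: powr_powr)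
    then have "C * (D * d powr \<alpha>) = e / 2 * (C * D / (C * D + 1))" using CD by simp
    also have "\<dots> \<le> e / 2 * 1" using e CD by (intro mult_left_mono) auto
    finally show ?thesis by simp
  qed
  have main: "norm (iXB (v k t) - iXB (v k s)) \<le> e" if "0 \<le> s" "s \<le> t" "t \<le> T" "t - s < d" for k s t
  proof -
    have "norm (iBY (iXB (v k t - v k s))) \<le> D * (t - s) powr \<alpha>"
      using increment[OF that(1-3), of k] modulus[OF that(1-3), of k] lB by (simp add: iXB_diff linear_simps(2))
    also have "\<dots> \<le> D * d powr \<alpha>" using that \<alpha> D by (intro mult_left_mono powr_mono2) auto
    finally have Y: "norm (iBY (iXB (v k t - v k s))) \<le> D * d powr \<alpha>" .
    have "norm (v k t - v k s) \<le> 2 * M" using v[of t k] v[of s k] that norm_triangle_ineq4[of "v k t" "v k s"] by auto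
    then have "norm (iXB (v k t - v k s)) \<le> \<epsilon> * (2 * M) + C * (D * d powr \<alpha>)"
      using C Y \<epsilon> by (intro order_trans[OF C(2)] add_mono mult_left_mono) auto
    then show ?thesis using \<epsilon>M da by (simp add: iXB_diff)
  qed
  have "norm (iXB (v k t) - iXB (v k s)) \<le> e" if "s \<in> {0..T}" "t \<in> {0..T}" "\<bar>t - s\<bar> < d" for k s t
  proof (cases "s \<le> t")
    case True
    then show ?thesis using main[of s t k] that by auto
  next
    case False
    then show ?thesis using main[of t s k] that by (auto simp: norm_minus_commute)
  qed
  then show ?thesis using d by blast
qed

lemma converges_to_continuous:
  assumes v: "\<And>k t. 0 \<le> t \<Longrightarrow> t \<le> T \<Longrightarrow> norm (v k t) \<le> M" and M: "M \<ge> 0" and \<alpha>: "\<alpha> > 0"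
  obtains \<phi> G where "strict_mono (\<phi> :: nat \<Rightarrow> nat)" "continuous_on {0..T} G"
    "\<And>q. 1 \<le> q \<Longrightarrow> converges_Lp (ereal q) T (\<lambda>k t. iXB (u (\<phi> k) t)) G"
proof -
  have "moment 1 T (v k) \<le> ennreal (M powr 1 * T)" for k
    using v T by (intro moment_bounded AE_I2) auto
  note A = this
  obtain \<phi> g where \<phi>: "strict_mono (\<phi> :: nat \<Rightarrow> nat)" and g: "strongly_measurable (time_measure T) g"
    and lv: "(\<lambda>i. moment 1 T (\<lambda>t. iXB (v (\<phi> i) t) - g t)) \<longlonglongrightarrow> 0"
    and lu: "(\<lambda>i. moment 1 T (\<lambda>t. iXB (u (\<phi> i) t) - g t)) \<longlonglongrightarrow> 0"
    by (rule compactness[OF order_refl A filterlim_ident]) blast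
  obtain \<psi> :: "nat \<Rightarrow> nat" where \<psi>: "strict_mono \<psi>" and ae: "AE t in time_measure T. (\<lambda>i. iXB (v (\<phi> (\<psi> i)) t)) \<longlonglongrightarrow> g t"
    using moment_1_AE_subseq[OF iv_meas g lv] by blast
  have eq: "\<exists>d>0. \<forall>i. \<forall>s\<in>{0..T}. \<forall>t\<in>{0..T}. \<bar>t - s\<bar> < d \<longrightarrow> norm (iXB (v (\<phi> (\<psi> i)) t) - iXB (v (\<phi> (\<psi> i)) s)) \<le> e"
    if "e > 0" for e
    using equicontinuous[OF v M \<alpha> that] by blast
  obtain G where G: "continuous_on {0..T} G" "AE t in time_measure T. g t = G t"
    using AE_convergent_equicontinuous[OF T eq ae] by blast
  have mG: "strongly_measurable (time_measure T) G" by (rule strongly_measurable_continuous[OF G(1) T])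
  have "moment 1 T (\<lambda>t. iXB (u (\<phi> i) t) - g t) = moment 1 T (\<lambda>t. iXB (u (\<phi> i) t) - G t)" for i
    using G(2) by (intro moment_cong_AE, eventually_elim) simp
  with lu have lG: "(\<lambda>i. moment 1 T (\<lambda>t. iXB (u (\<phi> i) t) - G t)) \<longlonglongrightarrow> 0" by simp
  obtain C where C: "C \<ge> 0" "\<And>k. AE t in time_measure T. norm (iXB (u k t)) \<le> C" using u_bounded[OF v] by blast
  have mom: "moment q T (\<lambda>t. iXB (u k t)) \<le> ennreal (C powr q * T)" if "q \<ge> 0" for q k
    using T that by (intro moment_bounded C(2)) auto
  have "converges_Lp (ereal q) T (\<lambda>k t. iXB (u (\<phi> k) t)) G" if q: "1 \<le> q" for q
  proof (rule converges_Lp_of_moment)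
    have bd: "moment (q + 1) T (\<lambda>t. iXB (u (\<phi> k) t)) \<le> ennreal (C powr (q + 1) * T)" for k using q by (intro mom) auto
    have T0: "T \<ge> 0" using T by simp
    note conv = moment_converges_interpolate[OF iu_meas mG lG bd q _ T0]
    show "G \<in> Lp_space (ereal q) T" unfolding Lp_space_iff_moment using mG conv(1) by auto
    show "(\<lambda>k. moment q T (\<lambda>t. iXB (u (\<phi> k) t) - G t)) \<longlonglongrightarrow> 0" using conv(2) by auto
    show "(\<lambda>t. iXB (u (\<phi> k) t)) \<in> Lp_space (ereal q) T" for k
      unfolding Lp_space_iff_moment using iu_meas mom[of q "\<phi> k"] q by (auto intro: le_less_trans)
  qed (use q in auto)
  then show ?thesis using that \<phi> G(1) by blast
qed

text \<open>
  The pointwise bound across scales integrates to a bound in \<open>L\<^sup>c\<close> with \<open>c = 1 / \<beta>\<close>.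
\<close>

lemma moment_interpolation_bound:
  assumes p: "p \<ge> 1" and A: "\<And>k. moment p T (v k) \<le> ennreal A" "A > 0"
    and \<eta>: "0 < \<eta>" "\<eta> < 1" and C\<eta>: "C\<eta> > 0"
    and interp: "\<And>w. norm (iXB w) \<le> C\<eta> * norm w powr \<eta> * norm (iBY (iXB w)) powr (1 - \<eta>)"
    and \<beta>: "\<beta> > 0" "\<eta> / p - (1 - \<eta>) * \<alpha> \<le> \<beta>"
  obtains C where "\<And>k. moment (1 / \<beta>) T (\<lambda>t. iXB (u k t)) \<le> ennreal C"
proof -
  obtain B where B: "B \<ge> 0" and pw: "\<And>w t. continuous_on {0..T} w \<Longrightarrow> moment p T w \<le> ennreal A \<Longrightarrow>
       (\<And>s t. 0 \<le> s \<Longrightarrow> s \<le> t \<Longrightarrow> t \<le> T \<Longrightarrow> norm (iBY (iXB (w t)) - iBY (iXB (w s))) \<le> D * (t - s) powr \<alpha>) \<Longrightarrow>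
       0 < t \<Longrightarrow> t < T \<Longrightarrow> norm (iXB (w t)) \<le> B * (1 + norm (w t) powr (p * \<beta>))"
    using multiscale_interpolation[OF lX lB T p A(2) D \<alpha> \<eta> \<beta> interp C\<eta>] by blast
  define c where "c = 1 / \<beta>"
  have c: "c > 0" unfolding c_def using \<beta> by simp
  have H: "norm (iBY (iXB (v k t)) - iBY (iXB (v k s))) \<le> D * (t - s) powr \<alpha>" if "0 \<le> s" "s \<le> t" "t \<le> T" for k s t
    using increment[OF that, of k] modulus[OF that, of k] by linarith
  define b where "b = 2 powr c * B powr c"
  have bv: "moment c T (\<lambda>t. iXB (v k t)) \<le> ennreal (b * (T + A))" for k
  proof -
    have [measurable]: "(\<lambda>t. norm (v k t)) \<in> borel_measurable (time_measure T)" by (rule strongly_measurable_norm[OF v_meas])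
    have "moment c T (\<lambda>t. iXB (v k t)) \<le> (\<integral>\<^sup>+t. ennreal b * (1 + ennreal (norm (v k t) powr p)) \<partial>time_measure T)"
      unfolding moment_def
    proof (rule nn_integral_mono)
      fix t assume t: "t \<in> space (time_measure T)"
      have "norm (iXB (v k t)) \<le> B * (1 + norm (v k t) powr (p * \<beta>))"
        using t by (intro pw v_cont A H) auto
      then have "norm (iXB (v k t)) powr c \<le> (B * (1 + norm (v k t) powr (p * \<beta>))) powr c"
        using c by (intro powr_mono2) auto
      also have "\<dots> = B powr c * (1 + norm (v k t) powr (p * \<beta>)) powr c" using B by (simp add: powr_mult)
      also have "\<dots> \<le> B powr c * (2 powr c * (1 powr c + (norm (v k t) powr (p * \<beta>)) powr c))"
        using c by (intro mult_left_mono powr_add_le) auto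
      also have "(norm (v k t) powr (p * \<beta>)) powr c = norm (v k t) powr p" unfolding c_def using \<beta> by (simp add: powr_powr)
      finally have "norm (iXB (v k t)) powr c \<le> b * (1 + norm (v k t) powr p)" unfolding b_def by (simp add: algebra_simps)
      then have "ennreal (norm (iXB (v k t)) powr c) \<le> ennreal (b * (1 + norm (v k t) powr p))" by (rule ennreal_leI)
      also have "\<dots> = ennreal b * (1 + ennreal (norm (v k t) powr p))"
        unfolding b_def by (simp add: ennreal_mult' ennreal_plus del: ennreal_plus[symmetric] flip: ennreal_1)
      finally show "ennreal (norm (iXB (v k t)) powr c) \<le> ennreal b * (1 + ennreal (norm (v k t) powr p))" .
    qed
    also have "\<dots> = ennreal b * (ennreal T + moment p T (v k))"
      unfolding moment_def using T by (simp add: nn_integral_cmult nn_integral_add emeasure_restrict_space)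
    also have "\<dots> \<le> ennreal b * (ennreal T + ennreal A)" by (intro mult_left_mono add_left_mono A) auto
    also have "\<dots> = ennreal (b * (T + A))" unfolding b_def using T A by (simp add: ennreal_mult' ennreal_plus)
    finally show ?thesis .
  qed
  have "moment c T (\<lambda>t. iXB (u k t)) \<le> ennreal (2 powr c * (E powr c * T + b * (T + A)))" for k
  proof -
    have "moment c T (\<lambda>t. iXB (u k t) - 0) \<le> ennreal (2 powr c * (E powr c * T + b * (T + A)))"
    proof (rule moment_triangle_le[OF iu_meas iv_meas])
      show "moment c T (\<lambda>t. iXB (u k t) - iXB (v k t)) \<le> ennreal (E powr c * T)"
        unfolding iXB_diff[symmetric] using T c by (intro moment_bounded err_bounded) auto
      show "moment c T (\<lambda>t. iXB (v k t) - 0) \<le> ennreal (b * (T + A))" using bv[of k] by simp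
    qed (use T A c in \<open>auto simp: b_def intro!: strongly_measurable_simple\<close>)
    then show ?thesis by simp
  qed
  then show ?thesis using that unfolding c_def by blast
qed

end

section \<open>Compactness of discontinuous piecewise polynomial approximations\<close>

theorem theorem2p2:
  fixes T :: real and l :: nat
    and iXB :: "'x::banach \<Rightarrow> 'b::banach" and iBY :: "'b \<Rightarrow> 'y::banach"
    and u0 :: 'x
    and N :: "nat \<Rightarrow> nat" and \<nu> :: "nat \<Rightarrow> nat \<Rightarrow> real"
    and Xs :: "nat \<Rightarrow> 'x set" and u :: "nat \<Rightarrow> real \<Rightarrow> 'x"
    and p r :: ereal and Cstar CJ :: real
  assumes T_pos: "T > 0"
    and embXB: "compact_embedding iXB"
    and embBY: "continuous_embedding iBY"
    and partitions: "\<And>k. time_partition T (N k) (\<nu> k)"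
    and mesh: "(\<lambda>k. max_time_step (N k) (\<nu> k)) \<longlonglongrightarrow> 0"
    and Cstar_pos: "Cstar > 0"
    and step_ratio: "\<And>k n. n \<in> {2..N k} \<Longrightarrow> time_step (\<nu> k) n / time_step (\<nu> k) (n - 1) \<le> Cstar"
    and subspaces: "\<And>k. subspace (Xs k)"
    and u_poly: "\<And>k. u k \<in> piecewise_poly T (N k) (\<nu> k) l (Xs k)"
    and p_ge: "1 \<le> p" and r_ge: "1 \<le> r"
    and h1: "uniformly_bounded_Lp p T u"
    and h2: "uniformly_bounded_Lp r T
               (\<lambda>k t. iBY (iXB (reconstruction_deriv (\<nu> k) l u0 (u k) t)))"
    and CJ_pos: "CJ > 0"
    and h3: "\<And>k. (\<Sum>n=1..N k. (norm (iXB (time_jump (\<nu> k) u0 (u k) (n - 1))))\<^sup>2) \<le> CJ"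
  shows
    "(p < \<infinity> \<longrightarrow> relatively_compact_Lp p T (range (\<lambda>k t. iXB (u k t)))) \<and>
     (p = \<infinity> \<and> r > 1 \<longrightarrow>
        (\<exists>\<phi> g. strict_mono (\<phi> :: nat \<Rightarrow> nat) \<and> continuous_on {0..T} g \<and>
           (\<forall>q::real. 1 \<le> q \<longrightarrow> converges_Lp (ereal q) T (\<lambda>k t. iXB (u (\<phi> k) t)) g))) \<and>
     (\<forall>\<theta> C\<theta>. continuous_embedding iXB \<and> continuous_embedding iBY \<and>
        compact_embedding (iBY \<circ> iXB) \<and> 0 < \<theta> \<and> \<theta> < 1 \<and> C\<theta> > 0 \<and>
        (\<forall>w. norm (iXB w) \<le> C\<theta> * norm w powr \<theta> * norm (iBY (iXB w)) powr (1 - \<theta>)) \<and>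
        exponents_compatible \<theta> p r \<longrightarrow>
          (\<forall>q::real. 1 \<le> q \<and> below_critical_exponent \<theta> p r q \<longrightarrow>
             relatively_compact_Lp (ereal q) T (range (\<lambda>k t. iXB (u k t)))))"
proof -
  have lX: "bounded_linear iXB" and lB: "bounded_linear iBY"
    using embXB embBY unfolding compact_embedding_def continuous_embedding_def by auto
  have lXY: "bounded_linear (\<lambda>x. iBY (iXB x))" by (rule bounded_linear_compose[OF lB lX])
  obtain K where K0: "K \<ge> 0"
    and K: "\<And>\<nu> n t. \<nu> (n - 1) < \<nu> n \<Longrightarrow> t \<in> {\<nu> (n - 1)..\<nu> n} \<Longrightarrow> \<bar>1 - profile_on \<nu> l n t\<bar> \<le> K"
    using ex_profile_bound[of l] by blast
  have "\<exists>U. reconstruction_setup T (N k) (\<nu> k) l (u k) U" for k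
    using piecewise_poly_setup[OF partitions u_poly] by blast
  then obtain U where U: "\<And>k. reconstruction_setup T (N k) (\<nu> k) l (u k) (U k)" by metis
  define v where "v k = reconstruction (\<nu> k) l u0 (u k)" for k
  obtain C1 where C1: "\<And>k. u k \<in> Lp_space p T" "\<And>k. Lp_norm p T (u k) \<le> C1"
    using h1 unfolding uniformly_bounded_Lp_def by blast
  define w where "w k t = iBY (iXB (reconstruction_deriv (\<nu> k) l u0 (u k) t))" for k t
  obtain C2 where C2: "\<And>k. w k \<in> Lp_space r T" "\<And>k. Lp_norm r T (w k) \<le> C2"
    using h2 unfolding uniformly_bounded_Lp_def w_def[abs_def] by blast
  have um: "strongly_measurable (time_measure T) (u k)" for k using C1(1)[of k] unfolding Lp_space_def by simp
  have [measurable]: "(\<lambda>t. norm (w k t)) \<in> borel_measurable (time_measure T)" for k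
    using C2(1)[of k] unfolding Lp_space_def by (auto intro: strongly_measurable_norm)
  define \<alpha> where "\<alpha> = 1 - real_of_ereal (1 / r)"
  have \<alpha>0: "\<alpha> \<ge> 0" and \<alpha>1: "1 < r \<Longrightarrow> \<alpha> > 0"
    unfolding \<alpha>_def using r_ge by (cases r; simp add: one_ereal_def)+
  define D where "D = 1 + \<bar>C2\<bar> + \<bar>C2\<bar> powr real_of_ereal r"
  have D0: "D \<ge> 0" unfolding D_def by simp
  \<comment> \<open>the mass of the derivative over \<open>[s,t)\<close>; its primitive \<open>\<theta> k\<close> controls the increments\<close>
  define I where "I k s t = (\<integral>\<^sup>+x. ennreal (norm (w k x)) * indicator {s..<t} x \<partial>time_measure T)" for k s t
  have I_le: "I k s t \<le> ennreal (D * (t - s) powr \<alpha>)" if "0 \<le> s" "s \<le> t" "t \<le> T" for k s t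
    unfolding I_def D_def \<alpha>_def by (rule Lp_bound_short_interval[OF C2 r_ge that])
  have I_add: "I k 0 t = I k 0 s + I k s t" if "0 \<le> s" "s \<le> t" for k s t
  proof -
    have "I k 0 t = (\<integral>\<^sup>+x. ennreal (norm (w k x)) * indicator {0..<s} x
        + ennreal (norm (w k x)) * indicator {s..<t} x \<partial>time_measure T)"
      unfolding I_def using that by (intro nn_integral_cong) (auto simp: indicator_def)
    also have "\<dots> = I k 0 s + I k s t" unfolding I_def by (rule nn_integral_add) measurable
    finally show ?thesis .
  qed
  have I_fin: "I k s t < top" if "0 \<le> s" "s \<le> t" "t \<le> T" for k s t
    using I_le[OF that, of k] by (rule le_less_trans) simp
  define \<theta> where "\<theta> k t = enn2real (I k 0 t)" for k t
  have \<theta>_diff: "\<theta> k t - \<theta> k s = enn2real (I k s t)" if "0 \<le> s" "s \<le> t" "t \<le> T" for k s t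
  proof -
    have "I k 0 s < top" using that by (intro I_fin) auto
    then show ?thesis unfolding \<theta>_def I_add[OF that(1,2)] using I_fin[OF that] by (simp add: enn2real_plus)
  qed
  have modulus: "\<theta> k t - \<theta> k s \<le> D * (t - s) powr \<alpha>" if "0 \<le> s" "s \<le> t" "t \<le> T" for k s t
    unfolding \<theta>_diff[OF that] using I_le[OF that] D0 by (intro enn2real_leI) auto
  have incr: "norm (iBY (iXB (v k t)) - iBY (iXB (v k s))) \<le> \<theta> k t - \<theta> k s"
    if st: "0 \<le> s" "s \<le> t" "t \<le> T" for k s t
  proof -
    have "(\<integral>\<^sup>+x. ennreal (norm (w k x)) \<partial>time_measure T) = I k 0 T"
      unfolding I_def by (intro nn_integral_cong) (simp add: indicator_def)
    then have fin: "(\<integral>\<^sup>+x. ennreal (norm (w k x)) \<partial>time_measure T) < \<infinity>" using I_fin[of 0 T k] T_pos by simp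
    have "ennreal (norm (iBY (iXB (v k t)) - iBY (iXB (v k s)))) \<le> I k s t"
      unfolding I_def v_def w_def
      by (rule reconstruction_setup.reconstruction_increment[OF U lXY _ _ st]) (use fin in \<open>simp_all add: w_def[symmetric]\<close>)
    also have "I k s t = ennreal (\<theta> k t - \<theta> k s)" unfolding \<theta>_diff[OF st] using I_fin[OF st] by simp
    finally show ?thesis unfolding \<theta>_diff[OF st] by simp
  qed
  define \<delta> where "\<delta> k = K * (CJ + T) * sqrt (max_time_step (N k) (\<nu> k))" for k
  have "(\<lambda>k. K * (CJ + T) * sqrt (max_time_step (N k) (\<nu> k))) \<longlonglongrightarrow> K * (CJ + T) * sqrt 0"
    by (intro tendsto_intros mesh)
  then have \<delta>0: "\<delta> \<longlonglongrightarrow> 0" unfolding \<delta>_def[abs_def] by simp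
  interpret F: reconstructed_family T iXB iBY u v \<theta> \<delta> D \<alpha> "K * sqrt CJ"
  proof
    show "continuous_on {0..T} (v k)" for k
      unfolding v_def by (rule reconstruction_setup.reconstruction_continuous[OF U])
    show "AE t in time_measure T. norm (iXB (u k t - v k t)) \<le> K * sqrt CJ"
      "moment 1 T (\<lambda>t. iXB (u k t - v k t)) \<le> ennreal (\<delta> k)" for k
      unfolding v_def \<delta>_def using reconstruction_setup.error_estimates[OF U lX K K0 um h3, of k] by auto
  qed (use T_pos embXB embBY um incr modulus D0 \<alpha>0 \<delta>0 in auto)
  have finite_p: "\<exists>A>0. (\<forall>k. moment p' T (v k) \<le> ennreal A) \<and> (\<forall>k. moment p' T (u k) < \<infinity>)"
    if p': "p = ereal p'" "p' \<ge> 1" for p'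
  proof -
    define A0 where "A0 = C1 powr p'"
    have uA: "moment p' T (u k) \<le> ennreal A0" for k
      unfolding A0_def using C1 p' by (intro moment_le_of_Lp_norm) auto
    define A where "A = 2 powr p' * (inverse_const l p' * A0
      + K powr p' * (2 powr p' * (inverse_const l p' * A0 + (T * norm u0 powr p' + Cstar * (inverse_const l p' * A0)))))"
    have "moment p' T (v k) \<le> ennreal A" for k
      unfolding v_def A_def
      by (rule reconstruction_setup.moment_reconstruction_le[OF U K K0 um p'(2) uA _ step_ratio Cstar_pos]) (auto simp: A0_def)
    then have "moment p' T (v k) \<le> ennreal (\<bar>A\<bar> + 1)" for k by (rule order_trans) (intro ennreal_leI, simp)
    moreover have "moment p' T (u k) < \<infinity>" for k using uA[of k] by (rule le_less_trans) simp
    ultimately show ?thesis by (intro exI[of _ "\<bar>A\<bar> + 1"]) auto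
  qed
  have infinite_p: "\<exists>M\<ge>0. \<forall>k t. 0 \<le> t \<longrightarrow> t \<le> T \<longrightarrow> norm (v k t) \<le> M" if p': "p = \<infinity>"
  proof -
    have bd: "AE t in time_measure T. norm (u k t) \<le> \<bar>C1\<bar>" for k
      using C1 p' by (intro AE_bound_of_Lp_norm_infinity) auto
    have "norm (v k t) \<le> \<bar>C1\<bar> + K * (2 * \<bar>C1\<bar> + norm u0)" if "0 \<le> t" "t \<le> T" for k t
      unfolding v_def by (rule reconstruction_setup.reconstruction_bounded[OF U K K0 bd _ that]) simp_all
    moreover have "0 \<le> \<bar>C1\<bar> + K * (2 * \<bar>C1\<bar> + norm u0)" using K0 by simp
    ultimately show ?thesis by blast
  qed
  show ?thesis
  proof (intro conjI allI impI)
    assume "p < \<infinity>"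
    then obtain p' where p': "p = ereal p'" "p' \<ge> 1" using p_ge by (cases p) auto
    obtain A where "\<And>k. moment p' T (v k) \<le> ennreal A" "\<And>k. moment p' T (u k) < \<infinity>" using finite_p[OF p'] by blast
    then show "relatively_compact_Lp p T (range (\<lambda>k t. iXB (u k t)))"
      unfolding p'(1) by (rule F.relatively_compact_same_exponent[OF p'(2)])
  next
    assume *: "p = \<infinity> \<and> r > 1"
    then obtain M where M: "M \<ge> 0" "\<And>k t. 0 \<le> t \<Longrightarrow> t \<le> T \<Longrightarrow> norm (v k t) \<le> M" using infinite_p by blast
    have "\<alpha> > 0" using * \<alpha>1 by simp
    then obtain \<phi> G where "strict_mono (\<phi> :: nat \<Rightarrow> nat)" "continuous_on {0..T} G"
      "\<And>q. 1 \<le> q \<Longrightarrow> converges_Lp (ereal q) T (\<lambda>k t. iXB (u (\<phi> k) t)) G"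
      using F.converges_to_continuous[OF M(2) M(1)] by blast
    then show "\<exists>\<phi> g. strict_mono (\<phi> :: nat \<Rightarrow> nat) \<and> continuous_on {0..T} g \<and>
        (\<forall>q::real. 1 \<le> q \<longrightarrow> converges_Lp (ereal q) T (\<lambda>k t. iXB (u (\<phi> k) t)) g)" by blast
  next
    fix \<eta> C\<eta> q :: real
    assume A3: "continuous_embedding iXB \<and> continuous_embedding iBY \<and>
        compact_embedding (iBY \<circ> iXB) \<and> 0 < \<eta> \<and> \<eta> < 1 \<and> C\<eta> > 0 \<and>
        (\<forall>w. norm (iXB w) \<le> C\<eta> * norm w powr \<eta> * norm (iBY (iXB w)) powr (1 - \<eta>)) \<and>
        exponents_compatible \<eta> p r"
      and q: "1 \<le> q \<and> below_critical_exponent \<eta> p r q"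
    show "relatively_compact_Lp (ereal q) T (range (\<lambda>k t. iXB (u k t)))"
    proof (cases "p = \<infinity>")
      case True
      then obtain M where M: "M \<ge> 0" "\<And>k t. 0 \<le> t \<Longrightarrow> t \<le> T \<Longrightarrow> norm (v k t) \<le> M" using infinite_p by blast
      obtain C where C: "C \<ge> 0" "\<And>k. AE t in time_measure T. norm (iXB (u k t)) \<le> C" using F.u_bounded[OF M(2)] by blast
      show ?thesis
      proof (rule F.relatively_compact_lower_exponent)
        show "moment 1 T (v k) \<le> ennreal (M powr 1 * T)" for k using M T_pos by (intro moment_bounded AE_I2) auto
        show "moment (q + 1) T (\<lambda>t. iXB (u k t)) \<le> ennreal (C powr (q + 1) * T)" for k
          using T_pos q by (intro moment_bounded C(2)) auto
      qed (use q in auto)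
    next
      case False
      then obtain p' where p': "p = ereal p'" "p' \<ge> 1" using p_ge by (cases p) auto
      obtain A where A: "A > 0" "\<And>k. moment p' T (v k) \<le> ennreal A" using finite_p[OF p'] by blast
      \<comment> \<open>the reciprocal of the critical exponent\<close>
      define \<gamma> where "\<gamma> = \<eta> / p' - (1 - \<eta>) * \<alpha>"
      have \<gamma>: "\<gamma> < 1 / q"
      proof (cases "r = \<infinity>")
        case True
        then show ?thesis using q p' unfolding below_critical_exponent_def recip_exponent_def \<gamma>_def \<alpha>_def
          by (simp add: one_ereal_def)
      next
        case False
        then obtain r' where r': "r = ereal r'" "r' \<ge> 1" using r_ge by (cases r) auto
        define den where "den = (1 - \<eta>) * (1 - r') * p' + \<eta> * r'"
        have \<alpha>: "\<alpha> = 1 - 1 / r'" unfolding \<alpha>_def using r' by (simp add: one_ereal_def)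
        \<comment> \<open>the denominator in the critical exponent has the sign of \<open>\<gamma>\<close>\<close>
        have den: "den = r' * p' * \<gamma>" unfolding den_def \<gamma>_def \<alpha> using r'(2) p'(2) by (simp add: field_simps)
        have "(r' - 1) * p' / r' \<le> \<eta> / (1 - \<eta>)" using A3 r' p' unfolding exponents_compatible_def by simp
        then have "den \<ge> 0" using A3 r' unfolding den_def by (simp add: field_simps)
        have lt: "ereal q < ereal (r' * p') / ereal den"
          using q r' p' unfolding below_critical_exponent_def den_def by simp
        have rp: "r' * p' > 0" using r'(2) p'(2) by simp
        show ?thesis
        proof (cases "den = 0")
          case True
          then have "\<gamma> = 0" using den rp by auto
          then show ?thesis using q by simp
        next
          case False
          then have "q < r' * p' / den" using lt by simp
          then have "q * (r' * p' * \<gamma>) < r' * p'" using \<open>den \<ge> 0\<close> False unfolding den[symmetric] by (simp add: pos_less_divide_eq)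
          then have "r' * p' * (q * \<gamma>) < r' * p' * 1" by (simp add: algebra_simps)
          then have "q * \<gamma> < 1" using rp by (simp only: mult_less_cancel_left_pos)
          then show ?thesis using q by (simp add: pos_less_divide_eq mult.commute)
        qed
      qed
      \<comment> \<open>\<open>1 / \<beta>\<close> is a finite exponent between \<open>q\<close> and the critical one\<close>
      have "max \<gamma> 0 < 1 / q" using \<gamma> q by simp
      then obtain \<beta> where "max \<gamma> 0 < \<beta>" and \<beta>q: "\<beta> < 1 / q" using dense by blast
      then have \<beta>: "\<beta> > 0" "\<gamma> \<le> \<beta>" by auto
      have interp: "\<And>x. norm (iXB x) \<le> C\<eta> * norm x powr \<eta> * norm (iBY (iXB x)) powr (1 - \<eta>)" using A3 by blast
      obtain C where C: "\<And>k. moment (1 / \<beta>) T (\<lambda>t. iXB (u k t)) \<le> ennreal C"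
        using F.moment_interpolation_bound[OF p'(2) A(2,1) _ _ _ interp \<beta>(1) \<beta>(2)[unfolded \<gamma>_def]] A3 by blast
      show ?thesis
      proof (rule F.relatively_compact_lower_exponent[OF _ C])
        show "moment 1 T (v k) \<le> ennreal (T + A)" for k
        proof -
          have "moment 1 T (v k) \<le> ennreal (1 powr (1 - 0)) * moment 0 T (v k) + ennreal (1 powr (1 - p')) * moment p' T (v k)"
            using p'(2) by (intro moment_interpolate F.v_meas) auto
          also have "\<dots> \<le> ennreal (1 powr (1 - 0)) * ennreal T + ennreal (1 powr (1 - p')) * ennreal A"
            using T_pos A by (intro add_mono mult_left_mono moment_0_le) auto
          also have "\<dots> = ennreal (T + A)" using T_pos A by (simp add: ennreal_plus)
          finally show ?thesis .
        qed
        show "q < 1 / \<beta>" using \<beta> \<beta>q q by (simp add: field_simps)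
      qed (use q in auto)
    qed
  qed
qed

end
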